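(* Let $u_h^{cr}\in K_h^{cr}$ be the discrete primal solution (the unique minimizer of $I_h^{cr}$) and let $z_h^{rt}\in K_h^{rt,*}$ be a discrete dual solution (a maximizer of $D_h^{rt}$). Define $\rho_{I_h^{cr}}^2(v_h):=I_h^{cr}(v_h)-I_h^{cr}(u_h^{cr})$ for $v_h\in K_h^{cr}$ and $\rho_{-D_h^{rt}}^2(y_h):=-D_h^{rt}(y_h)+D_h^{rt}(z_h^{rt})$ for $y_h\in K_h^{rt,*}$. Then: (i) For every $v_h\in K_h^{cr}$, $$\rho_{I_h^{cr}}^2(v_h)=\tfrac12\|\nabla_hv_h-\nabla_hu_h^{cr}\|_{2,\Omega}^2+\Big(\tfrac{|\Pi_hz_h^{rt}|}{\zeta_h}-1,\ \zeta_h^2-\nabla_hu_h^{cr}\cdot\nabla_hv_h\Big)_{\{|\nabla_hu_h^{cr}|=\zeta_h\}}.$$ (ii) For every $y_h\in K_h^{rt,*}$, $$\rho_{-D_h^{rt}}^2(y_h)=\big(D_t^2\phi_h^*\{\Pi_hy_h,\Pi_hz_h^{rt}\}(\Pi_hy_h-\Pi_hz_h^{rt}),\ \Pi_hy_h-\Pi_hz_h^{rt}\big)_\Omega,$$ where, for a.e. $x\in\Omega$ and all $t,s\in\mathbb{R}^d$, $D_t^2\phi_h^*\{t,s\}(x):=\int_0^1(1-\lambda)D_t^2\phi_h^*(x,\lambda t+(1-\lambda)s)\,\mathrm{d}\lambda$.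
   Context: Let $\Omega\subseteq\mathbb{R}^d$, $d\in\mathbb{N}$, be a bounded simplicial Lipschitz domain with $\partial\Omega=\overline\Gamma_D\cup\overline\Gamma_N$, $\Gamma_D,\Gamma_N$ disjoint and relatively open, $|\Gamma_D|>0$. $\mathcal{T}_h$ is a (shape-regular, conforming) simplicial triangulation of $\Omega$; $\mathcal{S}_h$ is the set of its sides (($d-1$)-dimensional faces), $\mathcal{S}_h^i$ the interior sides, $\mathcal{S}_h^{\Gamma_D},\mathcal{S}_h^{\Gamma_N}$ the boundary sides whose relative interior lies in $\Gamma_D$, resp. $\Gamma_N$; every boundary side belongs to exactly one of these two sets. $(v,w)_\omega=\int_\omega v\cdot w$; $\|\cdot\|_{p,\omega}$ is the $L^p(\omega)$-norm. $\mathcal{L}^k(\mathcal{T}_h)$ are the element-wise polynomials of degree $\le k$; $\mathcal{L}^0(\mathcal{S}_h^{\gamma})$ the side-wise constant functions on $\mathcal{S}_h^\gamma$. $\Pi_h$ is the $L^2$-projection onto element-wise constants (element averages, component-wise for vector fields), $\pi_h$ the projection onto side-wise constants (side averages). $\nabla_h$ is the element-wise gradient. $\mathcal{S}^{1,cr}(\mathcal{T}_h)=\{v_h\in\mathcal{L}^1(\mathcal{T}_h):$ the side average of the jump of $v_h$ vanishes on every interior side$\}$ (Crouzeix–Raviart). $\mathcal{R}T^0(\mathcal{T}_h)=\{y_h\in(\mathcal{L}^1(\mathcal{T}_h))^d: y_h|_T\cdot n_T$ is constant on each side of each $T\in\mathcal{T}_h$ and the normal jump of $y_h$ vanishes on every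 interior side$\}$ (lowest-order Raviart–Thomas; on each $T$, $y_h(x)=a_T+b_Tx$ with $a_T\in\mathbb{R}^d,b_T\in\mathbb{R}$). $n$ is the outward unit normal on $\partial\Omega$. Data: $f_h\in\mathcal{L}^0(\mathcal{T}_h)$, $g_h\in\mathcal{L}^0(\mathcal{S}_h^{\Gamma_N})$, $\zeta_h\in\mathcal{L}^0(\mathcal{T}_h)$ with $\operatorname{ess\,inf}_\Omega\zeta_h>0$, $u_D^h\in\mathcal{L}^0(\mathcal{S}_h^{\Gamma_D})$ such that there exists $\widehat u_D^h\in\mathcal{S}^{1,cr}(\mathcal{T}_h)$ with $\pi_h\widehat u_D^h=u_D^h$ on $\Gamma_D$ and $\|\nabla_h\widehat u_D^h/\zeta_h\|_{\infty,\Omega}<1$. For a.e. $x$ and $s\in\mathbb{R}^d$: $\phi_h^*(x,s)=\frac12|s|^2$ if $|s|\le\zeta_h(x)$, $\phi_h^*(x,s)=\zeta_h(x)|s|-\frac12\zeta_h(x)^2$ if $|s|>\zeta_h(x)$. Its (generalized) Hessian in the second argument is $D_t^2\phi_h^*(x,t)=\mathrm{I}_{d\times d}$ if $|t|\le\zeta_h(x)$ and $\frac{\zeta_h(x)}{|t|}\big(\mathrm{I}_{d\times d}-\frac{t\otimes t}{|t|^2}\big)$ if $|t|>\zeta_h(x)$. Discrete primal problem: $K_h^{cr}=\{v_h\in\mathcal{S}^{1,cr}(\mathcal{T}_h):|\nabla_hv_h|\le\zeta_h\text{ a.e. in }\Omega,\ \pi_hv_h=u_D^h\text{ a.e. on }\Gamma_D\}$;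 $I_h^{cr}(v_h)=\frac12\|\nabla_hv_h\|_{2,\Omega}^2-(f_h,\Pi_hv_h)_\Omega-(g_h,\pi_hv_h)_{\Gamma_N}$ if $v_h\in K_h^{cr}$ and $+\infty$ for other $v_h\in\mathcal{S}^{1,cr}(\mathcal{T}_h)$. It has a unique minimizer $u_h^{cr}$. Discrete dual functional: $K_h^{rt,*}=\{y_h\in\mathcal{R}T^0(\mathcal{T}_h):\operatorname{div}y_h=-f_h\text{ a.e. in }\Omega,\ y_h\cdot n=g_h\text{ a.e. on }\Gamma_N\}$; $D_h^{rt}(y_h)=-\int_\Omega\phi_h^*(\cdot,\Pi_hy_h)\,\mathrm{d}x+(y_h\cdot n,u_D^h)_{\Gamma_D}$ if $y_h\in K_h^{rt,*}$ and $-\infty$ for other $y_h\in\mathcal{R}T^0(\mathcal{T}_h)$. $D_h^{rt}$ is the Fenchel dual functional of $I_h^{cr}$. *)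

theory Defs
  imports "HOL-Analysis.Analysis" "HOL-Probability.Essential_Supremum"
begin

text \<open>The argument \<open>x - (x \<bullet> e) *\<^sub>R e\<close> of \<open>\<psi>\<close> stands for the coordinates orthogonal to the direction \<open>e\<close>:
  locally the domain lies strictly below a Lipschitz graph.\<close>

definition lipschitz_domain :: "(real^'n) set \<Rightarrow> bool" where
  "lipschitz_domain \<Omega> \<longleftrightarrow>
     open \<Omega> \<and> connected \<Omega> \<and> \<Omega> \<noteq> {} \<and>
     (\<forall>p\<in>frontier \<Omega>. \<exists>U e L. \<exists>\<psi> :: real^'n \<Rightarrow> real.
        open U \<and> p \<in> U \<and> norm e = 1 \<and> L-lipschitz_on UNIV \<psi> \<and>
        \<Omega> \<inter> U = {x \<in> U. x \<bullet> e < \<psi> (x - (x \<bullet> e) *\<^sub>R e)})"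

text \<open>The library notion \<^const>\<open>triangulation\<close> contains finiteness and conformity (any two
  elements meet in a common, possibly empty, face). The elements are closed simplices.\<close>

definition simplicial_mesh :: "(real^'n) set \<Rightarrow> (real^'n) set set \<Rightarrow> bool" where
  "simplicial_mesh \<Omega> \<T> \<longleftrightarrow>
     triangulation \<T> \<and> (\<forall>T\<in>\<T>. int CARD('n) simplex T) \<and> \<Union>\<T> = closure \<Omega>"

definition sides :: "(real^'n) set set \<Rightarrow> (real^'n) set set" where
  "sides \<T> = {F. \<exists>T\<in>\<T>. F facet_of T}"

definition boundary_sides :: "(real^'n) set \<Rightarrow> (real^'n) set set \<Rightarrow> (real^'n) set set" where
  "boundary_sides \<Omega> \<T> = {F \<in> sides \<T>. F \<subseteq> frontier \<Omega>}"

definition interior_sides :: "(real^'n) set \<Rightarrow> (real^'n) set set \<Rightarrow> (real^'n) set set" where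
  "interior_sides \<Omega> \<T> = sides \<T> - boundary_sides \<Omega> \<T>"

definition sides_in ::
  "(real^'n) set \<Rightarrow> (real^'n) set set \<Rightarrow> (real^'n) set \<Rightarrow> (real^'n) set set" where
  "sides_in \<Omega> \<T> \<gamma> = {F \<in> boundary_sides \<Omega> \<T>. rel_interior F \<subseteq> \<gamma>}"

definition outer_normal :: "(real^'n) set \<Rightarrow> (real^'n) set \<Rightarrow> real^'n" where
  "outer_normal T F = (THE n. norm n = 1 \<and> (\<forall>x\<in>F. \<forall>y\<in>T. n \<bullet> y \<le> n \<bullet> x))"

text \<open>The \<open>(d - 1)\<close>-dimensional Lebesgue measure on the hyperplane \<open>H = affine hull F\<close> spanned by a
  side \<open>F\<close>. Lebesgue measure on the slab of thickness one around \<open>H\<close> is the product of the measure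
  on \<open>H\<close> and of Lebesgue measure on an interval of length one, so the measure on \<open>H\<close> is the image
  of the former under the orthogonal projection onto \<open>H\<close>. For \<open>d = 1\<close> it is the point mass at the
  vertex \<open>F\<close>.\<close>

definition side_measure :: "(real^'n) set \<Rightarrow> (real^'n) measure" where
  "side_measure F =
     completion (distr (restrict_space lborel {x. infdist x (affine hull F) \<le> 1/2}) borel
                       (closest_point (affine hull F)))"

text \<open>The boundary is the union of the boundary sides, which overlap in null sets only; so surface
  measure and surface integrals over a part \<open>\<gamma>\<close> of the boundary are sums over all boundary sides.\<close>

definition boundary_measure ::
  "(real^'n) set \<Rightarrow> (real^'n) set set \<Rightarrow> (real^'n) set \<Rightarrow> real" where
  "boundary_measure \<Omega> \<T> \<gamma> = (\<Sum>F\<in>boundary_sides \<Omega> \<T>. measure (side_measure F) (F \<inter> \<gamma>))"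

definition boundary_inner ::
  "(real^'n) set \<Rightarrow> (real^'n) set set \<Rightarrow> (real^'n) set \<Rightarrow>
   (real^'n \<Rightarrow> real) \<Rightarrow> (real^'n \<Rightarrow> real) \<Rightarrow> real" where
  "boundary_inner \<Omega> \<T> \<gamma> v w =
     (\<Sum>F\<in>boundary_sides \<Omega> \<T>. LINT x:F \<inter> \<gamma>|side_measure F. v x * w x)"

definition AE_boundary ::
  "(real^'n) set \<Rightarrow> (real^'n) set set \<Rightarrow> (real^'n) set \<Rightarrow> (real^'n \<Rightarrow> bool) \<Rightarrow> bool" where
  "AE_boundary \<Omega> \<T> \<gamma> P \<longleftrightarrow>
     (\<forall>F\<in>boundary_sides \<Omega> \<T>. AE x in side_measure F. x \<in> F \<inter> \<gamma> \<longrightarrow> P x)"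

definition side_mean :: "(real^'n) set \<Rightarrow> (real^'n \<Rightarrow> real) \<Rightarrow> real" where
  "side_mean F w = (LINT x:F|side_measure F. w x) / measure (side_measure F) F"

text \<open>Element-wise and side-wise defined functions are represented by functions on the whole space.
  Only their values in the interiors of elements, respectively in the relative interiors of sides,
  are constrained; the values on the remaining null sets are arbitrary.\<close>

definition L0 :: "(real^'n) set set \<Rightarrow> (real^'n \<Rightarrow> real) set" where
  "L0 \<T> = {v. \<forall>T\<in>\<T>. \<exists>c. \<forall>x\<in>interior T. v x = c}"

definition L1 :: "(real^'n) set set \<Rightarrow> (real^'n \<Rightarrow> real) set" where
  "L1 \<T> = {v. \<forall>T\<in>\<T>. \<exists>c b. \<forall>x\<in>interior T. v x = c + b \<bullet> x}"

definition L0_sides :: "(real^'n) set set \<Rightarrow> (real^'n \<Rightarrow> real) set" where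
  "L0_sides \<S> = {g. \<forall>F\<in>\<S>. \<exists>c. \<forall>x\<in>rel_interior F. g x = c}"

text \<open>The restriction to \<open>T\<close> of an element-wise defined function, continuously extended up to the
  boundary of \<open>T\<close>.\<close>

definition elem_trace :: "(real^'n) set \<Rightarrow> (real^'n \<Rightarrow> 'b::t2_space) \<Rightarrow> real^'n \<Rightarrow> 'b" where
  "elem_trace T v x = Lim (at x within interior T) v"

definition crouzeix_raviart ::
  "(real^'n) set \<Rightarrow> (real^'n) set set \<Rightarrow> (real^'n \<Rightarrow> real) set" where
  "crouzeix_raviart \<Omega> \<T> =
     {v \<in> L1 \<T>. \<forall>F\<in>interior_sides \<Omega> \<T>. \<forall>T\<in>\<T>. \<forall>T'\<in>\<T>.
        T \<noteq> T' \<and> F facet_of T \<and> F facet_of T' \<longrightarrow>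
        side_mean F (\<lambda>x. elem_trace T v x - elem_trace T' v x) = 0}"

definition raviart_thomas ::
  "(real^'n) set \<Rightarrow> (real^'n) set set \<Rightarrow> (real^'n \<Rightarrow> real^'n) set" where
  "raviart_thomas \<Omega> \<T> =
     {y. (\<forall>i. (\<lambda>x. y x $ i) \<in> L1 \<T>) \<and>
         (\<forall>T\<in>\<T>. \<forall>F. F facet_of T \<longrightarrow>
            (\<exists>c. \<forall>x\<in>F. elem_trace T y x \<bullet> outer_normal T F = c)) \<and>
         (\<forall>F\<in>interior_sides \<Omega> \<T>. \<forall>T\<in>\<T>. \<forall>T'\<in>\<T>.
            T \<noteq> T' \<and> F facet_of T \<and> F facet_of T' \<longrightarrow>
            (\<forall>x\<in>F. elem_trace T y x \<bullet> outer_normal T F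
                   + elem_trace T' y x \<bullet> outer_normal T' F = 0))}"

definition grad_h :: "(real^'n) set set \<Rightarrow> (real^'n \<Rightarrow> real) \<Rightarrow> real^'n \<Rightarrow> real^'n" where
  "grad_h \<T> v x = (if x \<in> (\<Union>T\<in>\<T>. interior T) then (THE D. GDERIV v x :> D) else 0)"

text \<open>For Raviart-Thomas fields the weak divergence is the element-wise one, since the normal jumps
  vanish.\<close>

definition div_h :: "(real^'n) set set \<Rightarrow> (real^'n \<Rightarrow> real^'n) \<Rightarrow> real^'n \<Rightarrow> real" where
  "div_h \<T> y x =
     (if x \<in> (\<Union>T\<in>\<T>. interior T)
      then \<Sum>i\<in>UNIV. frechet_derivative y (at x) (axis i 1) $ i else 0)"

definition Pi_h ::
  "(real^'n) set set \<Rightarrow> (real^'n \<Rightarrow> 'b::euclidean_space) \<Rightarrow> real^'n \<Rightarrow> 'b" where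
  "Pi_h \<T> w x =
     (\<Sum>T\<in>\<T>. indicator (interior T) x *\<^sub>R
        ((1 / measure lebesgue T) *\<^sub>R (LINT z:T|lebesgue. w z)))"

text \<open>Side averages. On a boundary side there is only one adjacent element; on an interior side the
  two one-sided averages of a Crouzeix-Raviart function coincide.\<close>

definition pi_h :: "(real^'n) set set \<Rightarrow> (real^'n \<Rightarrow> real) \<Rightarrow> real^'n \<Rightarrow> real" where
  "pi_h \<T> v x =
     (\<Sum>F\<in>sides \<T>. indicator (rel_interior F) x *
        (THE c. \<forall>T\<in>\<T>. F facet_of T \<longrightarrow> side_mean F (elem_trace T v) = c))"

text \<open>The normal trace \<open>y \<cdot> n\<close> on the boundary: on a boundary side, the outward normal of the domain
  is that of the adjacent element.\<close>

definition normal_trace ::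
  "(real^'n) set \<Rightarrow> (real^'n) set set \<Rightarrow> (real^'n \<Rightarrow> real^'n) \<Rightarrow> real^'n \<Rightarrow> real" where
  "normal_trace \<Omega> \<T> y x =
     (\<Sum>F\<in>boundary_sides \<Omega> \<T>. indicator (rel_interior F) x *
        (THE c. \<forall>T\<in>\<T>. F facet_of T \<longrightarrow> elem_trace T y x \<bullet> outer_normal T F = c))"

definition l2_inner ::
  "(real^'n) set \<Rightarrow> (real^'n \<Rightarrow> 'b::euclidean_space) \<Rightarrow> (real^'n \<Rightarrow> 'b) \<Rightarrow> real" where
  "l2_inner \<omega> v w = (LINT x:\<omega>|lebesgue. v x \<bullet> w x)"

definition ess_inf_on :: "(real^'n) set \<Rightarrow> (real^'n \<Rightarrow> real) \<Rightarrow> ereal" where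
  "ess_inf_on \<omega> v = - esssup (restrict_space lebesgue \<omega>) (\<lambda>x. - ereal (v x))"

definition linf_norm :: "(real^'n) set \<Rightarrow> (real^'n \<Rightarrow> 'b::real_normed_vector) \<Rightarrow> ereal" where
  "linf_norm \<omega> w = esssup (restrict_space lebesgue \<omega>) (\<lambda>x. ereal (norm (w x)))"

definition phi_star :: "(real^'n \<Rightarrow> real) \<Rightarrow> real^'n \<Rightarrow> real^'n \<Rightarrow> real" where
  "phi_star \<zeta> x s =
     (if norm s \<le> \<zeta> x then (norm s)\<^sup>2 / 2 else \<zeta> x * norm s - (\<zeta> x)\<^sup>2 / 2)"

definition outer_product :: "real^'n \<Rightarrow> real^'n \<Rightarrow> real^'n^'n" where
  "outer_product s t = (\<chi> i j. s $ i * t $ j)"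

definition hess_phi_star :: "(real^'n \<Rightarrow> real) \<Rightarrow> real^'n \<Rightarrow> real^'n \<Rightarrow> real^'n^'n" where
  "hess_phi_star \<zeta> x t =
     (if norm t \<le> \<zeta> x then mat 1
      else (\<zeta> x / norm t) *\<^sub>R (mat 1 - (1 / (norm t)\<^sup>2) *\<^sub>R outer_product t t))"

definition hess_phi_star_mean ::
  "(real^'n \<Rightarrow> real) \<Rightarrow> real^'n \<Rightarrow> real^'n \<Rightarrow> real^'n \<Rightarrow> real^'n^'n" where
  "hess_phi_star_mean \<zeta> t s x =
     (LINT l:{0..1}|lebesgue. (1 - l) *\<^sub>R hess_phi_star \<zeta> x (l *\<^sub>R t + (1 - l) *\<^sub>R s))"

definition K_cr ::
  "(real^'n) set \<Rightarrow> (real^'n) set \<Rightarrow> (real^'n) set set \<Rightarrow> (real^'n \<Rightarrow> real) \<Rightarrow>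
   (real^'n \<Rightarrow> real) \<Rightarrow> (real^'n \<Rightarrow> real) set" where
  "K_cr \<Omega> \<Gamma>D \<T> \<zeta> uD =
     {v \<in> crouzeix_raviart \<Omega> \<T>.
        (AE x in lebesgue. x \<in> \<Omega> \<longrightarrow> norm (grad_h \<T> v x) \<le> \<zeta> x) \<and>
        AE_boundary \<Omega> \<T> \<Gamma>D (\<lambda>x. pi_h \<T> v x = uD x)}"

definition I_cr ::
  "(real^'n) set \<Rightarrow> (real^'n) set \<Rightarrow> (real^'n) set \<Rightarrow> (real^'n) set set \<Rightarrow> (real^'n \<Rightarrow> real) \<Rightarrow>
   (real^'n \<Rightarrow> real) \<Rightarrow> (real^'n \<Rightarrow> real) \<Rightarrow> (real^'n \<Rightarrow> real) \<Rightarrow> (real^'n \<Rightarrow> real) \<Rightarrow> ereal" where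
  "I_cr \<Omega> \<Gamma>D \<Gamma>N \<T> f g \<zeta> uD v =
     (if v \<in> K_cr \<Omega> \<Gamma>D \<T> \<zeta> uD
      then ereal (1/2 * l2_inner \<Omega> (grad_h \<T> v) (grad_h \<T> v)
                  - l2_inner \<Omega> f (Pi_h \<T> v) - boundary_inner \<Omega> \<T> \<Gamma>N g (pi_h \<T> v))
      else \<infinity>)"

definition K_rt ::
  "(real^'n) set \<Rightarrow> (real^'n) set \<Rightarrow> (real^'n) set set \<Rightarrow> (real^'n \<Rightarrow> real) \<Rightarrow>
   (real^'n \<Rightarrow> real) \<Rightarrow> (real^'n \<Rightarrow> real^'n) set" where
  "K_rt \<Omega> \<Gamma>N \<T> f g =
     {y \<in> raviart_thomas \<Omega> \<T>.
        (AE x in lebesgue. x \<in> \<Omega> \<longrightarrow> div_h \<T> y x = - f x) \<and>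
        AE_boundary \<Omega> \<T> \<Gamma>N (\<lambda>x. normal_trace \<Omega> \<T> y x = g x)}"

definition D_rt ::
  "(real^'n) set \<Rightarrow> (real^'n) set \<Rightarrow> (real^'n) set \<Rightarrow> (real^'n) set set \<Rightarrow> (real^'n \<Rightarrow> real) \<Rightarrow>
   (real^'n \<Rightarrow> real) \<Rightarrow> (real^'n \<Rightarrow> real) \<Rightarrow> (real^'n \<Rightarrow> real) \<Rightarrow> (real^'n \<Rightarrow> real^'n) \<Rightarrow> ereal" where
  "D_rt \<Omega> \<Gamma>D \<Gamma>N \<T> f g \<zeta> uD y =
     (if y \<in> K_rt \<Omega> \<Gamma>N \<T> f g
      then ereal (- (LINT x:\<Omega>|lebesgue. phi_star \<zeta> x (Pi_h \<T> y x))
                  + boundary_inner \<Omega> \<T> \<Gamma>D (normal_trace \<Omega> \<T> y) uD)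
      else - \<infinity>)"

text \<open>The squared error measures \<open>\<rho>\<^sup>2\<close>; \<open>u\<close> and \<open>z\<close> are the primal and the dual solution.\<close>

definition rho2_I ::
  "(real^'n) set \<Rightarrow> (real^'n) set \<Rightarrow> (real^'n) set \<Rightarrow> (real^'n) set set \<Rightarrow> (real^'n \<Rightarrow> real) \<Rightarrow>
   (real^'n \<Rightarrow> real) \<Rightarrow> (real^'n \<Rightarrow> real) \<Rightarrow> (real^'n \<Rightarrow> real) \<Rightarrow> (real^'n \<Rightarrow> real) \<Rightarrow>
   (real^'n \<Rightarrow> real) \<Rightarrow> ereal" where
  "rho2_I \<Omega> \<Gamma>D \<Gamma>N \<T> f g \<zeta> uD u v =
     I_cr \<Omega> \<Gamma>D \<Gamma>N \<T> f g \<zeta> uD v - I_cr \<Omega> \<Gamma>D \<Gamma>N \<T> f g \<zeta> uD u"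

definition rho2_D ::
  "(real^'n) set \<Rightarrow> (real^'n) set \<Rightarrow> (real^'n) set \<Rightarrow> (real^'n) set set \<Rightarrow> (real^'n \<Rightarrow> real) \<Rightarrow>
   (real^'n \<Rightarrow> real) \<Rightarrow> (real^'n \<Rightarrow> real) \<Rightarrow> (real^'n \<Rightarrow> real) \<Rightarrow> (real^'n \<Rightarrow> real^'n) \<Rightarrow>
   (real^'n \<Rightarrow> real^'n) \<Rightarrow> ereal" where
  "rho2_D \<Omega> \<Gamma>D \<Gamma>N \<T> f g \<zeta> uD z y =
     - D_rt \<Omega> \<Gamma>D \<Gamma>N \<T> f g \<zeta> uD y + D_rt \<Omega> \<Gamma>D \<Gamma>N \<T> f g \<zeta> uD z"

end

theory Submission
  imports Defs
begin

text \<open>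
  Averaged over elements and sides, all functions in the statement are piecewise constant, so both
  identities are statements about finite sums over elements and boundary sides. Three facts carry them.

  The first one is integration by parts (\<open>discrete_ibp\<close>): for a Crouzeix-Raviart function \<open>v\<close> and a Raviart-Thomas
  field \<open>y\<close>, the pairing of the gradient of \<open>v\<close> with the averages of \<open>y\<close> plus that of the averages of \<open>v\<close> with the divergence
  of \<open>y\<close> is the boundary pairing of side averages and normal traces. On one element
  (\<open>element_integration_by_parts\<close>) the field is a combination of the fields \<open>x - p\<close> for the vertices \<open>p\<close>, and everything
  follows from the mean values of affine functions, which are the values at barycenters, and from the cone
  formula relating the area of a facet to the volume (\<open>measure_prism\<close>). After summation the contributions of an interior side
  cancel because exactly two elements meet there; a boundary side belongs to a single element because a Lipschitz
  domain lies on one side of its boundary.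

  The second one is the optimality relation (\<open>primal_gradient\<close>): on each element the gradient of \<open>u\<close> is the derivative of \<open>phi_star\<close> at
  the average of \<open>z\<close>, that is, the projection of this average onto the ball of radius \<open>\<zeta>\<close>. The dual functional is differentiable, so its derivative at \<open>z\<close> vanishes in all
  divergence-free directions without flux through the Neumann sides (\<open>dual_stationary\<close>). By the discrete Helmholtz
  decomposition (\<open>discrete_helmholtz\<close>) the difference between the projection and the gradient of \<open>u\<close> is then the gradient of a
  function \<open>w\<close> with vanishing averages on the Dirichlet sides. Hence \<open>u + w\<close> is an admissible competitor, and minimality of
  \<open>u\<close> forces the gradient of \<open>w\<close> to vanish.

  The third one is Taylor's formula for \<open>phi_star\<close> with the averaged Hessian as remainder (\<open>phi_star_taylor\<close>).

  For the primal error the quadratic functional is expanded at \<open>u\<close>; integration by parts with \<open>z\<close> turns the linear terms into the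
  pairing of the difference between the gradient of \<open>u\<close> and the average of \<open>z\<close> with the difference of the gradients of \<open>v\<close> and \<open>u\<close>,
  which the optimality relation evaluates (\<open>ball_proj_defect\<close>). For the dual error stationarity removes
  the linear term of Taylor's formula.\<close>

section \<open>Linear images and Lebesgue measure\<close>

text \<open>A linear map is a product of shears, coordinate scalings, transpositions and maps with a vanishing
  component, and each of these multiplies all volumes by a constant. The factor is
  determined later, by comparing maps with each other.\<close>

lemma linear_image_scale:
  fixes f :: "real^'n \<Rightarrow> real^'n"
  assumes "linear f"
  obtains m where "m \<ge> 0"
    "\<And>S. S \<in> lmeasurable \<Longrightarrow> f ` S \<in> lmeasurable"
    "\<And>S. S \<in> lmeasurable \<Longrightarrow> measure lebesgue (f ` S) = m * measure lebesgue S"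
proof -
  define P where "P = (\<lambda>f::real^'n \<Rightarrow> real^'n. \<exists>m\<ge>0. \<forall>S\<in>lmeasurable.
      f ` S \<in> lmeasurable \<and> measure lebesgue (f ` S) = m * measure lebesgue S)"
  have comp: "P (f \<circ> g)" if "P f" "P g" for f g
  proof -
    obtain m m' where "m \<ge> 0" "m' \<ge> 0"
      and m: "\<And>S. S \<in> lmeasurable \<Longrightarrow> f ` S \<in> lmeasurable \<and> measure lebesgue (f ` S) = m * measure lebesgue S"
      and m': "\<And>S. S \<in> lmeasurable \<Longrightarrow> g ` S \<in> lmeasurable \<and> measure lebesgue (g ` S) = m' * measure lebesgue S"
      using \<open>P f\<close> \<open>P g\<close> unfolding P_def by auto
    have "\<forall>S\<in>lmeasurable. (f \<circ> g) ` S \<in> lmeasurable \<and> measure lebesgue ((f \<circ> g) ` S) = m * m' * measure lebesgue S"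
      using m m' by (simp add: image_comp[symmetric] del: comp_apply)
    then show ?thesis unfolding P_def using \<open>m \<ge> 0\<close> \<open>m' \<ge> 0\<close> by (metis mult_nonneg_nonneg)
  qed
  have const: "P (\<lambda>x. \<chi> i. c i * x$i)" for c
    unfolding P_def by (rule exI[of _ "\<bar>prod c UNIV\<bar>"]) (simp add: measurable_stretch measure_stretch)
  have idplus: "P (\<lambda>x. \<chi> i. if i = m then x$m + x$n else x$i)" (is "P ?h") if "m \<noteq> n" for m n
  proof -
    have lin: "linear ?h"
      by (rule linearI) (simp_all add: vec_eq_iff distrib_left)
    have box: "measure lebesgue (?h ` cbox a b) = 1 * measure lebesgue (cbox a b)" for a b
    proof (cases "cbox a b = {}")
      case False
      define t :: "real^'n" where "t = axis n (- (a $ n))"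
      have ne: "cbox (t + a) (t + b) \<noteq> {}"
        using False by (metis cbox_translation image_is_empty)
      have "?h ` cbox (t + a) (t + b) = (+) (?h t) ` ?h ` cbox a b"
        by (simp add: cbox_translation image_image linear_add[OF lin, simplified])
      then have "measure lebesgue (?h ` cbox a b) = measure lebesgue (?h ` cbox (t + a) (t + b))"
        by (simp only: measure_translation)
      also have "\<dots> = measure lebesgue (cbox (t + a) (t + b))"
        using measure_shear_interval[OF that ne] by (simp add: t_def)
      also have "\<dots> = measure lebesgue (cbox a b)"
        by (simp only: cbox_translation measure_translation)
      finally show ?thesis by simp
    qed simp
    have "?h ` S \<in> lmeasurable \<and> measure lebesgue (?h ` S) = 1 * measure lebesgue S" if "S \<in> lmeasurable" for S
      using measure_linear_sufficient[OF lin that box] by simp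
    then show ?thesis
      unfolding P_def using zero_le_one by blast
  qed
  have swap: "P (\<lambda>x. \<chi> i. x $ Transposition.transpose m n i)" if "m \<noteq> n" for m n
  proof -
    let ?A = "\<lambda>x::real^'n. \<chi> i. if i = m then x$m + x$n else x$i"
    let ?B = "\<lambda>x::real^'n. \<chi> i. if i = n then x$n + x$m else x$i"
    let ?N = "\<lambda>k (x::real^'n). \<chi> i. (if i = k then -1 else 1) * x$i"
    \<comment> \<open>a transposition is a product of three shears and three sign changes\<close>
    have "(\<lambda>x. \<chi> i. x $ Transposition.transpose m n i) = ?N n \<circ> (?A \<circ> (?N m \<circ> (?B \<circ> (?N m \<circ> ?A))))"
    proof (rule ext)
      fix x :: "real^'n"
      have "(\<chi> i. x $ Transposition.transpose m n i) $ i = (?N n (?A (?N m (?B (?N m (?A x)))))) $ i" for i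
        using that that[symmetric] by (cases "i = m"; cases "i = n") simp_all
      then show "(\<chi> i. x $ Transposition.transpose m n i) = (?N n \<circ> (?A \<circ> (?N m \<circ> (?B \<circ> (?N m \<circ> ?A))))) x"
        by (simp add: vec_eq_iff)
    qed
    moreover have "P (?N n \<circ> (?A \<circ> (?N m \<circ> (?B \<circ> (?N m \<circ> ?A)))))"
      by (intro comp[OF const] comp[OF idplus] const idplus that that[symmetric])
    ultimately show ?thesis by simp
  qed
  have zeroes: "P f" if "linear f" "\<And>x. f x $ i = 0" for f i
  proof -
    have "\<not> inj f"
    proof
      assume "inj f"
      then obtain x where "f x = axis i 1"
        using linear_injective_imp_surjective[OF \<open>linear f\<close>] by (metis surjE)
      then show False using that(2)[of x] by simp
    qed
    then have neg: "negligible (f ` S)" for S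
      using negligible_linear_singular_image \<open>linear f\<close> by blast
    then have "\<forall>S\<in>lmeasurable. f ` S \<in> lmeasurable \<and> measure lebesgue (f ` S) = 0 * measure lebesgue S"
      using negligible_imp_measurable[OF neg] negligible_imp_measure0[OF neg] by simp
    then show ?thesis
      unfolding P_def using order_refl by blast
  qed
  have "P f"
    by (rule induct_linear_elementary[OF assms, of P])
      (erule (1) comp, rule zeroes, assumption, assumption, rule const, erule swap, erule idplus)
  then obtain m where "m \<ge> 0" "\<forall>S\<in>lmeasurable. f ` S \<in> lmeasurable \<and> measure lebesgue (f ` S) = m * measure lebesgue S"
    unfolding P_def by blast
  then show thesis using that[of m] by simp
qed

lemma measure_affine_involution_image:
  fixes f :: "real^'n \<Rightarrow> real^'n"
  assumes "linear f" and inv: "\<And>x. f (f x + c) + c = x" and S: "S \<in> lmeasurable"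
  shows "(\<lambda>x. f x + c) ` S \<in> lmeasurable"
    "measure lebesgue ((\<lambda>x. f x + c) ` S) = measure lebesgue S"
proof -
  let ?g = "\<lambda>x. f x + c"
  obtain m where "m \<ge> 0" and mm: "\<And>S. S \<in> lmeasurable \<Longrightarrow> f ` S \<in> lmeasurable"
    "\<And>S. S \<in> lmeasurable \<Longrightarrow> measure lebesgue (f ` S) = m * measure lebesgue S"
    using linear_image_scale[OF \<open>linear f\<close>] by blast
  have g: "measure lebesgue (?g ` S) = m * measure lebesgue S" "?g ` S \<in> lmeasurable"
    if "S \<in> lmeasurable" for S
  proof -
    have "?g ` S = (+) c ` (f ` S)" by (auto simp: image_image add.commute)
    then show "measure lebesgue (?g ` S) = m * measure lebesgue S" "?g ` S \<in> lmeasurable"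
      using mm[OF that] by (simp_all add: measure_translation measurable_translation)
  qed
  \<comment> \<open>the scaling factor is its own inverse\<close>
  have "m = 1"
  proof -
    let ?B = "cbox 0 One :: (real^'n) set"
    have "?g ` (?g ` ?B) = ?B" by (simp add: image_image inv)
    moreover have "?B \<in> lmeasurable" by simp
    ultimately have "measure lebesgue ?B = m * (m * measure lebesgue ?B)"
      using g(1)[of ?B] g(1)[OF g(2)[of ?B]] by metis
    then have "m * m = 1" by simp
    then show ?thesis using \<open>m \<ge> 0\<close> by (auto simp: square_eq_1_iff)
  qed
  then show "?g ` S \<in> lmeasurable" "measure lebesgue (?g ` S) = measure lebesgue S"
    using g[OF S] by simp_all
qed

lemma lborel_affine_involution:
  fixes f :: "real^'n \<Rightarrow> real^'n"
  assumes "linear f" and inv: "\<And>x. f (f x + c) + c = x"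
  shows "distr lborel borel (\<lambda>x. f x + c) = lborel"
proof -
  let ?g = "\<lambda>x. f x + c"
  have [measurable]: "f \<in> borel_measurable borel"
    using \<open>linear f\<close> by (intro borel_measurable_continuous_onI linear_continuous_on) (simp add: linear_linear)
  have "lborel = distr lborel borel ?g"
  proof (rule lborel_eqI)
    fix l u :: "real^'n" assume le: "\<And>b. b \<in> Basis \<Longrightarrow> l \<bullet> b \<le> u \<bullet> b"
    have v: "?g -` box l u = ?g ` box l u"
    proof
      show "?g -` box l u \<subseteq> ?g ` box l u"
      proof
        fix x assume "x \<in> ?g -` box l u"
        then show "x \<in> ?g ` box l u" using inv[of x] by (intro image_eqI[of _ _ "?g x"]) auto
      qed
    qed (auto simp: inv)
    have "?g -` box l u \<inter> space borel \<in> sets borel"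
      by (rule measurable_sets[of _ borel borel]) auto
    then have s: "?g -` box l u \<in> sets borel" by simp
    have "emeasure (distr lborel borel ?g) (box l u) = emeasure lborel (?g -` box l u)"
      by (simp add: emeasure_distr)
    also have "\<dots> = emeasure lebesgue (?g ` box l u)"
      using s by (simp add: v)
    also have "\<dots> = ennreal (measure lebesgue (?g ` box l u))"
      using measure_affine_involution_image(1)[OF assms, of "box l u"] by (simp add: emeasure_eq_measure2)
    also have "measure lebesgue (?g ` box l u) = measure lebesgue (box l u)"
      using measure_affine_involution_image(2)[OF assms, of "box l u"] by simp
    also have "ennreal (measure lebesgue (box l u)) = (\<Prod>b\<in>Basis. (u - l) \<bullet> b)"
      using le by (simp add: measure_lborel_box_eq)
    finally show "emeasure (distr lborel borel ?g) (box l u) = (\<Prod>b\<in>Basis. (u - l) \<bullet> b)" .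
  qed simp
  then show ?thesis by simp
qed

lemma affine_reflection:
  fixes a e :: "real^'n"
  assumes "a \<bullet> e = -2"
  shows "linear (\<lambda>x. x + (a \<bullet> x) *\<^sub>R e)"
    "(x + (a \<bullet> x) *\<^sub>R e + c *\<^sub>R e) + (a \<bullet> (x + (a \<bullet> x) *\<^sub>R e + c *\<^sub>R e)) *\<^sub>R e + c *\<^sub>R e = x"
proof -
  show "linear (\<lambda>x. x + (a \<bullet> x) *\<^sub>R e)"
    by (rule linearI) (simp_all add: inner_add_right scaleR_add_left scaleR_add_right)
  have 1: "a \<bullet> (x + (a \<bullet> x) *\<^sub>R e + c *\<^sub>R e) = - (a \<bullet> x) - c - c"
    using assms by (simp add: inner_add_right)
  show "(x + (a \<bullet> x) *\<^sub>R e + c *\<^sub>R e) + (a \<bullet> (x + (a \<bullet> x) *\<^sub>R e + c *\<^sub>R e)) *\<^sub>R e + c *\<^sub>R e = x"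
    unfolding 1 by (simp add: vec_eq_iff algebra_simps)
qed

text \<open>The functional \<open>a \<bullet> x + c\<close> changes sign under the oblique reflection along \<open>e\<close> that fixes its zero
  set, and this reflection preserves Lebesgue measure. Over a set that the reflection maps into itself
  the two halves cancel.\<close>

lemma integral_odd_under_reflection:
  fixes a e :: "real^'n"
  assumes ae: "a \<bullet> e = -2" and S: "S \<in> sets borel"
    and inv: "\<And>x. x \<in> S \<Longrightarrow> x + (a \<bullet> x + c) *\<^sub>R e \<in> S"
  shows "(LINT x:S|lborel. a \<bullet> x + c) = 0"
proof -
  define s where "s = (\<lambda>x. (x + (a \<bullet> x) *\<^sub>R e) + c *\<^sub>R e)"
  note [measurable] = S
  have ss: "s (s x) = x" for x
    using affine_reflection(2)[OF ae, of x c] by (simp add: s_def)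
  have sS: "s x \<in> S" if "x \<in> S" for x
    using inv[OF that] by (simp add: s_def algebra_simps)
  then have ind: "indicator S (s x) = (indicator S x :: real)" for x
    using ss by (metis indicator_simps)
  have odd: "a \<bullet> s x + c = - (a \<bullet> x + c)" for x
    using ae by (simp add: s_def inner_add_right)
  have D: "distr lborel borel s = lborel"
    unfolding s_def using affine_reflection[OF ae] by (intro lborel_affine_involution) auto
  have [measurable]: "s \<in> borel_measurable borel"
    unfolding s_def by (intro borel_measurable_continuous_onI continuous_intros)
  have "(LINT x:S|lborel. a \<bullet> x + c) = (LINT x|distr lborel borel s. indicator S x *\<^sub>R (a \<bullet> x + c))"
    unfolding D set_lebesgue_integral_def ..
  also have "\<dots> = (LINT x|lborel. indicator S (s x) *\<^sub>R (a \<bullet> s x + c))"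
    by (subst integral_distr) auto
  also have "\<dots> = - (LINT x:S|lborel. a \<bullet> x + c)"
    unfolding odd ind set_lebesgue_integral_def scaleR_minus_right by simp
  finally show ?thesis by simp
qed

text \<open>Cramer's rule for volumes. Replacing the \<open>k\<close>-th column \<open>M e\<^sub>k\<close> by \<open>M x\<close> means to apply first the map
  that sends \<open>e\<^sub>k\<close> to \<open>x\<close> and fixes the other unit vectors; up to a reflection, which preserves volume,
  this map is the scaling of the \<open>k\<close>-th coordinate by \<open>- x $ k\<close>.\<close>

lemma measure_replace_column:
  fixes M M' :: "real^'n \<Rightarrow> real^'n"
  assumes "linear M" "linear M'"
    and eq: "\<And>j. j \<noteq> k \<Longrightarrow> M' (axis j 1) = M (axis j 1)" and eqk: "M' (axis k 1) = M x"
    and S: "S \<in> lmeasurable"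
  shows "measure lebesgue (M' ` S) = \<bar>x $ k\<bar> * measure lebesgue (M ` S)"
proof -
  obtain m where "m \<ge> 0" "\<And>S. S \<in> lmeasurable \<Longrightarrow> M ` S \<in> lmeasurable"
    and m: "\<And>S. S \<in> lmeasurable \<Longrightarrow> measure lebesgue (M ` S) = m * measure lebesgue S"
    using linear_image_scale[OF \<open>linear M\<close>] by blast
  define e where "e = x - (x $ k) *\<^sub>R axis k 1 - 2 *\<^sub>R axis k (1::real)"
  define R where "R = (\<lambda>\<xi>. \<xi> + (axis k 1 \<bullet> \<xi>) *\<^sub>R e)"
  define D where "D = (\<lambda>\<xi>::real^'n. (\<chi> j. (if j = k then - x $ k else 1) * \<xi> $ j))"
  have "axis k 1 \<bullet> e = -2" by (simp add: e_def inner_axis' inner_diff_right)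
  note refl = affine_reflection(1)[OF this] affine_reflection(2)[OF this, where c = 0]
  have "linear R" unfolding R_def by (rule refl(1))
  have inv: "R (R \<xi> + 0) + 0 = \<xi>" for \<xi>
    using refl(2)[of \<xi>] by (simp add: R_def)
  have R: "R ` S \<in> lmeasurable" "measure lebesgue (R ` S) = measure lebesgue S"
    using measure_affine_involution_image[OF \<open>linear R\<close> inv S] by simp_all
  have D1: "D ` R ` S \<in> lmeasurable"
    unfolding D_def by (rule measurable_stretch[OF R(1)])
  have "measure lebesgue (D ` R ` S) = \<bar>\<Prod>j\<in>UNIV. if j = k then - x $ k else 1\<bar> * measure lebesgue (R ` S)"
    unfolding D_def by (rule measure_stretch[OF R(1)])
  then have D2: "measure lebesgue (D ` R ` S) = \<bar>x $ k\<bar> * measure lebesgue (R ` S)"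
    by (simp add: prod.delta)
  have "linear D" unfolding D_def by (rule linearI) (simp_all add: vec_eq_iff distrib_left)
  have Rk: "R \<xi> = \<xi> + (\<xi> $ k) *\<^sub>R e" for \<xi> by (simp add: R_def inner_axis')
  have "M' = M \<circ> (D \<circ> R)"
  proof (rule linear_eq_stdbasis[OF \<open>linear M'\<close>])
    show "linear (M \<circ> (D \<circ> R))"
      using \<open>linear M\<close> \<open>linear D\<close> \<open>linear R\<close> by (intro linear_compose)
    fix b :: "real^'n" assume "b \<in> Basis"
    then obtain j where b: "b = axis j 1" by (auto simp: Basis_vec_def)
    show "M' b = (M \<circ> (D \<circ> R)) b"
    proof (cases "j = k")
      case True
      have "D (R (axis k 1)) = x"
        by (simp add: D_def Rk e_def vec_eq_iff) (simp add: axis_def)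
      then show ?thesis using True b eqk by simp
    next
      case False
      then have "D (R (axis j 1)) = axis j 1"
        by (simp add: D_def Rk vec_eq_iff) (simp add: axis_def)
      then show ?thesis using False b eq by simp
    qed
  qed
  then have "measure lebesgue (M' ` S) = measure lebesgue (M ` D ` R ` S)"
    by (simp only: image_comp o_assoc)
  also have "\<dots> = m * (\<bar>x $ k\<bar> * measure lebesgue S)"
    unfolding m[OF D1] D2 R(2) ..
  finally show ?thesis unfolding m[OF S] by simp
qed

subsection \<open>The standard simplex and the standard prism\<close>

definition std_simplex_vec :: "(real^'n) set" where
  "std_simplex_vec = {x. (\<forall>j. 0 \<le> x $ j) \<and> (\<Sum>j\<in>UNIV. x $ j) \<le> 1}"

text \<open>The model of the slab of thickness one around a facet: the base is the standard simplex in the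
  coordinates other than \<open>k\<close>.\<close>

definition std_prism_vec :: "'n \<Rightarrow> (real^'n) set" where
  "std_prism_vec k = {x. \<bar>x $ k\<bar> \<le> 1/2 \<and> (\<forall>j. j \<noteq> k \<longrightarrow> 0 \<le> x $ j) \<and> (\<Sum>j\<in>UNIV-{k}. x $ j) \<le> 1}"

lemma Basis_real_vec: "(Basis :: (real^'n) set) = (\<lambda>j. axis j 1) ` UNIV"
  by (auto simp: Basis_vec_def)

lemma inj_axis: "inj (\<lambda>j. axis j (1::real))"
  by (auto simp: inj_def axis_eq_axis)

lemma emeasure_std_simplex_vec:
  "emeasure lborel (std_simplex_vec :: (real^'n) set) = ennreal (1 / fact CARD('n))"
proof -
  have *: "std_simplex_vec = convex hull (insert 0 Basis :: (real^'n) set)"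
    unfolding std_simplex std_simplex_vec_def
    by (simp add: Basis_real_vec sum.reindex[OF inj_axis] inner_axis)
  show ?thesis
    unfolding * emeasure_std_simplex by simp
qed

text \<open>Fubini's theorem in the coordinate \<open>k\<close>: height one times the volume of the standard simplex in one
  dimension less. Compared with the standard simplex this gives the factor \<open>d\<close> of the cone formula.\<close>

lemma emeasure_std_prism_vec:
  "emeasure lborel (std_prism_vec k :: (real^'n) set) = ennreal (1 / fact (CARD('n) - 1))"
proof -
  define b :: "real^'n" where "b = axis k 1"
  define A :: "(real^'n) set" where "A = Basis - {b}"
  have bA: "Basis = insert b A" "b \<notin> A" "finite A" "b \<in> Basis"
    by (auto simp: A_def b_def Basis_real_vec)
  have A: "A = (\<lambda>j. axis j 1) ` (UNIV - {k})"
    unfolding A_def b_def Basis_real_vec by (auto simp: axis_eq_axis)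
  have cardA: "card A = CARD('n) - 1"
    unfolding A by (subst card_image) (auto intro: inj_on_subset[OF inj_axis])
  let ?L = "\<lambda>_::real^'n. lborel :: real measure"
  interpret product_sigma_finite ?L by standard
  define Q where "Q = {y::real^'n \<Rightarrow> real. (\<forall>i\<in>A. 0 \<le> y i) \<and> sum y A \<le> 1}"
  define X where "X = {y::real^'n \<Rightarrow> real. \<bar>y b\<bar> \<le> 1/2} \<inter> Q"
  have [measurable]: "Q \<inter> space (Pi\<^sub>M A ?L) \<in> sets (Pi\<^sub>M A ?L)"
  proof -
    have "Q \<inter> space (Pi\<^sub>M A ?L) = Pi\<^sub>E A (\<lambda>_. {0..}) \<inter> (\<lambda>x. sum x A) -` {..1} \<inter> space (Pi\<^sub>M A ?L)"
      by (auto simp: Q_def space_PiM)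
    also have "\<dots> \<in> sets (Pi\<^sub>M A ?L)" using bA(3) by measurable
    finally show ?thesis .
  qed
  have X: "X \<inter> space (Pi\<^sub>M (insert b A) ?L) \<in> sets (Pi\<^sub>M (insert b A) ?L)"
  proof -
    have "X \<inter> space (Pi\<^sub>M (insert b A) ?L)
        = ((\<lambda>y. y b) -` {-(1/2)..1/2} \<inter> space (Pi\<^sub>M (insert b A) ?L))
          \<inter> ((\<lambda>y. restrict y A) -` (Q \<inter> space (Pi\<^sub>M A ?L)) \<inter> space (Pi\<^sub>M (insert b A) ?L))"
      by (auto simp: X_def Q_def space_PiM abs_le_iff)
    also have "\<dots> \<in> sets (Pi\<^sub>M (insert b A) ?L)"
    proof (rule sets.Int)
      show "(\<lambda>y. y b) -` {-(1/2)..1/2} \<inter> space (Pi\<^sub>M (insert b A) ?L) \<in> sets (Pi\<^sub>M (insert b A) ?L)"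
        by (rule measurable_sets[OF measurable_component_singleton]) auto
      show "(\<lambda>y. restrict y A) -` (Q \<inter> space (Pi\<^sub>M A ?L)) \<inter> space (Pi\<^sub>M (insert b A) ?L)
          \<in> sets (Pi\<^sub>M (insert b A) ?L)"
        by (rule measurable_sets[OF measurable_restrict_subset]) auto
    qed
    finally show ?thesis .
  qed
  have "emeasure lborel (std_prism_vec k) = emeasure lborel {x::real^'n. \<bar>x \<bullet> b\<bar> \<le> 1/2 \<and> (\<forall>i\<in>A. 0 \<le> x \<bullet> i) \<and> sum ((\<bullet>) x) A \<le> 1}" (is "_ = emeasure _ ?P")
    unfolding std_prism_vec_def A b_def
    by (auto simp: sum.reindex[OF inj_on_subset[OF inj_axis]] inner_axis intro!: arg_cong[where f = "emeasure lborel"])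
  also have "emeasure lborel ?P = emeasure (distr (Pi\<^sub>M Basis ?L) borel (\<lambda>f. \<Sum>b\<in>Basis. f b *\<^sub>R b)) ?P"
    by (subst lborel_eq) simp
  also have "\<dots> = emeasure (Pi\<^sub>M Basis ?L) (X \<inter> space (Pi\<^sub>M Basis ?L))"
  proof (subst emeasure_distr)
    have in_sum: "(\<Sum>b\<in>Basis. y b *\<^sub>R b) \<bullet> i = y i" if "i \<in> Basis" for y and i :: "real^'n"
      using that by simp
    have "(\<Sum>b\<in>Basis. y b *\<^sub>R b) \<in> ?P \<longleftrightarrow> y \<in> X" for y
    proof -
      have "sum ((\<bullet>) (\<Sum>b\<in>Basis. y b *\<^sub>R b)) A = sum y A"
        by (intro sum.cong refl in_sum) (simp add: A_def)
      then show ?thesis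
        using bA(4) in_sum[of _ y] by (simp add: X_def Q_def A_def)
    qed
    then show "emeasure (Pi\<^sub>M Basis ?L) ((\<lambda>f. \<Sum>b\<in>Basis. f b *\<^sub>R b) -` ?P \<inter> space (Pi\<^sub>M Basis ?L))
        = emeasure (Pi\<^sub>M Basis ?L) (X \<inter> space (Pi\<^sub>M Basis ?L))"
      by (auto intro!: arg_cong2[where f = emeasure])
  qed (use bA(3) in measurable)
  also have "\<dots> = (\<integral>\<^sup>+x. indicator (X \<inter> space (Pi\<^sub>M (insert b A) ?L)) x \<partial>Pi\<^sub>M (insert b A) ?L)"
    using X by (simp add: bA(1))
  also have "\<dots> = (\<integral>\<^sup>+y. \<integral>\<^sup>+x. indicator (X \<inter> space (Pi\<^sub>M (insert b A) ?L)) (x(b := y)) \<partial>Pi\<^sub>M A ?L \<partial>lborel)"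
    using X bA by (intro product_nn_integral_insert_rev) auto
  also have "\<dots> = (\<integral>\<^sup>+y. \<integral>\<^sup>+x. indicator {-(1/2)..1/2::real} y * indicator (Q \<inter> space (Pi\<^sub>M A ?L)) x \<partial>Pi\<^sub>M A ?L \<partial>lborel)"
  proof (intro nn_integral_cong)
    fix y x assume x: "x \<in> space (Pi\<^sub>M A ?L)"
    have "sum (x(b := y)) A = sum x A" using bA(2) by (intro sum.cong) auto
    also have "x(b := y) \<in> space (Pi\<^sub>M (insert b A) ?L)"
      using x by (auto simp: space_PiM PiE_iff extensional_def)
    ultimately show "indicator (X \<inter> space (Pi\<^sub>M (insert b A) ?L)) (x(b := y))
        = (indicator {-(1/2)..1/2} y * indicator (Q \<inter> space (Pi\<^sub>M A ?L)) x :: ennreal)"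
      using x bA(2) by (auto simp: X_def Q_def indicator_def abs_le_iff)
  qed
  also have "\<dots> = emeasure lborel {-(1/2)..1/2::real} * emeasure (Pi\<^sub>M A ?L) (Q \<inter> space (Pi\<^sub>M A ?L))"
    by (simp add: nn_integral_cmult nn_integral_multc)
  also have "emeasure (Pi\<^sub>M A ?L) (Q \<inter> space (Pi\<^sub>M A ?L)) = ennreal (1 / fact (CARD('n) - 1))"
    unfolding Q_def using bA(3) by (subst emeasure_std_simplex_aux) (auto simp: cardA)
  finally show ?thesis by simp
qed

lemma measure_std_prism_vec:
  "measure lebesgue (std_prism_vec k :: (real^'n) set) = CARD('n) * measure lebesgue (std_simplex_vec :: (real^'n) set)"
  "measure lebesgue (std_simplex_vec :: (real^'n) set) > 0"
  "(std_prism_vec k :: (real^'n) set) \<in> lmeasurable"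
  "(std_simplex_vec :: (real^'n) set) \<in> lmeasurable"
proof -
  have [measurable]: "std_prism_vec k \<in> sets borel" "(std_simplex_vec :: (real^'n) set) \<in> sets borel"
    unfolding std_prism_vec_def std_simplex_vec_def by measurable
  have "fact CARD('n) = CARD('n) * (fact (CARD('n) - 1) :: real)"
    by (simp add: fact_reduce)
  then show "measure lebesgue (std_prism_vec k :: (real^'n) set) = CARD('n) * measure lebesgue (std_simplex_vec :: (real^'n) set)"
    "measure lebesgue (std_simplex_vec :: (real^'n) set) > 0"
    by (simp_all add: measure_def emeasure_std_simplex_vec emeasure_std_prism_vec)
  show "(std_prism_vec k :: (real^'n) set) \<in> lmeasurable" "(std_simplex_vec :: (real^'n) set) \<in> lmeasurable"
    by (auto simp: fmeasurable_def emeasure_std_simplex_vec emeasure_std_prism_vec)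
qed

section \<open>Barycentric coordinates of a full-dimensional simplex\<close>

locale full_simplex =
  fixes C :: "(real^'n) set"
  assumes aff_indep: "\<not> affine_dependent C" and card_C: "card C = Suc CARD('n)"
begin

lemma finite_C: "finite C"
  by (rule aff_independent_finite[OF aff_indep])

lemma other_vertex: obtains q where "q \<in> C" "q \<noteq> p"
proof -
  have "card C > 1" using card_C by (simp add: zero_less_card_finite)
  then have "\<not> C \<subseteq> {p}" using card_mono[of "{p}" C] by auto
  then show thesis using that by auto
qed

text \<open>The edges from a vertex \<open>o' \<noteq> p\<close> are linearly independent; the linear functional that is one on the edge to
  \<open>p\<close> and zero on the others is the linear part of the barycentric coordinate of \<open>p\<close>.\<close>

lemma bary_exists:
  assumes "p \<in> C"
  shows "\<exists>a c. \<forall>q\<in>C. a \<bullet> q + c = (if q = p then 1 else 0::real)"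
proof -
  obtain o' where o: "o' \<in> C" "o' \<noteq> p" by (rule other_vertex)
  have "independent ((\<lambda>x. - o' + x) ` (C - {o'}))"
    using aff_indep affine_dependent_iff_dependent2[OF o(1)] by simp
  then obtain f :: "real^'n \<Rightarrow> real" where f: "linear f"
    "\<forall>x\<in>(\<lambda>x. - o' + x) ` (C - {o'}). f x = (if x = p - o' then 1 else 0)"
    using linear_independent_extend[of _ "\<lambda>x. if x = p - o' then 1 else 0"] by blast
  define a where "a = adjoint f 1"
  have a: "a \<bullet> x = f x" for x
    using adjoint_works[OF f(1), of x 1] by (simp add: a_def inner_commute)
  have "a \<bullet> q + - (a \<bullet> o') = (if q = p then 1 else 0)" if "q \<in> C" for q
  proof (cases "q = o'")
    case False
    then have "f (- o' + q) = (if q = p then 1 else 0)" using f(2) that by simp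
    moreover have "a \<bullet> q + - (a \<bullet> o') = f (- o' + q)" by (simp add: a[symmetric] inner_diff_right)
    ultimately show ?thesis by simp
  qed (use o in simp)
  then show ?thesis by blast
qed

definition bary_grad :: "real^'n \<Rightarrow> real^'n" where
  "bary_grad p = (SOME a. \<exists>c. \<forall>q\<in>C. a \<bullet> q + c = (if q = p then 1 else 0::real))"

definition bary_const :: "real^'n \<Rightarrow> real" where
  "bary_const p = (SOME c. \<forall>q\<in>C. bary_grad p \<bullet> q + c = (if q = p then 1 else 0::real))"

definition bary :: "real^'n \<Rightarrow> real^'n \<Rightarrow> real" where
  "bary p x = bary_grad p \<bullet> x + bary_const p"

lemma bary_vertex:
  assumes "p \<in> C" "q \<in> C"
  shows "bary p q = (if q = p then 1 else 0)"
proof -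
  have "\<exists>c. \<forall>q\<in>C. bary_grad p \<bullet> q + c = (if q = p then 1 else 0::real)"
    unfolding bary_grad_def by (rule someI_ex[OF bary_exists[OF assms(1)]])
  then have "\<forall>q\<in>C. bary_grad p \<bullet> q + bary_const p = (if q = p then 1 else 0::real)"
    unfolding bary_const_def by (rule someI_ex)
  then show ?thesis using assms by (simp add: bary_def)
qed

lemma bary_add: "bary p (x + v) = bary p x + bary_grad p \<bullet> v"
  by (simp add: bary_def inner_add_right)

lemma bary_diff: "bary p (x - v) = bary p x - bary_grad p \<bullet> v"
  by (simp add: bary_def inner_diff_right)

lemma bary_grad_diff: "bary_grad p \<bullet> (x - y) = bary p x - bary p y"
  by (simp add: bary_def inner_diff_right)

lemma bary_comb:
  assumes "p \<in> C" "sum u C = 1"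
  shows "bary p (\<Sum>q\<in>C. u q *\<^sub>R q) = u p"
proof -
  have "bary p (\<Sum>q\<in>C. u q *\<^sub>R q) = (\<Sum>q\<in>C. u q * (bary_grad p \<bullet> q)) + sum u C * bary_const p"
    using assms(2) by (simp add: bary_def inner_sum_right)
  also have "\<dots> = (\<Sum>q\<in>C. u q * bary p q)"
    by (simp add: bary_def sum_distrib_right sum.distrib distrib_left)
  also have "\<dots> = (\<Sum>q\<in>C. if q = p then u q else 0)"
    using assms(1) by (intro sum.cong) (simp_all add: bary_vertex)
  finally show ?thesis using assms finite_C by simp
qed

lemma affine_hull_C: "affine hull C = UNIV"
proof -
  have "aff_dim C = int CARD('n)"
    using aff_dim_affine_independent[OF aff_indep] card_C by simp
  then show ?thesis using aff_dim_eq_full[of C] by simp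
qed

lemma sum_bary: "(\<Sum>p\<in>C. bary p x) = 1" and bary_repr: "(\<Sum>p\<in>C. bary p x *\<^sub>R p) = x"
proof -
  have "x \<in> affine hull C" by (simp add: affine_hull_C)
  then obtain u where u: "sum u C = 1" "(\<Sum>q\<in>C. u q *\<^sub>R q) = x"
    by (auto simp: affine_hull_finite[OF finite_C])
  then have "bary p x = u p" if "p \<in> C" for p
    using bary_comb[OF that u(1)] by simp
  then show "(\<Sum>p\<in>C. bary p x) = 1" "(\<Sum>p\<in>C. bary p x *\<^sub>R p) = x"
    using u by simp_all
qed

lemma sum_bary_grad: "(\<Sum>p\<in>C. bary_grad p \<bullet> v) = 0"
  and bary_grad_repr: "(\<Sum>p\<in>C. (bary_grad p \<bullet> v) *\<^sub>R p) = v"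
proof -
  have 1: "bary_grad p \<bullet> v = bary p v - bary p 0" for p by (simp add: bary_def)
  show "(\<Sum>p\<in>C. bary_grad p \<bullet> v) = 0"
    unfolding 1 sum_subtractf sum_bary by simp
  show "(\<Sum>p\<in>C. (bary_grad p \<bullet> v) *\<^sub>R p) = v"
    unfolding 1 scaleR_diff_left sum_subtractf bary_repr by simp
qed

lemma bary_grad_nonzero:
  assumes "p \<in> C" shows "bary_grad p \<noteq> 0"
proof -
  obtain q where q: "q \<in> C" "q \<noteq> p" by (rule other_vertex)
  have "bary_grad p \<bullet> (p - q) = 1"
    using assms q by (simp add: bary_grad_diff bary_vertex)
  then show ?thesis by auto
qed

lemma bary_grad_edge:
  assumes "p \<in> C" "q \<in> C" "r \<in> C" "q \<noteq> r"
  shows "bary_grad p \<bullet> (q - r) = (if p = q then 1 else if p = r then -1 else 0)"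
  using assms by (auto simp: bary_grad_diff bary_vertex)

lemma convex_hull_bary: "convex hull C = {x. \<forall>p\<in>C. 0 \<le> bary p x}"
proof (intro set_eqI iffI)
  fix x assume "x \<in> convex hull C"
  then obtain u where u: "\<forall>q\<in>C. 0 \<le> u q" "sum u C = 1" "(\<Sum>q\<in>C. u q *\<^sub>R q) = x"
    by (auto simp: convex_hull_finite[OF finite_C])
  then show "x \<in> {x. \<forall>p\<in>C. 0 \<le> bary p x}" using bary_comb[OF _ u(2)] by auto
next
  fix x assume "x \<in> {x. \<forall>p\<in>C. 0 \<le> bary p x}"
  then show "x \<in> convex hull C"
    using sum_bary[of x] bary_repr[of x] by (auto simp: convex_hull_finite[OF finite_C])
qed

lemma interior_bary: "interior (convex hull C) = {x. \<forall>p\<in>C. 0 < bary p x}"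
proof -
  have "interior (convex hull C) = {y. \<exists>u. (\<forall>x\<in>C. 0 < u x) \<and> sum u C = 1 \<and> (\<Sum>x\<in>C. u x *\<^sub>R x) = y}"
    using interior_convex_hull_explicit_minimal[OF aff_indep] card_C by simp
  also have "\<dots> = {x. \<forall>p\<in>C. 0 < bary p x}"
  proof (intro set_eqI iffI)
    fix x assume "x \<in> {y. \<exists>u. (\<forall>x\<in>C. 0 < u x) \<and> sum u C = 1 \<and> (\<Sum>x\<in>C. u x *\<^sub>R x) = y}"
    then obtain u where u: "\<forall>q\<in>C. 0 < u q" "sum u C = 1" "(\<Sum>q\<in>C. u q *\<^sub>R q) = x" by auto
    then show "x \<in> {x. \<forall>p\<in>C. 0 < bary p x}" using bary_comb[OF _ u(2)] by auto
  next
    fix x assume "x \<in> {x. \<forall>p\<in>C. 0 < bary p x}"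
    then show "x \<in> {y. \<exists>u. (\<forall>x\<in>C. 0 < u x) \<and> sum u C = 1 \<and> (\<Sum>x\<in>C. u x *\<^sub>R x) = y}"
      using sum_bary[of x] bary_repr[of x] by auto
  qed
  finally show ?thesis .
qed

text \<open>The facet opposite to the vertex \<open>p\<close>.\<close>

definition face :: "real^'n \<Rightarrow> (real^'n) set" where "face p = convex hull (C - {p})"

lemma sum_remove_vertex:
  fixes h :: "real^'n \<Rightarrow> 'b::comm_monoid_add"
  assumes "p \<in> C" "h p = 0" shows "sum h (C - {p}) = sum h C"
  using sum.remove[OF finite_C assms(1), of h] assms(2) by simp

lemma bary_face_comb:
  assumes p: "p \<in> C" and u: "sum u (C - {p}) = 1" "(\<Sum>q\<in>C - {p}. u q *\<^sub>R q) = x"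
  shows "bary p x = 0" "\<And>q. q \<in> C - {p} \<Longrightarrow> bary q x = u q"
proof -
  define w where "w = u(p := 0)"
  have "sum w (C - {p}) = sum u (C - {p})" by (rule sum.cong) (simp_all add: w_def)
  then have 1: "sum w C = 1" using sum_remove_vertex[OF p, of w] u(1) by (simp add: w_def)
  have "(\<Sum>q\<in>C - {p}. w q *\<^sub>R q) = (\<Sum>q\<in>C - {p}. u q *\<^sub>R q)" by (rule sum.cong) (simp_all add: w_def)
  then have 2: "(\<Sum>q\<in>C. w q *\<^sub>R q) = x"
    using sum_remove_vertex[OF p, of "\<lambda>q. w q *\<^sub>R q"] u(2) by (simp add: w_def)
  have "bary q x = w q" if "q \<in> C" for q using bary_comb[OF that 1] 2 by simp
  then show "bary p x = 0" "\<And>q. q \<in> C - {p} \<Longrightarrow> bary q x = u q"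
    using p by (simp_all add: w_def)
qed

lemma bary_face_repr:
  assumes "p \<in> C" "bary p x = 0"
  shows "(\<Sum>q\<in>C - {p}. bary q x) = 1" "(\<Sum>q\<in>C - {p}. bary q x *\<^sub>R q) = x"
  using sum_remove_vertex[OF assms(1), of "\<lambda>q. bary q x"] sum_remove_vertex[OF assms(1), of "\<lambda>q. bary q x *\<^sub>R q"]
    assms(2) by (simp_all add: sum_bary bary_repr)

lemma affine_hull_face:
  assumes "p \<in> C" shows "affine hull (face p) = {x. bary p x = 0}"
proof -
  have "affine hull (face p) = affine hull (C - {p})" by (simp add: face_def)
  also have "\<dots> = {x. bary p x = 0}"
  proof (intro set_eqI iffI)
    fix x assume "x \<in> affine hull (C - {p})"
    then obtain u where u: "sum u (C - {p}) = 1" "(\<Sum>q\<in>C - {p}. u q *\<^sub>R q) = x"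
      using affine_hull_finite[of "C - {p}"] finite_C by auto
    show "x \<in> {x. bary p x = 0}" using bary_face_comb(1)[OF assms u] by simp
  next
    fix x assume x: "x \<in> {x. bary p x = 0}"
    have "(\<Sum>q\<in>C - {p}. bary q x) = 1" "(\<Sum>q\<in>C - {p}. bary q x *\<^sub>R q) = x"
      using x by (simp_all add: bary_face_repr[OF assms])
    then show "x \<in> affine hull (C - {p})"
      using affine_hull_finite[of "C - {p}"] finite_C by auto
  qed
  finally show ?thesis .
qed

lemma face_bary:
  assumes "p \<in> C" shows "face p = {x. bary p x = 0 \<and> (\<forall>q\<in>C - {p}. 0 \<le> bary q x)}"
proof (intro set_eqI iffI)
  fix x assume "x \<in> face p"
  moreover have "face p \<subseteq> convex hull C" unfolding face_def by (rule hull_mono) auto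
  moreover have "face p \<subseteq> affine hull (face p)" by (rule hull_subset)
  ultimately show "x \<in> {x. bary p x = 0 \<and> (\<forall>q\<in>C - {p}. 0 \<le> bary q x)}"
    using affine_hull_face[OF assms] convex_hull_bary by auto
next
  fix x assume x: "x \<in> {x. bary p x = 0 \<and> (\<forall>q\<in>C - {p}. 0 \<le> bary q x)}"
  have "(\<Sum>q\<in>C - {p}. bary q x) = 1" "(\<Sum>q\<in>C - {p}. bary q x *\<^sub>R q) = x"
    using x by (simp_all add: bary_face_repr[OF assms])
  moreover have "finite (C - {p})" using finite_C by simp
  ultimately show "x \<in> face p"
    unfolding face_def using x by (auto simp: convex_hull_finite)
qed

lemma rel_interior_face:
  assumes "p \<in> C" shows "rel_interior (face p) = {x. bary p x = 0 \<and> (\<forall>q\<in>C - {p}. 0 < bary q x)}"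
proof -
  have ind: "\<not> affine_dependent (C - {p})"
    using aff_indep affine_independent_subset[of C "C - {p}"] by auto
  have fin: "finite (C - {p})" using finite_C by simp
  have "rel_interior (face p)
      = {y. \<exists>u. (\<forall>x\<in>C - {p}. 0 < u x) \<and> sum u (C - {p}) = 1 \<and> (\<Sum>x\<in>C - {p}. u x *\<^sub>R x) = y}"
    unfolding face_def using rel_interior_convex_hull_explicit[OF ind] by simp
  also have "\<dots> = {x. bary p x = 0 \<and> (\<forall>q\<in>C - {p}. 0 < bary q x)}"
  proof (intro set_eqI iffI)
    fix x assume "x \<in> {y. \<exists>u. (\<forall>x\<in>C - {p}. 0 < u x) \<and> sum u (C - {p}) = 1 \<and> (\<Sum>x\<in>C - {p}. u x *\<^sub>R x) = y}"
    then obtain u where u: "\<forall>q\<in>C - {p}. 0 < u q" "sum u (C - {p}) = 1" "(\<Sum>q\<in>C - {p}. u q *\<^sub>R q) = x"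
      by auto
    show "x \<in> {x. bary p x = 0 \<and> (\<forall>q\<in>C - {p}. 0 < bary q x)}"
      using bary_face_comb[OF assms u(2,3)] u(1) by simp
  next
    fix x assume x: "x \<in> {x. bary p x = 0 \<and> (\<forall>q\<in>C - {p}. 0 < bary q x)}"
    have "(\<Sum>q\<in>C - {p}. bary q x) = 1" "(\<Sum>q\<in>C - {p}. bary q x *\<^sub>R q) = x"
      using x by (simp_all add: bary_face_repr[OF assms])
    then show "x \<in> {y. \<exists>u. (\<forall>x\<in>C - {p}. 0 < u x) \<and> sum u (C - {p}) = 1 \<and> (\<Sum>x\<in>C - {p}. u x *\<^sub>R x) = y}"
      using x by auto
  qed
  finally show ?thesis .
qed

lemma vertex_in_face: "p \<in> C \<Longrightarrow> q \<in> C \<Longrightarrow> q \<noteq> p \<Longrightarrow> q \<in> face p"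
  unfolding face_def by (rule hull_inc) simp

lemma facet_iff: "F facet_of (convex hull C) \<longleftrightarrow> (\<exists>p\<in>C. F = face p)"
proof -
  have "face p \<noteq> {}" if "p \<in> C" for p
    using other_vertex[of p] vertex_in_face[OF that] by blast
  then show ?thesis
    unfolding facet_of_convex_hull_affine_independent[OF aff_indep] face_def by blast
qed

lemma inj_face: "inj_on face C"
proof (rule inj_onI)
  fix p q assume pq: "p \<in> C" "q \<in> C" "face p = face q"
  show "p = q"
  proof (rule ccontr)
    assume "p \<noteq> q"
    then have "q \<in> face p" using pq vertex_in_face by auto
    then have "q \<in> face q" using pq by simp
    then show False using pq by (simp add: face_bary bary_vertex)
  qed
qed

text \<open>The inward unit normal of the facet opposite to \<open>p\<close>. The corresponding height of the simplex is
  \<open>1 / norm (bary_grad p)\<close>.\<close>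

definition dir :: "real^'n \<Rightarrow> real^'n" where "dir p = bary_grad p /\<^sub>R norm (bary_grad p)"

lemma norm_dir: "p \<in> C \<Longrightarrow> norm (dir p) = 1"
  using bary_grad_nonzero by (simp add: dir_def)

lemma bary_grad_dir: "bary_grad p = norm (bary_grad p) *\<^sub>R dir p"
  by (cases "bary_grad p = 0") (simp_all add: dir_def)

lemma bary_grad_inner_dir: "p \<in> C \<Longrightarrow> bary_grad p \<bullet> dir p = norm (bary_grad p)"
  using norm_dir[of p] by (subst bary_grad_dir) (simp add: norm_eq_1)

text \<open>A vector satisfying the defining inequalities of the outward normal takes the same value at all
  vertices of the facet, hence it is a multiple of the gradient of the barycentric coordinate that
  vanishes there; the length and the remaining vertex fix the multiple.\<close>

lemma outer_normal_face:
  assumes p: "p \<in> C"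
  shows "outer_normal (convex hull C) (face p) = - dir p"
  unfolding outer_normal_def
proof (rule the_equality)
  have "- dir p \<bullet> y \<le> - dir p \<bullet> x" if "x \<in> face p" "y \<in> convex hull C" for x y
  proof -
    have "0 \<le> bary_grad p \<bullet> (y - x)"
      using that p by (auto simp: bary_grad_diff face_bary convex_hull_bary)
    then have "0 \<le> norm (bary_grad p) * (dir p \<bullet> (y - x))"
      by (subst (asm) bary_grad_dir) simp
    then have "0 \<le> dir p \<bullet> (y - x)"
      using bary_grad_nonzero[OF p] by (simp add: zero_le_mult_iff)
    then show ?thesis by (simp add: inner_diff_right)
  qed
  then show "norm (- dir p) = 1 \<and> (\<forall>x\<in>face p. \<forall>y\<in>convex hull C. - dir p \<bullet> y \<le> - dir p \<bullet> x)"
    using norm_dir[OF p] by simp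
next
  fix m assume m: "norm m = 1 \<and> (\<forall>x\<in>face p. \<forall>y\<in>convex hull C. m \<bullet> y \<le> m \<bullet> x)"
  obtain r where r: "r \<in> C" "r \<noteq> p" by (rule other_vertex)
  have inC: "q \<in> convex hull C" if "q \<in> C" for q using that by (rule hull_inc)
  have eq: "m \<bullet> q = m \<bullet> r" if "q \<in> C" "q \<noteq> p" for q
    using m vertex_in_face[OF p] r that inC by (meson antisym)
  define t where "t = m \<bullet> (p - r)"
  have "m \<bullet> v = t * (bary_grad p \<bullet> v)" for v
  proof -
    have "m \<bullet> v = m \<bullet> (\<Sum>q\<in>C. (bary_grad q \<bullet> v) *\<^sub>R q)" by (simp add: bary_grad_repr)
    also have "\<dots> = (\<Sum>q\<in>C. (bary_grad q \<bullet> v) * (m \<bullet> q)) - (\<Sum>q\<in>C. bary_grad q \<bullet> v) * (m \<bullet> r)"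
      by (simp add: sum_bary_grad inner_sum_right)
    also have "\<dots> = (\<Sum>q\<in>C. (bary_grad q \<bullet> v) * (m \<bullet> q - m \<bullet> r))"
      by (simp add: sum_distrib_right sum_subtractf right_diff_distrib)
    also have "\<dots> = (\<Sum>q\<in>C. if q = p then (bary_grad q \<bullet> v) * t else 0)"
    proof (rule sum.cong)
      fix q assume "q \<in> C"
      show "(bary_grad q \<bullet> v) * (m \<bullet> q - m \<bullet> r) = (if q = p then (bary_grad q \<bullet> v) * t else 0)"
      proof (cases "q = p")
        case False
        then have "m \<bullet> q - m \<bullet> r = 0" using eq[OF \<open>q \<in> C\<close>] by simp
        then show ?thesis using False by simp
      qed (simp add: t_def inner_diff_right)
    qed simp
    finally show ?thesis using p finite_C by simp
  qed
  then have "\<forall>v. v \<bullet> m = v \<bullet> (t *\<^sub>R bary_grad p)" by (simp add: inner_commute)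
  then have mt: "m = t *\<^sub>R bary_grad p" by (rule vector_eq_ldot[THEN iffD1])
  have "t \<le> 0" using m vertex_in_face[OF p r] inC[OF p] by (simp add: t_def inner_diff_right)
  moreover have "\<bar>t\<bar> * norm (bary_grad p) = 1" using m mt by simp
  ultimately have "t = - (1 / norm (bary_grad p))"
    using bary_grad_nonzero[OF p] by (simp add: field_simps)
  then show "m = - dir p" unfolding mt dir_def by (simp add: inverse_eq_divide)
qed

text \<open>Near a relatively interior point of a facet all other barycentric coordinates stay positive, so
  only the one belonging to this facet decides about membership. This is the form in which the geometry of
  the simplex enters the study of neighbouring elements.\<close>

lemma local_halfspace:
  assumes p: "p \<in> C" and x: "x \<in> rel_interior (face p)"
  shows "\<exists>e>0. \<forall>y\<in>ball x e. y \<in> convex hull C \<longleftrightarrow> 0 \<le> dir p \<bullet> (y - x)"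
proof -
  define U where "U = (\<Inter>q\<in>C - {p}. {y. 0 < bary q y})"
  have "open {y. 0 < bary q y}" for q
    unfolding bary_def by (intro open_Collect_less continuous_intros)
  then have "open U" unfolding U_def using finite_C by (intro open_INT) auto
  moreover have "x \<in> U" using x p by (simp add: U_def rel_interior_face)
  ultimately obtain e where e: "e > 0" "ball x e \<subseteq> U" by (meson open_contains_ball)
  have "y \<in> convex hull C \<longleftrightarrow> 0 \<le> dir p \<bullet> (y - x)" if "y \<in> ball x e" for y
  proof -
    have "y \<in> U" using that e by auto
    then have "0 \<le> bary q y" if "q \<in> C" "q \<noteq> p" for q
      using that by (simp add: U_def less_imp_le)
    then have "y \<in> convex hull C \<longleftrightarrow> 0 \<le> bary p y"
      using p unfolding convex_hull_bary by blast
    also have "bary p y = bary_grad p \<bullet> (y - x)"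
      using x p by (simp add: bary_grad_diff rel_interior_face)
    also have "\<dots> = norm (bary_grad p) * (dir p \<bullet> (y - x))"
      by (subst bary_grad_dir) simp
    finally show ?thesis using bary_grad_nonzero[OF p] by (simp add: zero_le_mult_iff)
  qed
  then show ?thesis using e(1) by blast
qed

end

lemma measure_translated_image:
  fixes M :: "real^'n \<Rightarrow> real^'n"
  shows "measure lebesgue ((\<lambda>\<xi>. c + M \<xi>) ` S) = measure lebesgue (M ` S)"
proof -
  have "(\<lambda>\<xi>. c + M \<xi>) ` S = (+) c ` (M ` S)" by (simp add: image_image)
  then show ?thesis by (simp only: measure_translation)
qed

lemma image_eq_of_surj:
  assumes "\<And>x. \<exists>\<xi>. f \<xi> = x" "\<And>\<xi>. f \<xi> \<in> B \<longleftrightarrow> \<xi> \<in> A"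
  shows "f ` A = B"
proof
  show "B \<subseteq> f ` A"
  proof
    fix x assume "x \<in> B"
    moreover obtain \<xi> where "f \<xi> = x" using assms(1) by blast
    ultimately show "x \<in> f ` A" using assms(2)[of \<xi>] by auto
  qed
qed (use assms(2) in auto)

lemma set_integrable_compact:
  fixes f :: "real^'n \<Rightarrow> real"
  assumes "compact X" "continuous_on UNIV f"
  shows "set_integrable lborel X f"
  unfolding set_integrable_def
  by (rule borel_integrable_compact[OF assms(1) continuous_on_subset[OF assms(2)]]) simp

text \<open>Affine functions that form a partition of unity and are exchanged in pairs by reflections of \<open>X\<close> have equal
  integrals over \<open>X\<close>. For barycentric coordinates this yields the mean values of affine functions over
  the simplex and, with \<open>X\<close> the prism over a facet, over the facet.\<close>

lemma integral_symmetric_partition: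
  fixes g :: "real^'n \<Rightarrow> real^'n" and h \<phi> :: "real^'n \<Rightarrow> real"
  assumes X: "compact X" and V: "finite V" "V \<noteq> {}"
    and one: "\<And>x. (\<Sum>r\<in>V. g r \<bullet> x + h r) = 1"
    and edge: "\<And>r s. r \<in> V \<Longrightarrow> s \<in> V \<Longrightarrow> r \<noteq> s \<Longrightarrow> (g r - g s) \<bullet> (s - r) = -2"
    and inv: "\<And>r s x. r \<in> V \<Longrightarrow> s \<in> V \<Longrightarrow> r \<noteq> s \<Longrightarrow> x \<in> X \<Longrightarrow>
        x + ((g r \<bullet> x + h r) - (g s \<bullet> x + h s)) *\<^sub>R (s - r) \<in> X"
  shows "(LINT x:X|lborel. (\<Sum>r\<in>V. \<phi> r * (g r \<bullet> x + h r))) = measure lborel X / card V * (\<Sum>r\<in>V. \<phi> r)"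
proof -
  have Xb: "X \<in> sets borel" using X by (rule borel_compact)
  have int: "set_integrable lborel X (\<lambda>x. \<phi> r * (g r \<bullet> x + h r))" for r and \<phi> :: "real^'n \<Rightarrow> real"
    by (rule set_integrable_compact[OF X]) (intro continuous_intros)
  have int1: "set_integrable lborel X (\<lambda>x. g r \<bullet> x + h r)" for r
    using int[of "\<lambda>_. 1"] by simp
  have eq: "(LINT x:X|lborel. g r \<bullet> x + h r) = (LINT x:X|lborel. g s \<bullet> x + h s)"
    if "r \<in> V" "s \<in> V" for r s
  proof (cases "r = s")
    case False
    have "(LINT x:X|lborel. (g r - g s) \<bullet> x + (h r - h s)) = 0"
    proof (rule integral_odd_under_reflection[OF edge[OF that False] Xb])
      fix x assume "x \<in> X"
      from inv[OF that False this]
      show "x + ((g r - g s) \<bullet> x + (h r - h s)) *\<^sub>R (s - r) \<in> X"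
        by (simp add: inner_diff_left algebra_simps)
    qed
    moreover have "(LINT x:X|lborel. (g r - g s) \<bullet> x + (h r - h s))
        = (LINT x:X|lborel. (g r \<bullet> x + h r) - (g s \<bullet> x + h s))"
      by (simp add: inner_diff_left algebra_simps)
    ultimately show ?thesis
      using set_integral_diff(2)[OF int1[of r] int1[of s]] by simp
  qed simp
  obtain s where s: "s \<in> V" using V(2) by blast
  define J where "J = (LINT x:X|lborel. g s \<bullet> x + h s)"
  have J: "(LINT x:X|lborel. g r \<bullet> x + h r) = J" if "r \<in> V" for r
    using eq[OF that s] by (simp add: J_def)
  have sum: "(LINT x:X|lborel. (\<Sum>r\<in>V. \<phi> r * (g r \<bullet> x + h r))) = (\<Sum>r\<in>V. \<phi> r) * J" for \<phi> :: "real^'n \<Rightarrow> real"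
  proof -
    have "(LINT x:X|lborel. (\<Sum>r\<in>V. \<phi> r * (g r \<bullet> x + h r)))
        = (LINT x|lborel. (\<Sum>r\<in>V. indicator X x *\<^sub>R (\<phi> r * (g r \<bullet> x + h r))))"
      by (simp only: set_lebesgue_integral_def scaleR_sum_right)
    also have "\<dots> = (\<Sum>r\<in>V. LINT x:X|lborel. \<phi> r * (g r \<bullet> x + h r))"
      unfolding set_lebesgue_integral_def
      by (rule Bochner_Integration.integral_sum) (rule int[unfolded set_integrable_def])
    also have "\<dots> = (\<Sum>r\<in>V. \<phi> r * J)"
      by (intro sum.cong refl) (simp add: J)
    finally show ?thesis by (simp add: sum_distrib_right)
  qed
  have "measure lborel X = (LINT x:X|lborel. (\<Sum>r\<in>V. 1 * (g r \<bullet> x + h r)))"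
    using Xb by (simp add: one set_lebesgue_integral_def)
  also have "\<dots> = card V * J" unfolding sum by simp
  finally have "J = measure lborel X / card V" using V by simp
  then show ?thesis using sum[of \<phi>] by simp
qed

context full_simplex
begin

subsection \<open>Volume and mean values on the simplex\<close>

lemma compact_hull: "compact (convex hull C)"
  by (rule finite_imp_compact_convex_hull[OF finite_C])

lemma interior_nonempty: "interior (convex hull C) \<noteq> {}"
proof -
  have c: "real (card C) > 0" using card_C by simp
  have "(\<Sum>q\<in>C. 1 / real (card C)) = 1" using c by simp
  from bary_comb[OF _ this] have "(\<Sum>q\<in>C. (1 / real (card C)) *\<^sub>R q) \<in> interior (convex hull C)"
    using c unfolding interior_bary by simp
  then show ?thesis by blast
qed

lemma measure_pos: "measure lborel (convex hull C) > 0"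
proof -
  have "\<not> negligible (interior (convex hull C))"
    using open_not_negligible[OF open_interior interior_nonempty] .
  then have "\<not> negligible (convex hull C)"
    using negligible_subset interior_subset by blast
  moreover have "convex hull C \<in> lmeasurable" by (rule lmeasurable_compact[OF compact_hull])
  ultimately have "measure lebesgue (convex hull C) \<noteq> 0" by (simp add: negligible_iff_measure)
  moreover have "measure lebesgue (convex hull C) = measure lborel (convex hull C)"
    using borel_compact[OF compact_hull] by simp
  ultimately show ?thesis using measure_nonneg[of lborel "convex hull C"] by linarith
qed

lemma vertex_sum: "(\<Sum>r\<in>C. (c + b \<bullet> r) * bary r x) = c + b \<bullet> x"
proof -
  have "c + b \<bullet> x = c * (\<Sum>r\<in>C. bary r x) + b \<bullet> (\<Sum>r\<in>C. bary r x *\<^sub>R r)"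
    unfolding sum_bary bary_repr by simp
  also have "\<dots> = (\<Sum>r\<in>C. (c + b \<bullet> r) * bary r x)"
    unfolding inner_sum_right inner_scaleR_right sum_distrib_left sum.distrib[symmetric]
    by (intro sum.cong refl) (simp add: algebra_simps)
  finally show ?thesis by simp
qed

lemma integral_simplex:
  "(LINT x:convex hull C|lborel. c + b \<bullet> x)
     = measure lborel (convex hull C) / (real CARD('n) + 1) * (\<Sum>r\<in>C. c + b \<bullet> r)"
proof -
  have "(LINT x:convex hull C|lborel. (\<Sum>r\<in>C. (c + b \<bullet> r) * (bary_grad r \<bullet> x + bary_const r)))
      = measure lborel (convex hull C) / card C * (\<Sum>r\<in>C. c + b \<bullet> r)"
  proof (rule integral_symmetric_partition[OF compact_hull finite_C])
    show "C \<noteq> {}" using card_C by auto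
    show "(\<Sum>r\<in>C. bary_grad r \<bullet> x + bary_const r) = 1" for x
      using sum_bary[of x] by (simp add: bary_def)
    show "(bary_grad r - bary_grad s) \<bullet> (s - r) = -2" if "r \<in> C" "s \<in> C" "r \<noteq> s" for r s
      using that by (simp add: inner_diff_left bary_grad_diff bary_vertex)
    show "x + ((bary_grad r \<bullet> x + bary_const r) - (bary_grad s \<bullet> x + bary_const s)) *\<^sub>R (s - r) \<in> convex hull C"
      if "r \<in> C" "s \<in> C" "r \<noteq> s" "x \<in> convex hull C" for r s x
    proof -
      have "0 \<le> bary q (x + (bary r x - bary s x) *\<^sub>R (s - r))" if "q \<in> C" for q
      proof -
        have "bary q (x + (bary r x - bary s x) *\<^sub>R (s - r)) = (if q = r then bary s x else if q = s then bary r x else bary q x)"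
          using \<open>r \<in> C\<close> \<open>s \<in> C\<close> \<open>r \<noteq> s\<close> \<open>q \<in> C\<close> by (simp add: bary_add bary_grad_edge)
        then show ?thesis
          using \<open>x \<in> convex hull C\<close> \<open>r \<in> C\<close> \<open>s \<in> C\<close> \<open>q \<in> C\<close> by (simp add: convex_hull_bary)
      qed
      then show ?thesis by (simp add: convex_hull_bary bary_def)
    qed
  qed
  moreover have "(\<Sum>r\<in>C. (c + b \<bullet> r) * (bary_grad r \<bullet> x + bary_const r)) = c + b \<bullet> x" for x
    using vertex_sum[of c b x] by (simp only: bary_def)
  ultimately show ?thesis using card_C by (simp add: add.commute)
qed

subsection \<open>Measure and mean values on a facet\<close>

text \<open>The orthogonal projection onto the hyperplane of the facet opposite to \<open>p\<close>.\<close>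

definition foot :: "real^'n \<Rightarrow> real^'n \<Rightarrow> real^'n" where
  "foot p x = x - (bary p x / norm (bary_grad p)) *\<^sub>R dir p"

text \<open>The part of the slab of thickness one around the hyperplane that lies over the facet. By the
  definition of the side measure, integrals over the facet are volume integrals over the prism.\<close>

definition prism :: "real^'n \<Rightarrow> (real^'n) set" where
  "prism p = {x. \<bar>bary p x\<bar> \<le> norm (bary_grad p) / 2 \<and> foot p x \<in> face p}"

lemma bary_foot: "p \<in> C \<Longrightarrow> bary p (foot p x) = 0"
  using bary_grad_nonzero[of p] by (simp add: foot_def bary_diff bary_grad_inner_dir)

lemma dist_foot:
  assumes p: "p \<in> C" shows "dist x (foot p x) = \<bar>bary p x\<bar> / norm (bary_grad p)"
  using norm_dir[OF p] by (simp add: foot_def dist_norm)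

lemma closest_point_face:
  assumes p: "p \<in> C" shows "closest_point (affine hull (face p)) x = foot p x"
proof (rule closest_point_unique[symmetric])
  show "convex (affine hull (face p))" by (simp add: affine_imp_convex)
  show "closed (affine hull (face p))" by simp
  show "foot p x \<in> affine hull (face p)" using p by (simp add: affine_hull_face bary_foot)
  show "\<forall>z\<in>affine hull (face p). dist x (foot p x) \<le> dist x z"
  proof
    fix z assume "z \<in> affine hull (face p)"
    then have "bary p x = bary_grad p \<bullet> (x - z)" using p by (simp add: affine_hull_face bary_grad_diff)
    then have "\<bar>bary p x\<bar> \<le> norm (bary_grad p) * dist x z"
      using Cauchy_Schwarz_ineq2[of "bary_grad p" "x - z"] by (simp add: dist_norm)
    then show "dist x (foot p x) \<le> dist x z"
      using bary_grad_nonzero[OF p] by (simp add: dist_foot[OF p] divide_le_eq mult.commute)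
  qed
qed

lemma infdist_face:
  assumes p: "p \<in> C" shows "infdist x (affine hull (face p)) = \<bar>bary p x\<bar> / norm (bary_grad p)"
proof -
  have "foot p x \<in> affine hull (face p)" using p by (simp add: affine_hull_face bary_foot)
  then have "affine hull (face p) \<noteq> {}" by blast
  then show ?thesis
    by (simp add: infdist_eq_setdist setdist_closest_point closest_point_face[OF p] dist_foot[OF p])
qed

lemma prism_alt:
  assumes p: "p \<in> C"
  shows "prism p = {x. infdist x (affine hull (face p)) \<le> 1/2} \<inter> foot p -` face p"
  using bary_grad_nonzero[OF p] by (auto simp: prism_def infdist_face[OF p] field_simps)

lemma continuous_foot: "continuous_on A (foot p)"
  unfolding foot_def bary_def divide_inverse by (intro continuous_intros)

lemma foot_measurable [measurable]: "foot p \<in> borel_measurable borel"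
  using continuous_foot by (rule borel_measurable_continuous_onI)

lemma compact_face: "compact (face p)"
  unfolding face_def using finite_C by (simp add: finite_imp_compact_convex_hull)

lemma face_borel [measurable]: "face p \<in> sets borel"
  by (rule borel_compact[OF compact_face])

lemma compact_prism:
  assumes p: "p \<in> C" shows "compact (prism p)"
proof -
  have "closed {x. \<bar>bary p x\<bar> \<le> norm (bary_grad p) / 2}"
    unfolding bary_def by (intro closed_Collect_le continuous_intros)
  moreover have "closed (foot p -` face p)"
    using continuous_closed_vimage[OF compact_imp_closed[OF compact_face], of "foot p" p] continuous_foot[of UNIV p]
    by (simp add: continuous_on_eq_continuous_at)
  moreover have "prism p = {x. \<bar>bary p x\<bar> \<le> norm (bary_grad p) / 2} \<inter> (foot p -` face p)"
    by (auto simp: prism_def)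
  ultimately have "closed (prism p)" by (simp add: closed_Int)
  moreover have "bounded (prism p)"
  proof -
    obtain B where B: "\<forall>x\<in>face p. norm x \<le> B"
      using compact_imp_bounded[OF compact_face] by (auto simp: bounded_iff)
    have "norm x \<le> B + 1/2" if "x \<in> prism p" for x
    proof -
      have "dist x (foot p x) \<le> 1/2"
        using that bary_grad_nonzero[OF p] by (simp add: dist_foot[OF p] prism_def divide_le_eq)
      moreover have "norm (foot p x) \<le> B" using that B by (simp add: prism_def)
      ultimately show ?thesis using norm_triangle_sub[of x "foot p x"] by (simp add: dist_norm)
    qed
    then show ?thesis by (auto simp: bounded_iff)
  qed
  ultimately show ?thesis by (simp add: compact_eq_bounded_closed)
qed

lemma side_measure_face:
  assumes p: "p \<in> C"
  shows "side_measure (face p) = completion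
    (distr (restrict_space lborel {x. infdist x (affine hull (face p)) \<le> 1/2}) borel (foot p))"
proof -
  have "closest_point (affine hull (face p)) = foot p"
    by (rule ext) (rule closest_point_face[OF p])
  then show ?thesis by (simp add: side_measure_def)
qed

lemma slab_borel: "{x. infdist x (affine hull (face p)) \<le> 1/2} \<in> sets borel"
  by (intro borel_closed closed_Collect_le continuous_intros)

lemma integral_side:
  fixes g :: "real^'n \<Rightarrow> real"
  assumes p: "p \<in> C" and [measurable]: "g \<in> borel_measurable borel"
  shows "(LINT x:face p|side_measure (face p). g x) = (LINT x:prism p|lborel. g (foot p x))"
proof -
  let ?S = "{x. infdist x (affine hull (face p)) \<le> 1/2}"
  let ?N = "distr (restrict_space lborel ?S) borel (foot p)"
  have m: "foot p \<in> restrict_space lborel ?S \<rightarrow>\<^sub>M borel"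
    by (intro measurable_restrict_space1) simp
  have "(LINT x:face p|side_measure (face p). g x) = (LINT x|?N. indicator (face p) x *\<^sub>R g x)"
    unfolding side_measure_face[OF p] set_lebesgue_integral_def by (rule integral_completion) simp
  also have "\<dots> = (LINT x|restrict_space lborel ?S. indicator (face p) (foot p x) *\<^sub>R g (foot p x))"
    by (rule integral_distr[OF m]) simp
  also have "\<dots> = (LINT x|lborel. indicator ?S x *\<^sub>R (indicator (face p) (foot p x) *\<^sub>R g (foot p x)))"
    by (rule integral_restrict_space) (use slab_borel in simp)
  also have "\<dots> = (LINT x:prism p|lborel. g (foot p x))"
    unfolding set_lebesgue_integral_def
    by (rule Bochner_Integration.integral_cong) (auto simp: prism_alt[OF p] indicator_def)
  finally show ?thesis .
qed

lemma measure_side: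
  assumes p: "p \<in> C"
  shows "measure (side_measure (face p)) (face p) = measure lborel (prism p)"
proof -
  let ?S = "{x. infdist x (affine hull (face p)) \<le> 1/2}"
  let ?N = "distr (restrict_space lborel ?S) borel (foot p)"
  have m: "foot p \<in> restrict_space lborel ?S \<rightarrow>\<^sub>M borel"
    by (intro measurable_restrict_space1) simp
  have "measure (side_measure (face p)) (face p) = measure ?N (face p)"
    unfolding side_measure_face[OF p] by simp
  also have "\<dots> = measure (restrict_space lborel ?S) (foot p -` face p \<inter> space (restrict_space lborel ?S))"
    by (rule measure_distr[OF m]) simp
  also have "\<dots> = measure lborel (foot p -` face p \<inter> space (restrict_space lborel ?S))"
    by (rule measure_restrict_space) (use slab_borel in \<open>auto simp: space_restrict_space\<close>)
  also have "foot p -` face p \<inter> space (restrict_space lborel ?S) = prism p"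
    by (auto simp: prism_alt[OF p] space_restrict_space)
  finally show ?thesis .
qed

text \<open>On the relative boundary of the facet a second barycentric coordinate vanishes. Its preimage
  under the projection lies in finitely many hyperplanes.\<close>

lemma side_AE_rel_interior:
  assumes p: "p \<in> C"
  shows "AE x in side_measure (face p). x \<in> face p \<longrightarrow> x \<in> rel_interior (face p)"
proof -
  let ?S = "{x. infdist x (affine hull (face p)) \<le> 1/2}"
  have m: "foot p \<in> restrict_space lborel ?S \<rightarrow>\<^sub>M borel"
    by (intro measurable_restrict_space1) simp
  have ri: "{x. x \<in> face p \<longrightarrow> x \<in> rel_interior (face p)} \<in> sets borel"
  proof -
    have "{x. x \<in> face p \<longrightarrow> x \<in> rel_interior (face p)} = - (face p - rel_interior (face p))" by auto
    moreover have "rel_interior (face p) = affine hull (face p) \<inter> (\<Inter>q\<in>C - {p}. {x. 0 < bary q x})" 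
      unfolding rel_interior_face[OF p] affine_hull_face[OF p] by auto
    moreover have "\<dots> \<in> sets borel"
    proof (rule sets.Int)
      show "affine hull (face p) \<in> sets borel" by (rule borel_closed) simp
      have "open (\<Inter>q\<in>C - {p}. {x. 0 < bary q x})"
        unfolding bary_def using finite_C by (intro open_INT ballI open_Collect_less continuous_intros) auto
      then show "(\<Inter>q\<in>C - {p}. {x. 0 < bary q x}) \<in> sets borel" by (rule borel_open)
    qed
    ultimately show ?thesis by simp
  qed
  have null: "AE x in lborel. bary q (foot p x) \<noteq> 0" if q: "q \<in> C - {p}" for q
  proof -
    define a where "a = bary_grad q - ((bary_grad q \<bullet> dir p) / norm (bary_grad p)) *\<^sub>R bary_grad p"
    define b where "b = bary_const q - (bary_grad q \<bullet> dir p) / norm (bary_grad p) * bary_const p"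
    have eq: "bary q (foot p x) = a \<bullet> x + b" for x
      by (simp add: foot_def bary_def inner_diff_right a_def b_def inner_diff_left algebra_simps add_divide_distrib)
    have "foot p q = q" using q p by (simp add: foot_def bary_vertex)
    then have "a \<bullet> q + b = 1" using eq[of q] q by (simp add: bary_vertex)
    then have "a \<noteq> 0 \<or> - b \<noteq> 0" by auto
    then have "negligible {x. a \<bullet> x = - b}" by (rule negligible_hyperplane)
    moreover have "{x. a \<bullet> x = - b} \<in> sets lborel"
      using borel_closed[OF closed_hyperplane[of a "- b"]] by simp
    ultimately have "{x. a \<bullet> x = - b} \<in> null_sets lborel"
      by (simp add: negligible_iff_null_sets null_sets_completion_iff)
    then have "AE x in lborel. x \<notin> {x. a \<bullet> x = - b}" by (rule AE_not_in)
    then show ?thesis by eventually_elim (simp add: eq eq_neg_iff_add_eq_0)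
  qed
  have "AE x in lborel. \<forall>q\<in>C - {p}. bary q (foot p x) \<noteq> 0"
    using null finite_C by (intro AE_finite_allI) auto
  then have "AE x in lborel. x \<in> ?S \<longrightarrow> foot p x \<in> face p \<longrightarrow> foot p x \<in> rel_interior (face p)"
  proof eventually_elim
    case (elim x)
    show ?case
    proof (intro impI)
      assume "foot p x \<in> face p"
      then have "bary p (foot p x) = 0 \<and> (\<forall>q\<in>C - {p}. 0 \<le> bary q (foot p x))"
        using p by (simp add: face_bary)
      then show "foot p x \<in> rel_interior (face p)"
        using elim unfolding rel_interior_face[OF p] by (auto simp: less_le)
    qed
  qed
  then have "AE x in restrict_space lborel ?S. foot p x \<in> face p \<longrightarrow> foot p x \<in> rel_interior (face p)"
    by (subst AE_restrict_space_iff) (use slab_borel in auto)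
  then have "AE x in distr (restrict_space lborel ?S) borel (foot p). x \<in> face p \<longrightarrow> x \<in> rel_interior (face p)"
    by (subst AE_distr_iff[OF m]) (use ri in auto)
  then show ?thesis
    unfolding side_measure_face[OF p] by (rule AE_completion)
qed

end

context full_simplex
begin

text \<open>The cone formula: area times height equals \<open>d\<close> times volume, with the area as the volume of the
  prism. The simplex is the image of the standard simplex under a map whose columns are edges from a
  vertex \<open>o'\<close> of the facet, the prism that of the standard prism under the map with the column of the opposite vertex
  replaced by the unit normal.\<close>

lemma measure_prism:
  assumes p: "p \<in> C"
  shows "measure lborel (prism p) = norm (bary_grad p) * CARD('n) * measure lborel (convex hull C)"
proof -
  obtain o' where o: "o' \<in> C" "o' \<noteq> p" by (rule other_vertex)
  have "card (UNIV :: 'n set) = card (C - {o'})" using card_C o finite_C by simp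
  then obtain v where v: "bij_betw v (UNIV :: 'n set) (C - {o'})"
    using finite_C finite_same_card_bij[of "UNIV :: 'n set" "C - {o'}"] by auto
  have vC: "v j \<in> C" "v j \<noteq> o'" for j using bij_betwE[OF v] by auto
  have vinj: "v i = v j \<longleftrightarrow> i = j" for i j using bij_betw_imp_inj_on[OF v] by (auto simp: inj_on_def)
  have "p \<in> v ` UNIV" using bij_betw_imp_surj_on[OF v] p o by simp
  then obtain k where k: "v k = p" by blast
  have C_eq: "q = o' \<or> (\<exists>j. q = v j)" if "q \<in> C" for q
    using v that by (auto simp: bij_betw_def)
  define M where "M = (\<lambda>\<xi>::real^'n. \<Sum>j\<in>UNIV. \<xi> $ j *\<^sub>R (v j - o'))"
  define N where "N = (\<lambda>\<xi>::real^'n. \<Sum>j\<in>UNIV. \<xi> $ j *\<^sub>R (if j = k then dir p else v j - o'))"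
  have linM: "linear M" and linN: "linear N" unfolding M_def N_def
    by (rule linearI; simp add: scaleR_add_left sum.distrib scaleR_sum_right)+
  have axis_sum: "(\<Sum>i\<in>UNIV. axis j (1::real) $ i *\<^sub>R c i) = c j" for j :: 'n and c :: "'n \<Rightarrow> real^'n"
  proof -
    have "(\<Sum>i\<in>UNIV. axis j (1::real) $ i *\<^sub>R c i) = (\<Sum>i\<in>UNIV. if i = j then c i else 0)"
      by (rule sum.cong) (auto simp: axis_def)
    then show ?thesis by simp
  qed
  have M_bary: "bary (v j) (o' + M \<xi>) = \<xi> $ j" for j \<xi>
  proof -
    have "bary_grad (v j) \<bullet> M \<xi> = (\<Sum>i\<in>UNIV. if i = j then \<xi> $ i else 0)"
      unfolding M_def inner_sum_right
      by (rule sum.cong) (auto simp: vC o bary_grad_edge vinj)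
    moreover have "bary (v j) o' = 0" using vC[of j] o by (simp add: bary_vertex)
    ultimately show ?thesis by (simp add: bary_add)
  qed
  have M_bary0: "bary o' (o' + M \<xi>) = 1 - (\<Sum>j\<in>UNIV. \<xi> $ j)" for \<xi>
  proof -
    have "bary_grad o' \<bullet> M \<xi> = (\<Sum>i\<in>UNIV. - \<xi> $ i)"
      unfolding M_def inner_sum_right
      by (rule sum.cong) (auto simp: vC o bary_grad_edge vC(2)[symmetric])
    then show ?thesis using o by (simp add: bary_add bary_vertex sum_negf)
  qed
  have M_surj: "o' + M (\<chi> j. bary (v j) x) = x" for x
  proof -
    have "M (\<chi> j. bary (v j) x) = (\<Sum>q\<in>C - {o'}. bary q x *\<^sub>R (q - o'))"
      unfolding M_def using sum.reindex_bij_betw[OF v, of "\<lambda>q. bary q x *\<^sub>R (q - o')"] by simp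
    also have "\<dots> = (\<Sum>q\<in>C. bary q x *\<^sub>R (q - o'))"
      by (rule sum_remove_vertex) (use o in simp_all)
    also have "\<dots> = x - o'"
      by (simp add: scaleR_diff_right sum_subtractf bary_repr scaleR_sum_left[symmetric] sum_bary)
    finally show ?thesis by simp
  qed
  have T: "(\<lambda>\<xi>. o' + M \<xi>) ` std_simplex_vec = convex hull C"
  proof (rule image_eq_of_surj)
    show "\<exists>\<xi>. o' + M \<xi> = x" for x using M_surj[of x] by blast
    show "o' + M \<xi> \<in> convex hull C \<longleftrightarrow> \<xi> \<in> std_simplex_vec" for \<xi>
    proof -
      have "o' + M \<xi> \<in> convex hull C \<longleftrightarrow> 0 \<le> bary o' (o' + M \<xi>) \<and> (\<forall>j. 0 \<le> bary (v j) (o' + M \<xi>))"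
        unfolding convex_hull_bary using C_eq vC o(1) by blast
      then show ?thesis by (auto simp: M_bary M_bary0 std_simplex_vec_def)
    qed
  qed
  define cut where "cut = (\<lambda>\<xi>::real^'n. (\<chi> j. if j = k then 0 else \<xi> $ j))"
  have N_cut: "N \<xi> = M (cut \<xi>) + \<xi> $ k *\<^sub>R dir p" for \<xi>
  proof -
    have "N \<xi> = (\<Sum>j\<in>UNIV. cut \<xi> $ j *\<^sub>R (v j - o') + (if j = k then \<xi> $ j *\<^sub>R dir p else 0))"
      unfolding N_def by (rule sum.cong) (auto simp: cut_def)
    then show ?thesis by (simp add: M_def sum.distrib)
  qed
  have g0: "norm (bary_grad p) > 0" using bary_grad_nonzero[OF p] by simp
  have N_bary: "bary p (o' + N \<xi>) = \<xi> $ k * norm (bary_grad p)" for \<xi>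
  proof -
    have "bary p (o' + N \<xi>) = bary p (o' + M (cut \<xi>)) + bary_grad p \<bullet> (\<xi> $ k *\<^sub>R dir p)"
      unfolding N_cut bary_add[symmetric] by (simp add: add.assoc)
    also have "bary p (o' + M (cut \<xi>)) = 0" using M_bary[of k "cut \<xi>"] by (simp add: k cut_def)
    finally show ?thesis using p by (simp add: bary_grad_inner_dir)
  qed
  have N_foot: "foot p (o' + N \<xi>) = o' + M (cut \<xi>)" for \<xi>
  proof -
    have "foot p (o' + N \<xi>) = o' + N \<xi> - \<xi> $ k *\<^sub>R dir p"
      using g0 by (simp add: foot_def N_bary)
    then show ?thesis by (simp add: N_cut)
  qed
  have N_surj: "\<exists>\<xi>. o' + N \<xi> = x" for x
  proof
    define \<eta> where "\<eta> = (\<chi> j. bary (v j) (foot p x))"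
    define \<xi> where "\<xi> = (\<chi> j. if j = k then bary p x / norm (bary_grad p) else \<eta> $ j)"
    have "cut \<xi> = \<eta>" using bary_foot[OF p, of x] by (simp add: cut_def \<xi>_def \<eta>_def vec_eq_iff k)
    then have "o' + N \<xi> = foot p x + (bary p x / norm (bary_grad p)) *\<^sub>R dir p"
      using M_surj[of "foot p x"] by (simp add: N_cut \<eta>_def[symmetric] \<xi>_def add.assoc[symmetric])
    then show "o' + N \<xi> = x" by (simp add: foot_def)
  qed
  have P: "(\<lambda>\<xi>. o' + N \<xi>) ` std_prism_vec k = prism p"
  proof (rule image_eq_of_surj[OF N_surj])
    show "o' + N \<xi> \<in> prism p \<longleftrightarrow> \<xi> \<in> std_prism_vec k" for \<xi>
    proof -
      have "o' + N \<xi> \<in> prism p \<longleftrightarrow> \<bar>\<xi> $ k\<bar> \<le> 1/2 \<and> o' + M (cut \<xi>) \<in> face p"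
        using g0 by (simp add: prism_def N_bary N_foot abs_mult field_simps)
      also have "o' + M (cut \<xi>) \<in> face p \<longleftrightarrow>
          0 \<le> bary o' (o' + M (cut \<xi>)) \<and> (\<forall>j. j \<noteq> k \<longrightarrow> 0 \<le> bary (v j) (o' + M (cut \<xi>)))"
      proof -
        have "bary p (o' + M (cut \<xi>)) = 0" using M_bary[of k "cut \<xi>"] by (simp add: k cut_def)
        moreover have "v j \<in> C - {p} \<longleftrightarrow> j \<noteq> k" for j using vC vinj[of j k] k by auto
        ultimately show ?thesis
          unfolding face_bary[OF p] using C_eq o by blast
      qed
      also have "(\<Sum>j\<in>UNIV. cut \<xi> $ j) = (\<Sum>j\<in>UNIV - {k}. \<xi> $ j)"
        unfolding cut_def by (subst sum.remove[of _ k]) (auto intro!: sum.cong)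
      then have "bary o' (o' + M (cut \<xi>)) = 1 - (\<Sum>j\<in>UNIV - {k}. \<xi> $ j)"
        by (simp add: M_bary0)
      finally show ?thesis
        by (auto simp: M_bary std_prism_vec_def cut_def)
    qed
  qed
  \<comment> \<open>the edge to \<open>p\<close>, the \<open>k\<close>-th column of \<open>M\<close>, in terms of the columns of \<open>N\<close>\<close>
  obtain \<xi>0 where x0: "o' + N \<xi>0 = p" using N_surj by blast
  then have x0k: "\<xi>0 $ k = 1 / norm (bary_grad p)"
    using N_bary[of \<xi>0] p g0 by (simp add: bary_vertex field_simps)
  obtain m where "m \<ge> 0" "\<And>S. S \<in> lmeasurable \<Longrightarrow> N ` S \<in> lmeasurable"
    and m: "\<And>S. S \<in> lmeasurable \<Longrightarrow> measure lebesgue (N ` S) = m * measure lebesgue S"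
    using linear_image_scale[OF linN] by blast
  have "measure lebesgue (M ` std_simplex_vec) = \<bar>\<xi>0 $ k\<bar> * measure lebesgue (N ` std_simplex_vec)"
  proof (rule measure_replace_column[OF linN linM])
    show "M (axis j 1) = N (axis j 1)" if "j \<noteq> k" for j
      using that unfolding M_def N_def axis_sum by simp
    have "M (axis k 1) = p - o'" unfolding M_def axis_sum k ..
    then show "M (axis k 1) = N \<xi>0" using x0[symmetric] by simp
  qed (rule measure_std_prism_vec)
  then have 1: "norm (bary_grad p) * measure lebesgue (M ` std_simplex_vec) = m * measure lebesgue (std_simplex_vec :: (real^'n) set)"
    using g0 by (simp add: x0k m[OF measure_std_prism_vec(4)])
  have "measure lebesgue (prism p) = m * measure lebesgue (std_prism_vec k)"
    unfolding P[symmetric] measure_translated_image m[OF measure_std_prism_vec(3)] ..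
  also have "\<dots> = CARD('n) * (norm (bary_grad p) * measure lebesgue (M ` std_simplex_vec))"
    unfolding 1 measure_std_prism_vec(1) by simp
  also have "measure lebesgue (M ` std_simplex_vec) = measure lebesgue (convex hull C)"
    unfolding T[symmetric] measure_translated_image ..
  finally show ?thesis
    using borel_compact[OF compact_hull] borel_compact[OF compact_prism[OF p]] by simp
qed

lemma measure_prism_pos: "p \<in> C \<Longrightarrow> measure lborel (prism p) > 0"
  using measure_pos bary_grad_nonzero[of p] by (simp add: measure_prism zero_less_card_finite)

lemma side_mean_face:
  assumes p: "p \<in> C"
  shows "side_mean (face p) (\<lambda>x. c + b \<bullet> x) = (\<Sum>r\<in>C - {p}. c + b \<bullet> r) / CARD('n)"
proof -
  define g where "g r = bary_grad r - ((bary_grad r \<bullet> dir p) / norm (bary_grad p)) *\<^sub>R bary_grad p" for r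
  define h where "h r = bary_const r - (bary_grad r \<bullet> dir p) / norm (bary_grad p) * bary_const p" for r
  have gh: "g r \<bullet> x + h r = bary r (foot p x)" for r x
    by (simp add: foot_def bary_def inner_diff_right g_def h_def inner_diff_left algebra_simps add_divide_distrib)
  have "card (C - {p}) = CARD('n)" using p card_C finite_C by simp
  then have ne: "C - {p} \<noteq> {}" by (metis card.empty zero_less_card_finite less_irrefl)
  have sums: "(\<Sum>r\<in>C - {p}. (c + b \<bullet> r) * bary r (foot p x)) = c + b \<bullet> foot p x" for c b x
    using sum_remove_vertex[OF p, of "\<lambda>r. (c + b \<bullet> r) * bary r (foot p x)"] bary_foot[OF p, of x]
    by (simp add: vertex_sum)
  have "(LINT x:face p|side_measure (face p). c + b \<bullet> x) = (LINT x:prism p|lborel. c + b \<bullet> foot p x)"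
    by (rule integral_side[OF p]) simp
  also have "\<dots> = (LINT x:prism p|lborel. (\<Sum>r\<in>C - {p}. (c + b \<bullet> r) * (g r \<bullet> x + h r)))"
    unfolding gh sums ..
  also have "\<dots> = measure lborel (prism p) / card (C - {p}) * (\<Sum>r\<in>C - {p}. c + b \<bullet> r)"
  proof (rule integral_symmetric_partition[OF compact_prism[OF p] _ ne])
    show "finite (C - {p})" using finite_C by simp
    show "(\<Sum>r\<in>C - {p}. g r \<bullet> x + h r) = 1" for x
      unfolding gh using sums[of 1 0 x] by simp
    fix r s assume rs: "r \<in> C - {p}" "s \<in> C - {p}" "r \<noteq> s"
    have p_edge: "bary_grad p \<bullet> (s - r) = 0" using rs p by (auto simp: bary_grad_edge)
    show "(g r - g s) \<bullet> (s - r) = -2"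
      using rs by (simp add: inner_diff_left g_def p_edge bary_grad_edge)
    fix x assume x: "x \<in> prism p"
    define t where "t = bary r (foot p x) - bary s (foot p x)"
    have b: "bary p (x + t *\<^sub>R (s - r)) = bary p x" by (simp add: bary_add p_edge)
    then have f: "foot p (x + t *\<^sub>R (s - r)) = foot p x + t *\<^sub>R (s - r)"
      by (simp add: foot_def)
    have "foot p x \<in> face p" using x by (simp add: prism_def)
    then have face: "bary p (foot p x) = 0" "\<And>q. q \<in> C - {p} \<Longrightarrow> 0 \<le> bary q (foot p x)"
      using p by (simp_all add: face_bary)
    have "0 \<le> bary q (foot p x + t *\<^sub>R (s - r))" if q: "q \<in> C - {p}" for q
    proof -
      have "bary q (foot p x + t *\<^sub>R (s - r)) =
          (if q = r then bary s (foot p x) else if q = s then bary r (foot p x) else bary q (foot p x))"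
        using rs q by (simp add: bary_add bary_grad_edge t_def)
      then show ?thesis using face(2) q rs by simp
    qed
    moreover have "bary p (foot p x + t *\<^sub>R (s - r)) = 0" by (simp add: bary_add p_edge face(1))
    ultimately have "foot p (x + t *\<^sub>R (s - r)) \<in> face p" unfolding f using p by (simp add: face_bary)
    then have "x + t *\<^sub>R (s - r) \<in> prism p" using x b by (simp add: prism_def)
    then show "x + ((g r \<bullet> x + h r) - (g s \<bullet> x + h s)) *\<^sub>R (s - r) \<in> prism p"
      unfolding gh t_def .
  qed
  finally have "(LINT x:face p|side_measure (face p). c + b \<bullet> x)
      = measure lborel (prism p) / CARD('n) * (\<Sum>r\<in>C - {p}. c + b \<bullet> r)"
    using \<open>card (C - {p}) = CARD('n)\<close> by simp
  then show ?thesis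
    unfolding side_mean_def measure_side[OF p] using measure_prism_pos[OF p] by simp
qed

subsection \<open>Integration by parts and affine basis on one element\<close>

text \<open>At a vertex \<open>q\<close> the conditions say that \<open>A + L q\<close> is orthogonal to all barycentric gradients but that of \<open>q\<close>;
  since the gradients add up to zero, it is orthogonal to that one as well, and they span the space.\<close>

lemma affine_zero:
  assumes L: "linear L" and w: "\<And>q r. q \<in> C \<Longrightarrow> r \<in> C \<Longrightarrow> r \<noteq> q \<Longrightarrow> bary_grad r \<bullet> (A + L q) = 0"
  shows "A = 0" "L x = 0"
proof -
  have q0: "A + L q = 0" if q: "q \<in> C" for q
  proof -
    have "(\<Sum>r\<in>C. bary_grad r \<bullet> (A + L q)) = bary_grad q \<bullet> (A + L q)"
      using q finite_C w by (subst sum.remove[of _ q]) auto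
    then have "bary_grad q \<bullet> (A + L q) = 0" by (simp only: sum_bary_grad)
    then have "(bary_grad r \<bullet> (A + L q)) *\<^sub>R r = 0" if "r \<in> C" for r
      using w[OF q that] by (cases "r = q") simp_all
    then have "(\<Sum>r\<in>C. (bary_grad r \<bullet> (A + L q)) *\<^sub>R r) = 0" by (intro sum.neutral) simp
    then show ?thesis by (simp only: bary_grad_repr)
  qed
  have "A + L x = 0" for x
  proof -
    have "A + L x = (\<Sum>q\<in>C. bary q x) *\<^sub>R A + L (\<Sum>q\<in>C. bary q x *\<^sub>R q)"
      by (simp add: sum_bary bary_repr)
    also have "\<dots> = (\<Sum>q\<in>C. bary q x *\<^sub>R (A + L q))"
      by (simp add: linear_sum[OF L] linear_scale[OF L] scaleR_sum_left sum.distrib scaleR_add_right)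
    also have "\<dots> = 0" by (intro sum.neutral) (simp add: q0)
    finally show ?thesis .
  qed
  from this[of 0] this[of x] show "A = 0" "L x = 0" by (simp_all add: linear_0[OF L])
qed

text \<open>An affine field with constant normal component on every facet is \<open>\<Sum>p\<in>C. \<gamma> p *\<^sub>R (x - p)\<close>: the summand
  of \<open>p\<close> is tangential to all facets containing \<open>p\<close>, and with the coefficients \<open>\<gamma> p\<close> given by the fluxes the difference
  of both fields is tangential to all facets, hence zero. Both sides of the identity are then
  explicit in the values at the vertices, by the mean value formulas and the cone formula.\<close>

lemma element_integration_by_parts:
  fixes A b :: "real^'n" and B :: "real^'n^'n"
  assumes \<kappa>: "\<And>p x. p \<in> C \<Longrightarrow> x \<in> face p \<Longrightarrow> (A + B *v x) \<bullet> outer_normal (convex hull C) (face p) = \<kappa> p"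
  shows "(LINT x:convex hull C|lborel. (A + B *v x) \<bullet> b)
       + (LINT x:convex hull C|lborel. c + b \<bullet> x) * (\<Sum>i\<in>UNIV. B $ i $ i)
     = (\<Sum>p\<in>C. measure (side_measure (face p)) (face p) * \<kappa> p * side_mean (face p) (\<lambda>x. c + b \<bullet> x))"
proof -
  define \<gamma> where "\<gamma> p = norm (bary_grad p) * \<kappa> p" for p
  define \<Gamma> where "\<Gamma> = (\<Sum>p\<in>C. \<gamma> p)"
  define L where "L x = B *v x - \<Gamma> *\<^sub>R x" for x
  define A' where "A' = A + (\<Sum>p\<in>C. \<gamma> p *\<^sub>R p)"
  have L: "linear L" unfolding L_def
    by (intro linear_compose_sub matrix_vector_mul_linear bounded_linear.linear[OF bounded_linear_scaleR_right])
  have w: "bary_grad r \<bullet> (A' + L q) = 0" if q: "q \<in> C" and r: "r \<in> C" "r \<noteq> q" for q r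
  proof -
    have "A' + L q = (A + B *v q) - (\<Sum>p\<in>C. \<gamma> p *\<^sub>R (q - p))"
      by (simp add: A'_def L_def \<Gamma>_def scaleR_diff_right sum_subtractf scaleR_sum_left)
    moreover have "bary_grad r \<bullet> (A + B *v q) = - \<gamma> r"
    proof -
      have "q \<in> face r" using q r vertex_in_face by auto
      then have "(A + B *v q) \<bullet> - dir r = \<kappa> r" using \<kappa>[OF r(1)] by (simp add: outer_normal_face[OF r(1)])
      then have "dir r \<bullet> (A + B *v q) = - \<kappa> r" by (simp add: inner_commute)
      then show ?thesis unfolding \<gamma>_def by (subst bary_grad_dir) simp
    qed
    moreover have "bary_grad r \<bullet> (\<Sum>p\<in>C. \<gamma> p *\<^sub>R (q - p)) = - \<gamma> r"
    proof -
      have "bary_grad r \<bullet> (\<Sum>p\<in>C. \<gamma> p *\<^sub>R (q - p)) = (\<Sum>p\<in>C. if p = r then - \<gamma> p else 0)"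
        unfolding inner_sum_right
        by (rule sum.cong) (use q r in \<open>auto simp: bary_grad_diff bary_vertex\<close>)
      then show ?thesis using r(1) finite_C by simp
    qed
    ultimately show ?thesis by (simp add: inner_diff_right)
  qed
  have A: "A = - (\<Sum>p\<in>C. \<gamma> p *\<^sub>R p)" using affine_zero(1)[OF L w] by (simp add: A'_def eq_neg_iff_add_eq_0)
  have B: "B *v x = \<Gamma> *\<^sub>R x" for x using affine_zero(2)[OF L w, of x] by (simp add: L_def)
  have "B $ i $ i = \<Gamma>" for i
  proof -
    have "(B *v axis i 1) $ i = \<Gamma>" by (simp add: B)
    then show ?thesis by (simp add: matrix_vector_mult_basis column_def)
  qed
  then have tr: "(\<Sum>i\<in>UNIV. B $ i $ i) = CARD('n) * \<Gamma>" by simp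
  define V where "V = measure lborel (convex hull C)"
  define n1 where "n1 = real CARD('n) + 1"
  have n1: "n1 > 0" "real (card C) = n1" by (simp_all add: n1_def card_C)
  define S where "S = (\<Sum>r\<in>C. b \<bullet> r)"
  define W where "W = (\<Sum>p\<in>C. \<gamma> p * (b \<bullet> p))"
  have i1: "(LINT x:convex hull C|lborel. (A + B *v x) \<bullet> b) = V / n1 * (n1 * (A \<bullet> b) + \<Gamma> * S)"
  proof -
    have "(A + B *v x) \<bullet> b = A \<bullet> b + (\<Gamma> *\<^sub>R b) \<bullet> x" for x
      by (simp add: B inner_add_left inner_commute[of x b])
    then have "(LINT x:convex hull C|lborel. (A + B *v x) \<bullet> b)
        = (LINT x:convex hull C|lborel. A \<bullet> b + (\<Gamma> *\<^sub>R b) \<bullet> x)" by simp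
    also have "\<dots> = V / n1 * (\<Sum>r\<in>C. A \<bullet> b + (\<Gamma> *\<^sub>R b) \<bullet> r)"
      unfolding V_def n1_def by (rule integral_simplex)
    also have "(\<Sum>r\<in>C. A \<bullet> b + (\<Gamma> *\<^sub>R b) \<bullet> r) = n1 * (A \<bullet> b) + \<Gamma> * S"
      by (simp add: sum.distrib n1(2) S_def sum_distrib_left)
    finally show ?thesis .
  qed
  have i2: "(LINT x:convex hull C|lborel. c + b \<bullet> x) = V / n1 * (n1 * c + S)"
    unfolding integral_simplex V_def n1_def by (simp add: sum.distrib card_C S_def add.commute)
  have Ab: "A \<bullet> b = - W" by (simp add: A W_def inner_sum_left inner_commute[of b])
  have side: "measure (side_measure (face p)) (face p) * \<kappa> p * side_mean (face p) (\<lambda>x. c + b \<bullet> x)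
      = V * (\<gamma> p * (n1 * c + S - c) - \<gamma> p * (b \<bullet> p))" if p: "p \<in> C" for p
  proof -
    have "(\<Sum>r\<in>C - {p}. c + b \<bullet> r) = n1 * c + S - (c + b \<bullet> p)"
      using sum.remove[OF finite_C p, of "\<lambda>r. c + b \<bullet> r"] by (simp add: sum.distrib n1(2) S_def)
    then have "measure (side_measure (face p)) (face p) * \<kappa> p * side_mean (face p) (\<lambda>x. c + b \<bullet> x)
        = norm (bary_grad p) * CARD('n) * V * \<kappa> p * ((n1 * c + S - (c + b \<bullet> p)) / CARD('n))"
      by (simp only: measure_side[OF p] measure_prism[OF p] side_mean_face[OF p] V_def)
    also have "\<dots> = V * (\<gamma> p * (n1 * c + S - (c + b \<bullet> p)))"
      by (simp add: \<gamma>_def)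
    finally show ?thesis by (simp add: algebra_simps)
  qed
  have "(\<Sum>p\<in>C. measure (side_measure (face p)) (face p) * \<kappa> p * side_mean (face p) (\<lambda>x. c + b \<bullet> x))
      = (\<Sum>p\<in>C. V * (\<gamma> p * (n1 * c + S - c) - \<gamma> p * (b \<bullet> p)))"
    by (rule sum.cong) (simp_all add: side)
  also have "\<dots> = V * (\<Gamma> * (n1 * c + S - c) - W)"
    unfolding \<Gamma>_def W_def by (simp only: sum_distrib_left[symmetric] sum_subtractf sum_distrib_right[symmetric])
  finally have Q: "(\<Sum>p\<in>C. measure (side_measure (face p)) (face p) * \<kappa> p * side_mean (face p) (\<lambda>x. c + b \<bullet> x))
      = V * (\<Gamma> * (n1 * c + S - c) - W)" .
  have d: "real CARD('n) = n1 - 1" by (simp add: n1_def)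
  show ?thesis
    unfolding Q i1 i2 tr Ab d using n1(1) by (simp add: field_simps)
qed

text \<open>The local Crouzeix-Raviart basis function \<open>1 - d * bary p\<close>: on the facet opposite to \<open>p\<close> it is one, on
  any other facet the coordinate \<open>bary p\<close> has the mean value \<open>1 / d\<close>.\<close>

lemma element_basis:
  assumes p: "p \<in> C" and q: "q \<in> C"
  shows "side_mean (face q) (\<lambda>x. (1 - real CARD('n) * bary_const p) + (- real CARD('n) *\<^sub>R bary_grad p) \<bullet> x)
    = (if q = p then 1 else 0)"
proof -
  have "(\<Sum>r\<in>C - {q}. (1 - real CARD('n) * bary_const p) + (- real CARD('n) *\<^sub>R bary_grad p) \<bullet> r)
      = (\<Sum>r\<in>C - {q}. 1 - real CARD('n) * (if r = p then 1 else 0))"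
    using p by (intro sum.cong refl) (auto simp: bary_vertex[symmetric] bary_def algebra_simps)
  also have "\<dots> = real CARD('n) - real CARD('n) * (if q = p then 0 else 1)"
    proof -
    have "(\<Sum>r\<in>C - {q}. (if r = p then 1 else 0)) = (if q = p then 0 else 1::real)"
      using p finite_C by simp
    moreover have "card (C - {q}) = CARD('n)" using q finite_C card_C by simp
    ultimately show ?thesis by (simp only: sum_subtractf sum_distrib_left[symmetric] sum_constant)
  qed
  finally show ?thesis
    unfolding side_mean_face[OF q] by (simp add: zero_less_card_finite)
qed

end

section \<open>Elements and sides\<close>

lemma full_simplexE:
  fixes T :: "(real^'n) set"
  assumes "int CARD('n) simplex T"
  obtains C where "full_simplex C" "T = convex hull C"
proof -
  obtain C where C: "\<not> affine_dependent C" "int (card C) = int CARD('n) + 1" "T = convex hull C"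
    using assms unfolding simplex_def by blast
  then have "full_simplex C" by unfold_locales auto
  with C(3) show thesis by (rule that[rotated])
qed

lemma element_interior_nonempty:
  fixes T :: "(real^'n) set"
  assumes "int CARD('n) simplex T" shows "interior T \<noteq> {}"
  using full_simplexE[OF assms] full_simplex.interior_nonempty by metis

lemma element_compact:
  fixes T :: "(real^'n) set"
  assumes "int CARD('n) simplex T" shows "compact T"
  using full_simplexE[OF assms] full_simplex.compact_hull by metis

lemma element_convex:
  fixes T :: "(real^'n) set"
  assumes "int CARD('n) simplex T" shows "convex T"
  using full_simplexE[OF assms] convex_convex_hull by metis

lemma element_measure_pos:
  fixes T :: "(real^'n) set"
  assumes "int CARD('n) simplex T" shows "measure lebesgue T > 0"
proof -
  have "measure lborel T > 0" using full_simplexE[OF assms] full_simplex.measure_pos by metis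
  then show ?thesis using borel_compact[OF element_compact[OF assms]] by simp
qed

lemma element_finite_facets:
  fixes T :: "(real^'n) set"
  assumes "int CARD('n) simplex T" shows "finite {F. F facet_of T}"
proof -
  obtain C where C: "full_simplex C" "T = convex hull C" using assms by (rule full_simplexE)
  then interpret full_simplex C by simp
  have "{F. F facet_of T} = face ` C" unfolding C(2) facet_iff by blast
  then show ?thesis using finite_C by simp
qed

lemma facetE:
  fixes T :: "(real^'n) set"
  assumes "int CARD('n) simplex T" "F facet_of T"
  obtains C p where "full_simplex C" "T = convex hull C" "p \<in> C" "F = full_simplex.face C p"
proof -
  obtain C where C: "full_simplex C" "T = convex hull C" using assms(1) by (rule full_simplexE)
  then obtain p where "p \<in> C" "F = full_simplex.face C p"
    using assms(2) full_simplex.facet_iff[OF C(1), of F] by blast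
  with C show thesis by (rule that)
qed

lemma facet_compact_convex:
  fixes T :: "(real^'n) set"
  assumes "int CARD('n) simplex T" "F facet_of T"
  shows "compact F" "convex F" "rel_interior F \<noteq> {}"
proof -
  obtain C p where C: "full_simplex C" "T = convex hull C" "p \<in> C" "F = full_simplex.face C p"
    using assms by (rule facetE)
  show "compact F" using full_simplex.compact_face[OF C(1)] C(4) by simp
  show "convex F" using full_simplex.face_def[OF C(1), of p] C(4) by (simp add: convex_convex_hull)
  then show "rel_interior F \<noteq> {}" using assms(2) by (simp add: rel_interior_eq_empty facet_of_def)
qed

lemma facet_measure_pos:
  fixes T :: "(real^'n) set"
  assumes "int CARD('n) simplex T" "F facet_of T"
  shows "measure (side_measure F) F > 0"
proof -
  obtain C p where C: "full_simplex C" "T = convex hull C" "p \<in> C" "F = full_simplex.face C p"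
    using assms by (rule facetE)
  show ?thesis
    unfolding C(4) full_simplex.measure_side[OF C(1,3)] by (rule full_simplex.measure_prism_pos[OF C(1,3)])
qed

lemma facet_AE_rel_interior:
  fixes T :: "(real^'n) set"
  assumes "int CARD('n) simplex T" "F facet_of T"
  shows "AE x in side_measure F. x \<in> F \<longrightarrow> x \<in> rel_interior F"
proof -
  obtain C p where C: "full_simplex C" "T = convex hull C" "p \<in> C" "F = full_simplex.face C p"
    using assms by (rule facetE)
  show ?thesis unfolding C(4) by (rule full_simplex.side_AE_rel_interior[OF C(1,3)])
qed

lemma facet_halfspace:
  fixes T :: "(real^'n) set"
  assumes "int CARD('n) simplex T" "F facet_of T" "x \<in> rel_interior F"
  shows "norm (outer_normal T F) = 1"
    "\<exists>e>0. \<forall>y\<in>ball x e. y \<in> T \<longleftrightarrow> outer_normal T F \<bullet> (y - x) \<le> 0"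
proof -
  obtain C p where C: "full_simplex C" "T = convex hull C" "p \<in> C" "F = full_simplex.face C p"
    using assms(1,2) by (rule facetE)
  have n: "outer_normal T F = - full_simplex.dir C p"
    unfolding C(2,4) by (rule full_simplex.outer_normal_face[OF C(1,3)])
  show "norm (outer_normal T F) = 1" using full_simplex.norm_dir[OF C(1,3)] by (simp add: n)
  show "\<exists>e>0. \<forall>y\<in>ball x e. y \<in> T \<longleftrightarrow> outer_normal T F \<bullet> (y - x) \<le> 0"
  proof -
    have "\<exists>e>0. \<forall>y\<in>ball x e. y \<in> T \<longleftrightarrow> 0 \<le> full_simplex.dir C p \<bullet> (y - x)"
      unfolding C(2) by (rule full_simplex.local_halfspace[OF C(1,3)]) (use assms(3) C(4) in simp)
    then show ?thesis by (simp add: n)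
  qed
qed

lemma element_ibp:
  fixes T :: "(real^'n) set" and A b :: "real^'n" and B :: "real^'n^'n"
  assumes T: "int CARD('n) simplex T"
    and \<kappa>: "\<And>F x. F facet_of T \<Longrightarrow> x \<in> F \<Longrightarrow> (A + B *v x) \<bullet> outer_normal T F = \<kappa> F"
  shows "(LINT x:T|lebesgue. (A + B *v x) \<bullet> b) + (LINT x:T|lebesgue. c + b \<bullet> x) * (\<Sum>i\<in>UNIV. B $ i $ i)
     = (\<Sum>F | F facet_of T. measure (side_measure F) F * \<kappa> F * side_mean F (\<lambda>x. c + b \<bullet> x))"
proof -
  obtain C where C: "full_simplex C" "T = convex hull C" using T by (rule full_simplexE)
  interpret full_simplex C by (rule C(1))
  have leb: "(LINT x:T|lebesgue. w x) = (LINT x:T|lborel. w x)" if "w \<in> borel_measurable borel" for w :: "real^'n \<Rightarrow> real"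
    unfolding set_lebesgue_integral_def using borel_compact[OF element_compact[OF T]] that
    by (intro integral_completion) simp
  have "(\<lambda>x. (A + B *v x) \<bullet> b) \<in> borel_measurable borel"
    by (intro borel_measurable_continuous_onI continuous_intros linear_continuous_on)
       (simp add: linear_linear matrix_vector_mul_linear)
  moreover have "(\<lambda>x. c + b \<bullet> x) \<in> borel_measurable borel"
    by (intro borel_measurable_continuous_onI continuous_intros)
  ultimately have "(LINT x:T|lebesgue. (A + B *v x) \<bullet> b) + (LINT x:T|lebesgue. c + b \<bullet> x) * (\<Sum>i\<in>UNIV. B $ i $ i)
      = (LINT x:convex hull C|lborel. (A + B *v x) \<bullet> b) + (LINT x:convex hull C|lborel. c + b \<bullet> x) * (\<Sum>i\<in>UNIV. B $ i $ i)"
    by (simp only: leb) (simp only: C(2))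
  also have "\<dots> = (\<Sum>p\<in>C. measure (side_measure (face p)) (face p) * \<kappa> (face p) * side_mean (face p) (\<lambda>x. c + b \<bullet> x))"
    by (rule element_integration_by_parts) (rule \<kappa>[unfolded C(2)], auto simp: facet_iff)
  also have "\<dots> = (\<Sum>F\<in>face ` C. measure (side_measure F) F * \<kappa> F * side_mean F (\<lambda>x. c + b \<bullet> x))"
    by (simp add: sum.reindex[OF inj_face])
  also have "face ` C = {F. F facet_of T}" unfolding C(2) facet_iff by blast
  finally show ?thesis .
qed

lemma element_dual_basis:
  fixes T :: "(real^'n) set"
  assumes T: "int CARD('n) simplex T"
  shows "\<exists>\<kappa> \<gamma>. \<forall>F G. F facet_of T \<longrightarrow> G facet_of T \<longrightarrow>
     side_mean G (\<lambda>x. \<kappa> F + (\<gamma> F :: real^'n) \<bullet> x) = (if G = F then 1 else 0)"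
proof -
  obtain C where C: "full_simplex C" "T = convex hull C" using T by (rule full_simplexE)
  interpret full_simplex C by (rule C(1))
  define v where "v F = the_inv_into C face F" for F
  have v: "v (face p) = p" if "p \<in> C" for p
    unfolding v_def by (rule the_inv_into_f_f[OF inj_face that])
  have "side_mean G (\<lambda>x. (1 - real CARD('n) * bary_const (v F)) + (- real CARD('n) *\<^sub>R bary_grad (v F)) \<bullet> x)
      = (if G = F then 1 else 0)" if FG: "F facet_of T" "G facet_of T" for F G
  proof -
    obtain p q where pq: "p \<in> C" "F = face p" "q \<in> C" "G = face q"
      using FG unfolding C(2) facet_iff by blast
    have "face q = face p \<longleftrightarrow> q = p" using inj_face pq by (auto simp: inj_on_def)
    then show ?thesis unfolding pq(2,4) v[OF pq(1)] element_basis[OF pq(1,3)] by simp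
  qed
  note * = this
  show ?thesis
    by (rule exI[of _ "\<lambda>F. 1 - real CARD('n) * bary_const (v F)"], rule exI[of _ "\<lambda>F. - real CARD('n) *\<^sub>R bary_grad (v F)"], intro allI impI, rule *)
qed

lemma side_mean_affine:
  fixes T :: "(real^'n) set"
  assumes "int CARD('n) simplex T" "F facet_of T"
  shows "\<exists>m. \<forall>c b. side_mean F (\<lambda>x. c + b \<bullet> x) = c + b \<bullet> m"
proof -
  obtain C p where C: "full_simplex C" "T = convex hull C" "p \<in> C" "F = full_simplex.face C p"
    using assms by (rule facetE)
  interpret full_simplex C by (rule C(1))
  have n: "card (C - {p}) = CARD('n)" using C(3) card_C finite_C by simp
  have "side_mean F (\<lambda>x. c + b \<bullet> x) = c + b \<bullet> ((1 / real CARD('n)) *\<^sub>R (\<Sum>r\<in>C - {p}. r))" for c b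
    unfolding C(4) side_mean_face[OF C(3)]
    by (simp add: sum.distrib n inner_sum_right add_divide_distrib zero_less_card_finite)
  then show ?thesis by (intro exI[of _ "(1 / real CARD('n)) *\<^sub>R (\<Sum>r\<in>C - {p}. r)"] allI)
qed

section \<open>Geometry of the mesh\<close>

text \<open>The domain has no slits: the points just above the graph that describes the boundary near \<open>p\<close> do not
  belong to the closure, so a boundary point is not interior to the closure.\<close>

lemma lipschitz_domain_interior_closure:
  fixes \<Omega> :: "(real^'n) set"
  assumes "lipschitz_domain \<Omega>"
  shows "interior (closure \<Omega>) \<subseteq> \<Omega>"
proof
  fix p assume p: "p \<in> interior (closure \<Omega>)"
  have op: "open \<Omega>" using assms by (simp add: lipschitz_domain_def)
  show "p \<in> \<Omega>"
  proof (rule ccontr)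
    assume "p \<notin> \<Omega>"
    then have "p \<in> frontier \<Omega>"
      using p op interior_subset[of "closure \<Omega>"] by (auto simp: frontier_def interior_open)
    then obtain U e L and \<psi> :: "real^'n \<Rightarrow> real" where U: "open U" "p \<in> U" "norm e = 1"
      "L-lipschitz_on UNIV \<psi>" "\<Omega> \<inter> U = {x \<in> U. x \<bullet> e < \<psi> (x - (x \<bullet> e) *\<^sub>R e)}"
      using assms unfolding lipschitz_domain_def by meson
    have cont: "continuous_on UNIV (\<lambda>x. \<psi> (x - (x \<bullet> e) *\<^sub>R e))"
      by (rule continuous_on_compose2[OF lipschitz_on_continuous_on[OF U(4)]])
        (intro continuous_intros, rule subset_UNIV)
    define W where "W = U \<inter> {x. \<psi> (x - (x \<bullet> e) *\<^sub>R e) < x \<bullet> e}"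
    have "open W" unfolding W_def
      by (intro open_Int U(1) open_Collect_less cont continuous_intros)
    moreover have "W \<inter> \<Omega> = {}" using U(5) by (force simp: W_def)
    ultimately have disj: "W \<inter> closure \<Omega> = {}" using open_Int_closure_eq_empty by blast
    have ge: "\<psi> (p - (p \<bullet> e) *\<^sub>R e) \<le> p \<bullet> e"
      using U(2,5) \<open>p \<notin> \<Omega>\<close> by (metis (mono_tags, lifting) IntD1 mem_Collect_eq not_le)
    have "open (U \<inter> interior (closure \<Omega>))" using U(1) by (intro open_Int) auto
    moreover have "p \<in> U \<inter> interior (closure \<Omega>)" using U(2) p by simp
    ultimately obtain r where r: "r > 0" "ball p r \<subseteq> U \<inter> interior (closure \<Omega>)"
      by (meson open_contains_ball)
    define x where "x = p + (r/2) *\<^sub>R e"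
    have "dist p x < r" using r(1) U(3) by (simp add: x_def dist_norm)
    then have "x \<in> U \<inter> interior (closure \<Omega>)" using r(2) by auto
    then have x: "x \<in> U" "x \<in> closure \<Omega>" using interior_subset[of "closure \<Omega>"] by blast+
    have ee: "e \<bullet> e = 1" using U(3) by (simp add: norm_eq_1)
    have "x \<bullet> e = p \<bullet> e + r/2" by (simp add: x_def inner_add_left ee)
    moreover have "x - (x \<bullet> e) *\<^sub>R e = p - (p \<bullet> e) *\<^sub>R e"
      by (simp add: x_def inner_add_left ee scaleR_add_left)
    ultimately have "x \<in> W" using x(1) ge r(1) by (simp add: W_def)
    then show False using disj x(2) by blast
  qed
qed

locale mesh =
  fixes \<Omega> :: "(real^'n) set" and \<T> :: "(real^'n) set set"
  assumes lip: "lipschitz_domain \<Omega>" and mesh: "simplicial_mesh \<Omega> \<T>"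
begin

abbreviation "CR \<equiv> crouzeix_raviart \<Omega> \<T>"
abbreviation "RT \<equiv> raviart_thomas \<Omega> \<T>"
abbreviation "bsides \<equiv> boundary_sides \<Omega> \<T>"
abbreviation "isides \<equiv> interior_sides \<Omega> \<T>"
abbreviation "vol T \<equiv> measure lebesgue T"
abbreviation "area F \<equiv> measure (side_measure F) F"

lemma finite_T: "finite \<T>" and Union_T: "\<Union>\<T> = closure \<Omega>"
  and face_Int: "T \<in> \<T> \<Longrightarrow> T' \<in> \<T> \<Longrightarrow> T \<inter> T' face_of T"
  and simplex_T: "T \<in> \<T> \<Longrightarrow> int CARD('n) simplex T"
  using mesh by (auto simp: simplicial_mesh_def triangulation_def)

lemma open_Omega: "open \<Omega>"
  using lip by (simp add: lipschitz_domain_def)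

lemma interior_disjoint:
  assumes "T \<in> \<T>" "T' \<in> \<T>" "T \<noteq> T'" shows "interior T \<inter> interior T' = {}"
proof (rule ccontr)
  assume "interior T \<inter> interior T' \<noteq> {}"
  then obtain x where x: "x \<in> interior T" "x \<in> interior T'" by blast
  then have "x \<in> T" "x \<in> T'" using interior_subset by blast+
  have eq: "S = S \<inter> S'" if "S \<in> \<T>" "S' \<in> \<T>" "x \<in> interior S" "x \<in> S" "x \<in> S'" for S S'
  proof (rule ccontr)
    assume "S \<noteq> S \<inter> S'"
    then have "(S \<inter> S') \<inter> interior S = {}"
      by (intro face_of_disjoint_interior[OF face_Int[OF that(1,2)]]) simp
    then show False using that(3-5) by blast
  qed
  have "T = T \<inter> T'" by (rule eq[OF assms(1,2) x(1) \<open>x \<in> T\<close> \<open>x \<in> T'\<close>])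
  moreover have "T' = T' \<inter> T" by (rule eq[OF assms(2,1) x(2) \<open>x \<in> T'\<close> \<open>x \<in> T\<close>])
  ultimately show False using assms(3) by blast
qed

lemma interior_T_subset: "T \<in> \<T> \<Longrightarrow> interior T \<subseteq> \<Omega>"
  using lipschitz_domain_interior_closure[OF lip] interior_mono[of T "closure \<Omega>"] Union_T by blast

lemma finite_sides: "finite (sides \<T>)"
proof -
  have "sides \<T> = (\<Union>T\<in>\<T>. {F. F facet_of T})" by (auto simp: sides_def)
  moreover have "finite {F. F facet_of T}" if "T \<in> \<T>" for T
    by (rule element_finite_facets[OF simplex_T[OF that]])
  ultimately show ?thesis using finite_T by simp
qed

text \<open>By conformity \<open>F \<inter> G\<close> is a face of both elements, and a face of an element that meets the relative interior of a
  side contains this side.\<close>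

lemma sides_rel_interior_disjoint:
  assumes F: "F \<in> sides \<T>" and G: "G \<in> sides \<T>" and x: "x \<in> rel_interior F" "x \<in> rel_interior G"
  shows "F = G"
proof -
  obtain T T' where T: "T \<in> \<T>" "F facet_of T" "T' \<in> \<T>" "G facet_of T'"
    using F G by (auto simp: sides_def)
  have fT: "F face_of T" "G face_of T'" using T by (auto simp: facet_of_def)
  have f: "T \<inter> T' face_of T" "T' \<inter> T face_of T'"
    by (rule face_Int[OF T(1,3)], rule face_Int[OF T(3,1)])
  then have f': "T \<inter> T' face_of T'" "T' \<inter> T face_of T" by (simp_all add: Int_commute)
  have sub: "F \<subseteq> G" if "F face_of T" "G face_of T'" "T \<inter> T' face_of T" "T \<inter> T' face_of T'"
    "x \<in> rel_interior F" "x \<in> rel_interior G" for F G T T'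
  proof -
    have x: "x \<in> F" "x \<in> G" using that(5,6) rel_interior_subset by blast+
    have FT: "F \<subseteq> T" "G \<subseteq> T'" using that(1,2) face_of_imp_subset by blast+
    have "F \<inter> (T \<inter> T') face_of T \<inter> T'"
      by (rule face_of_subset[OF face_of_Int[OF that(1,3)]]) auto
    moreover have "G \<inter> (T \<inter> T') face_of T \<inter> T'"
      by (rule face_of_subset[OF face_of_Int[OF that(2,4)]]) auto
    ultimately have "(F \<inter> (T \<inter> T')) \<inter> (G \<inter> (T \<inter> T')) face_of T \<inter> T'" by (rule face_of_Int)
    then have "(F \<inter> (T \<inter> T')) \<inter> (G \<inter> (T \<inter> T')) face_of T" using that(3) by (rule face_of_trans)
    moreover have "(F \<inter> (T \<inter> T')) \<inter> (G \<inter> (T \<inter> T')) = F \<inter> G" using FT by blast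
    ultimately have "F \<inter> G face_of T" by simp
    then have "F \<subseteq> F \<inter> G"
      by (rule subset_of_face_of[OF _ FT(1)]) (use x that(5) in blast)
    then show ?thesis by blast
  qed
  have "F \<subseteq> G" by (rule sub[OF fT f(1) f'(1) x])
  moreover have "G \<subseteq> F" by (rule sub[OF fT(2,1) f(2) f'(2) x(2,1)])
  ultimately show ?thesis by blast
qed

text \<open>Otherwise the two half-spaces that the elements occupy near a relatively interior point of the
  common side overlap in a set with interior points.\<close>

lemma opposite_normals:
  assumes T: "T \<in> \<T>" "T' \<in> \<T>" "T \<noteq> T'" and F: "F facet_of T" "F facet_of T'"
  shows "outer_normal T' F = - outer_normal T F"
proof (rule ccontr)
  assume "outer_normal T' F \<noteq> - outer_normal T F"
  define n where "n = outer_normal T F"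
  define n' where "n' = outer_normal T' F"
  obtain x where x: "x \<in> rel_interior F" using facet_compact_convex(3)[OF simplex_T[OF T(1)] F(1)] by blast
  note h = facet_halfspace[OF simplex_T[OF T(1)] F(1) x, folded n_def]
  note h' = facet_halfspace[OF simplex_T[OF T(2)] F(2) x, folded n'_def]
  obtain e where e: "e > 0" "\<forall>y\<in>ball x e. y \<in> T \<longleftrightarrow> n \<bullet> (y - x) \<le> 0" using h(2) by blast
  obtain e' where e': "e' > 0" "\<forall>y\<in>ball x e'. y \<in> T' \<longleftrightarrow> n' \<bullet> (y - x) \<le> 0" using h'(2) by blast
  \<comment> \<open>the bisector: \<open>- w\<close> points into both half-spaces\<close>
  define w where "w = n + n'"
  have "w \<noteq> 0" using \<open>outer_normal T' F \<noteq> - outer_normal T F\<close> by (simp add: w_def n_def n'_def add_eq_0_iff)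
  have nn: "n \<bullet> n = 1" "n' \<bullet> n' = 1" using h(1) h'(1) by (simp_all add: norm_eq_1)
  have ww: "w \<bullet> w = 2 * (n \<bullet> w)" "n \<bullet> w = n' \<bullet> w"
    by (simp_all add: w_def inner_add_left inner_add_right nn inner_commute[of n' n])
  then have nw: "n \<bullet> w > 0" using \<open>w \<noteq> 0\<close> inner_gt_zero_iff[of w] by linarith
  define G where "G = ball x e \<inter> ball x e' \<inter> {y. n \<bullet> (y - x) < 0} \<inter> {y. n' \<bullet> (y - x) < 0}"
  have "open G" unfolding G_def by (intro open_Int open_ball open_Collect_less continuous_intros)
  moreover have "G \<subseteq> T" "G \<subseteq> T'" using e(2) e'(2) by (auto simp: G_def)
  ultimately have "G \<subseteq> interior T \<inter> interior T'" by (simp add: interior_maximal)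
  then have "G = {}" using interior_disjoint[OF T] by blast
  define s where "s = min e e' / (2 * norm w)"
  have s: "s > 0" "s * norm w < e" "s * norm w < e'"
  proof -
    have "s * norm w = min e e' / 2" using \<open>w \<noteq> 0\<close> by (simp add: s_def)
    then show "s > 0" "s * norm w < e" "s * norm w < e'"
      using e(1) e'(1) \<open>w \<noteq> 0\<close> by (simp_all add: s_def)
  qed
  have "x - s *\<^sub>R w \<in> G"
    using s nw ww by (simp add: G_def dist_norm)
  then show False using \<open>G = {}\<close> by blast
qed

lemma at_most_two_elements:
  assumes T: "T \<in> \<T>" "F facet_of T" "T' \<in> \<T>" "F facet_of T'" "T'' \<in> \<T>" "F facet_of T''" "T \<noteq> T'"
  shows "T'' = T \<or> T'' = T'"
proof (rule ccontr)
  assume "\<not> ?thesis"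
  then have ne: "T \<noteq> T''" "T' \<noteq> T''" by auto
  have "- outer_normal T' F = - outer_normal T F"
    using opposite_normals[OF T(3,5) ne(2) T(4,6)] opposite_normals[OF T(1,5) ne(1) T(2,6)] by (rule subst)
  then have "outer_normal T F = - outer_normal T F"
    using opposite_normals[OF T(1,3,7,2,4)] by (simp only: neg_equal_iff_equal)
  then have "outer_normal T F \<bullet> outer_normal T F = outer_normal T F \<bullet> (- outer_normal T F)"
    by (rule arg_cong)
  moreover obtain x where "x \<in> rel_interior F" using facet_compact_convex(3)[OF simplex_T[OF T(1)] T(2)] by blast
  ultimately show False using facet_halfspace(1)[OF simplex_T[OF T(1)] T(2)] by (simp add: norm_eq_1)
qed

text \<open>Two elements on opposite sides of \<open>F\<close> would fill a neighbourhood of a relatively interior point of \<open>F\<close>,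
  which then is an interior point of the closure of the domain and not on its boundary.\<close>

lemma boundary_side_unique_element:
  assumes F: "F \<in> bsides" and T: "T \<in> \<T>" "F facet_of T" "T' \<in> \<T>" "F facet_of T'"
  shows "T = T'"
proof (rule ccontr)
  assume "T \<noteq> T'"
  obtain x where x: "x \<in> rel_interior F" using facet_compact_convex(3)[OF simplex_T[OF T(1)] T(2)] by blast
  obtain e where e: "e > 0" "\<forall>y\<in>ball x e. y \<in> T \<longleftrightarrow> outer_normal T F \<bullet> (y - x) \<le> 0"
    using facet_halfspace(2)[OF simplex_T[OF T(1)] T(2) x] by blast
  obtain e' where e': "e' > 0" "\<forall>y\<in>ball x e'. y \<in> T' \<longleftrightarrow> outer_normal T' F \<bullet> (y - x) \<le> 0"
    using facet_halfspace(2)[OF simplex_T[OF T(3)] T(4) x] by blast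
  have op: "outer_normal T' F = - outer_normal T F" by (rule opposite_normals[OF T(1,3) \<open>T \<noteq> T'\<close> T(2,4)])
  have "ball x (min e e') \<subseteq> T \<union> T'"
  proof
    fix y assume "y \<in> ball x (min e e')"
    then show "y \<in> T \<union> T'" using e(2) e'(2) by (cases "outer_normal T F \<bullet> (y - x) \<le> 0") (auto simp: op)
  qed
  also have "T \<union> T' \<subseteq> closure \<Omega>"
    unfolding Union_T[symmetric] using Union_upper[OF T(1)] Union_upper[OF T(3)] by (rule Un_least)
  finally have "ball x (min e e') \<subseteq> interior (closure \<Omega>)"
    by (rule interior_maximal[OF _ open_ball])
  moreover have "x \<in> ball x (min e e')" using e(1) e'(1) by simp
  ultimately have "x \<in> interior (closure \<Omega>)" by blast
  then have "x \<in> \<Omega>" using lipschitz_domain_interior_closure[OF lip] by blast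
  moreover have "x \<in> frontier \<Omega>" using x F rel_interior_subset[of F] by (auto simp: boundary_sides_def)
  ultimately show False using open_Omega by (simp add: frontier_def interior_open)
qed

text \<open>The side contains a relatively interior point \<open>x\<close> in the open set \<open>\<Omega>\<close>. A point of \<open>\<Omega>\<close> beyond the side and close
  to \<open>x\<close> lies in an element that also contains \<open>x\<close>; its intersection with \<open>T\<close> is a face of \<open>T\<close> that
  contains \<open>F\<close> and is not \<open>T\<close>, hence it is \<open>F\<close>.\<close>

lemma interior_side_second_element:
  assumes F: "F \<in> isides" and T: "T \<in> \<T>" "F facet_of T"
  obtains T' where "T' \<in> \<T>" "F facet_of T'" "T' \<noteq> T"
proof -
  have "F \<subseteq> T" using T(2) by (simp add: facet_of_imp_subset)
  then have "F \<subseteq> closure \<Omega>" using T(1) Union_T by blast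
  moreover have "\<not> F \<subseteq> frontier \<Omega>"
    using F by (auto simp: interior_sides_def boundary_sides_def)
  ultimately obtain x0 where x0: "x0 \<in> F" "x0 \<in> \<Omega>"
    using open_Omega by (auto simp: frontier_def interior_open)
  have "closure (rel_interior F) = closure F"
    using facet_compact_convex(2)[OF simplex_T[OF T(1)] T(2)] by (rule convex_closure_rel_interior)
  then have "x0 \<in> closure (rel_interior F)" using x0(1) closure_subset by blast
  then have "\<Omega> \<inter> closure (rel_interior F) \<noteq> {}" using x0(2) by blast
  then have "\<Omega> \<inter> rel_interior F \<noteq> {}" by (simp add: open_Int_closure_eq_empty[OF open_Omega])
  then obtain x where x: "x \<in> rel_interior F" "x \<in> \<Omega>" by blast
  define n where "n = outer_normal T F"
  note h = facet_halfspace[OF simplex_T[OF T(1)] T(2) x(1), folded n_def]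
  obtain e where e: "e > 0" "\<forall>y\<in>ball x e. y \<in> T \<longleftrightarrow> n \<bullet> (y - x) \<le> 0" using h(2) by blast
  \<comment> \<open>stay away from all elements that do not contain \<open>x\<close>\<close>
  define K where "K = \<Union>{S \<in> \<T>. x \<notin> S}"
  have "closed K" unfolding K_def
    using finite_T element_compact[OF simplex_T] by (intro closed_Union) (auto intro: compact_imp_closed)
  then have "open (\<Omega> - K)" using open_Omega by (rule open_Diff[rotated])
  moreover have "x \<in> \<Omega> - K" using x(2) by (simp add: K_def)
  ultimately obtain d where d: "d > 0" "ball x d \<subseteq> \<Omega> - K" by (meson open_contains_ball)
  define t where "t = min e d / 2"
  have t: "t > 0" "t < e" "t < d" using e(1) d(1) by (auto simp: t_def min_def)
  define y where "y = x + t *\<^sub>R n"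
  have "dist x y = t" using t(1) h(1) by (simp add: y_def dist_norm)
  then have y: "y \<in> \<Omega>" "y \<notin> K" "y \<in> ball x e" using d(2) t by auto
  have nn: "n \<bullet> n = 1" using h(1) by (simp add: norm_eq_1)
  have "n \<bullet> (y - x) = t" by (simp add: y_def nn)
  then have "y \<notin> T" using e(2) y(3) t(1) by auto
  have "y \<in> \<Union>\<T>" using y(1) Union_T closure_subset by blast
  then obtain T' where T': "T' \<in> \<T>" "y \<in> T'" by blast
  then have "x \<in> T'" using y(2) by (auto simp: K_def)
  have "T' \<noteq> T" using T'(2) \<open>y \<notin> T\<close> by blast
  have f: "T \<inter> T' face_of T" "T \<inter> T' face_of T'"
    using face_Int[OF T(1) T'(1)] face_Int[OF T'(1) T(1)] by (simp_all add: Int_commute)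
  have fF: "F face_of T" and dF: "aff_dim F = aff_dim T - 1" and neF: "F \<noteq> {}"
    using T(2) unfolding facet_of_def by simp_all
  have "x \<in> T \<inter> T'" using \<open>x \<in> T'\<close> x(1) rel_interior_subset \<open>F \<subseteq> T\<close> by blast
  then have FTT: "F \<subseteq> T \<inter> T'"
    by (intro subset_of_face_of[OF f(1) \<open>F \<subseteq> T\<close>]) (use x(1) in blast)
  have dim: "aff_dim T = int CARD('n)" "aff_dim T' = int CARD('n)"
    using aff_dim_simplex[OF simplex_T] T(1) T'(1) by auto
  have "T \<inter> T' \<noteq> T"
  proof
    assume "T \<inter> T' = T"
    then have "T face_of T'" using f(2) by simp
    then have "aff_dim T < aff_dim T'"
      by (rule face_of_aff_dim_lt[OF element_convex[OF simplex_T[OF T'(1)]]]) (rule \<open>T' \<noteq> T\<close>[symmetric])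
    then show False using dim by simp
  qed
  then have lt: "aff_dim (T \<inter> T') < aff_dim T"
    using face_of_aff_dim_lt[OF element_convex[OF simplex_T[OF T(1)]] f(1)] by blast
  have "F face_of T \<inter> T'" by (rule face_of_subset[OF fF FTT]) auto
  moreover have "convex (T \<inter> T')" using element_convex[OF simplex_T] T(1) T'(1) by (simp add: convex_Int)
  ultimately have "F = T \<inter> T'" using face_of_aff_dim_lt[of "T \<inter> T'" F] lt dF by linarith
  then have "F facet_of T'" using f(2) dF neF dim by (simp add: facet_of_def)
  then show thesis using that T'(1) \<open>T' \<noteq> T\<close> by blast
qed

end

section \<open>Element-wise and side-wise constant functions\<close>

lemma measurable_completion_cong_AE:
  assumes g: "g \<in> borel_measurable (completion M)" and ae: "AE x in completion M. f x = g x"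
  shows "f \<in> borel_measurable (completion M)"
proof (rule measurableI)
  fix A :: "'b set" assume A: "A \<in> sets borel"
  have ae': "AE x in M. f x = g x" using ae by (simp only: AE_completion_iff)
  have "AE x in M. \<not> (f x \<noteq> g x \<and> f x \<in> A)" using ae' by eventually_elim simp
  then have 1: "{x \<in> space (completion M). f x \<noteq> g x \<and> f x \<in> A} \<in> sets (completion M)"
    using sets_completion_AE[where M = M and P = "\<lambda>x. f x \<noteq> g x \<and> f x \<in> A"] by (simp add: pred_def)
  have "AE x in M. \<not> (f x \<noteq> g x)" using ae' by eventually_elim simp
  then have 2: "{x \<in> space (completion M). f x \<noteq> g x} \<in> sets (completion M)"
    using sets_completion_AE[where M = M and P = "\<lambda>x. f x \<noteq> g x"] by (simp add: pred_def)
  have 3: "g -` A \<inter> space (completion M) \<in> sets (completion M)" by (rule measurable_sets[OF g A])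
  have "f -` A \<inter> space (completion M) = (g -` A \<inter> space (completion M) - {x \<in> space (completion M). f x \<noteq> g x})
      \<union> {x \<in> space (completion M). f x \<noteq> g x \<and> f x \<in> A}"
    by auto
  then show "f -` A \<inter> space (completion M) \<in> sets (completion M)"
    using sets.Un[OF sets.Diff[OF 3 2] 1] by simp
qed simp

lemma integral_completion_cong_AE:
  fixes f g :: "'a \<Rightarrow> 'b::{banach, second_countable_topology}"
  assumes g: "g \<in> borel_measurable (completion M)" and ae: "AE x in completion M. f x = g x"
  shows "integral\<^sup>L (completion M) f = integral\<^sup>L (completion M) g"
  by (rule integral_cong_AE[OF measurable_completion_cong_AE[OF assms] g ae])

text \<open>A reference point: piecewise constant functions are represented by their values at the reference points
  of the elements or of the sides, which turns integrals into finite sums.\<close>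

definition inner_pt :: "(real^'n) set \<Rightarrow> real^'n" where "inner_pt S = (SOME x. x \<in> rel_interior S)"

context mesh
begin

lemma rel_interior_T: "T \<in> \<T> \<Longrightarrow> rel_interior T = interior T"
  by (rule rel_interior_nonempty_interior[OF element_interior_nonempty[OF simplex_T]])

lemma inner_pt_T: "T \<in> \<T> \<Longrightarrow> inner_pt T \<in> interior T"
  unfolding inner_pt_def using element_interior_nonempty[OF simplex_T] rel_interior_T some_in_eq by metis

lemma sidesE:
  assumes "F \<in> sides \<T>" obtains T where "T \<in> \<T>" "F facet_of T"
  using assms by (auto simp: sides_def)

lemma inner_pt_F:
  assumes "F \<in> sides \<T>" shows "inner_pt F \<in> rel_interior F"
proof -
  obtain T where "T \<in> \<T>" "F facet_of T" using assms by (rule sidesE)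
  then show ?thesis unfolding inner_pt_def some_in_eq using facet_compact_convex(3)[OF simplex_T] by blast
qed

definition elem_const :: "(real^'n \<Rightarrow> 'b) \<Rightarrow> bool" where
  "elem_const w \<longleftrightarrow> (\<forall>T\<in>\<T>. \<forall>x\<in>interior T. w x = w (inner_pt T))"

lemma elem_constI: "(\<And>T x. T \<in> \<T> \<Longrightarrow> x \<in> interior T \<Longrightarrow> w x = k T) \<Longrightarrow> elem_const w"
  using inner_pt_T by (simp add: elem_const_def)

lemma elem_constD: "elem_const w \<Longrightarrow> T \<in> \<T> \<Longrightarrow> x \<in> interior T \<Longrightarrow> w x = w (inner_pt T)"
  by (simp add: elem_const_def)

lemma elem_const_comp: "elem_const v \<Longrightarrow> elem_const (\<lambda>x. h (v x))"
  by (rule elem_constI) (rule arg_cong[of _ _ h], rule elem_constD)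

lemma elem_const_comp2: "elem_const v \<Longrightarrow> elem_const w \<Longrightarrow> elem_const (\<lambda>x. h (v x) (w x))"
  by (rule elem_constI) (rule arg_cong2[of _ _ _ _ h]; rule elem_constD)

lemma AE_interior: "AE x in lebesgue. x \<in> \<Omega> \<longrightarrow> (\<exists>T\<in>\<T>. x \<in> interior T)"
proof -
  have "negligible (\<Union>T\<in>\<T>. frontier T)"
    using finite_T negligible_convex_frontier[OF element_convex[OF simplex_T]]
    by (intro negligible_Union) auto
  then have "AE x in lebesgue. x \<notin> (\<Union>T\<in>\<T>. frontier T)"
    by (intro AE_not_in) (simp only: negligible_iff_null_sets)
  then show ?thesis
  proof eventually_elim
    case (elim x)
    show ?case
    proof
      assume "x \<in> \<Omega>"
      then have "x \<in> \<Union>\<T>" unfolding Union_T using closure_subset by blast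
      then obtain T where T: "T \<in> \<T>" "x \<in> T" by blast
      then have "closed T" using element_compact[OF simplex_T] compact_imp_closed by blast
      then have "x \<in> interior T" using elim T by (auto simp: frontier_def closure_closed)
      then show "\<exists>T\<in>\<T>. x \<in> interior T" using T(1) by blast
    qed
  qed
qed

lemma AE_elem_const:
  assumes "elem_const P"
  shows "(AE x in lebesgue. x \<in> \<Omega> \<longrightarrow> P x) \<longleftrightarrow> (\<forall>T\<in>\<T>. P (inner_pt T))"
proof
  assume ae: "AE x in lebesgue. x \<in> \<Omega> \<longrightarrow> P x"
  show "\<forall>T\<in>\<T>. P (inner_pt T)"
  proof (rule ballI, rule ccontr)
    fix T assume T: "T \<in> \<T>" "\<not> P (inner_pt T)"
    obtain N where N: "{x \<in> space lebesgue. \<not> (x \<in> \<Omega> \<longrightarrow> P x)} \<subseteq> N" "N \<in> null_sets lebesgue"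
      using ae by (auto elim: AE_E simp: null_sets_def)
    have "interior T \<subseteq> N"
    proof
      fix x assume x: "x \<in> interior T"
      then have "\<not> P x" using elem_constD[OF assms T(1)] T(2) by simp
      then show "x \<in> N" using N(1) interior_T_subset[OF T(1)] x by auto
    qed
    moreover have "negligible N" using N(2) by (simp only: negligible_iff_null_sets)
    ultimately have "negligible (interior T)" using negligible_subset by blast
    then show False
      using open_not_negligible[OF open_interior element_interior_nonempty[OF simplex_T[OF T(1)]]] by blast
  qed
next
  assume P: "\<forall>T\<in>\<T>. P (inner_pt T)"
  show "AE x in lebesgue. x \<in> \<Omega> \<longrightarrow> P x"
    using AE_interior
  proof eventually_elim
    case (elim x)
    then show ?case using P elem_constD[OF assms] by blast
  qed
qed

lemma sum_interior_indicator:
  fixes h :: "(real^'n) set \<Rightarrow> 'b::real_vector"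
  assumes "T \<in> \<T>" "x \<in> interior T"
  shows "(\<Sum>S\<in>\<T>. indicator (interior S) x *\<^sub>R h S) = h T"
proof -
  have "(\<Sum>S\<in>\<T>. indicator (interior S) x *\<^sub>R h S) = (\<Sum>S\<in>\<T>. if S = T then h S else 0)"
  proof (rule sum.cong)
    fix S assume "S \<in> \<T>"
    show "indicator (interior S) x *\<^sub>R h S = (if S = T then h S else 0)"
      using assms(2) interior_disjoint[OF \<open>S \<in> \<T>\<close> assms(1)] by (cases "S = T") (auto simp: indicator_def)
  qed simp
  then show ?thesis using assms(1) finite_T by simp
qed

lemma measure_interior_T:
  assumes "T \<in> \<T>"
  shows "interior T \<in> lmeasurable" "vol (interior T) = vol T"
proof -
  have "bounded T" using element_compact[OF simplex_T[OF assms]] by (rule compact_imp_bounded)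
  moreover have "negligible (frontier T)"
    by (rule negligible_convex_frontier[OF element_convex[OF simplex_T[OF assms]]])
  ultimately show "vol (interior T) = vol T" by (rule measure_interior)
  show "interior T \<in> lmeasurable"
    by (rule lmeasurable_interior[OF \<open>bounded T\<close>])
qed

lemma integral_elem_const:
  fixes w :: "real^'n \<Rightarrow> real"
  assumes w: "elem_const w"
  shows "(LINT x:\<Omega>|lebesgue. w x) = (\<Sum>T\<in>\<T>. vol T * w (inner_pt T))"
proof -
  define G where "G = (\<lambda>x. \<Sum>T\<in>\<T>. indicator (interior T) x *\<^sub>R w (inner_pt T))"
  have int: "integrable lebesgue (\<lambda>x. indicator (interior T) x *\<^sub>R w (inner_pt T))" if "T \<in> \<T>" for T
    using measure_interior_T(1)[OF that]
    by (intro integrable_scaleR_left) (simp add: fmeasurable_def)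
  have ae: "AE x in lebesgue. indicator \<Omega> x *\<^sub>R w x = G x"
    using AE_interior
  proof eventually_elim
    case (elim x)
    show ?case
    proof (cases "x \<in> \<Omega>")
      case True
      then obtain T where T: "T \<in> \<T>" "x \<in> interior T" using elim by blast
      then show ?thesis
        unfolding G_def sum_interior_indicator[OF T] using True elem_constD[OF w T] by simp
    next
      case False
      then have "x \<notin> interior T" if "T \<in> \<T>" for T using interior_T_subset[OF that] by blast
      then have "G x = 0" unfolding G_def by (intro sum.neutral) simp
      then show ?thesis using False by simp
    qed
  qed
  have G: "G \<in> borel_measurable lebesgue"
    unfolding G_def by (intro borel_measurable_sum borel_measurable_integrable[OF int])
  have "(LINT x:\<Omega>|lebesgue. w x) = (LINT x|lebesgue. G x)"
    unfolding set_lebesgue_integral_def by (rule integral_completion_cong_AE[OF G ae])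
  also have "\<dots> = (\<Sum>T\<in>\<T>. LINT x|lebesgue. indicator (interior T) x *\<^sub>R w (inner_pt T))"
    unfolding G_def by (rule Bochner_Integration.integral_sum[OF int])
  also have "\<dots> = (\<Sum>T\<in>\<T>. vol T * w (inner_pt T))"
  proof (rule sum.cong)
    fix T assume "T \<in> \<T>"
    have "(LINT x|lebesgue. indicator (interior T) x *\<^sub>R w (inner_pt T)) = vol (interior T) * w (inner_pt T)"
      by simp
    then show "(LINT x|lebesgue. indicator (interior T) x *\<^sub>R w (inner_pt T)) = vol T * w (inner_pt T)"
      by (simp only: measure_interior_T(2)[OF \<open>T \<in> \<T>\<close>])
  qed simp
  finally show ?thesis .
qed

subsection \<open>Boundary sides\<close>

lemma boundary_sidesD: "F \<in> bsides \<Longrightarrow> F \<in> sides \<T>"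
  by (simp add: boundary_sides_def)

lemma finite_boundary_sides: "finite (bsides)"
  by (rule finite_subset[OF _ finite_sides]) (auto simp: boundary_sides_def)

lemma side_facts:
  assumes "F \<in> sides \<T>"
  shows "F \<in> sets (side_measure F)" "area F > 0" "space (side_measure F) = UNIV"
    "AE x in side_measure F. x \<in> F \<longrightarrow> x \<in> rel_interior F" "rel_interior F \<subseteq> F"
proof -
  obtain T where T: "T \<in> \<T>" "F facet_of T" using assms by (rule sidesE)
  note s = simplex_T[OF T(1)]
  have "F \<in> sets borel" by (rule borel_compact[OF facet_compact_convex(1)[OF s T(2)]])
  then show "F \<in> sets (side_measure F)" unfolding side_measure_def by (intro sets_completionI_sets) simp
  show "area F > 0" by (rule facet_measure_pos[OF s T(2)])
  show "space (side_measure F) = UNIV" by (simp add: side_measure_def)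
  show "AE x in side_measure F. x \<in> F \<longrightarrow> x \<in> rel_interior F" by (rule facet_AE_rel_interior[OF s T(2)])
  show "rel_interior F \<subseteq> F" by (rule rel_interior_subset)
qed

lemma integral_side_const:
  fixes w :: "real^'n \<Rightarrow> real"
  assumes F: "F \<in> sides \<T>" and sub: "rel_interior F \<subseteq> \<gamma>"
    and w: "\<And>x. x \<in> rel_interior F \<Longrightarrow> w x = k"
  shows "(LINT x:F \<inter> \<gamma>|side_measure F. w x) = area F * k"
proof -
  have ae: "AE x in side_measure F. indicator (F \<inter> \<gamma>) x *\<^sub>R w x = indicator F x * k"
    using side_facts(4)[OF F]
  proof eventually_elim
    case (elim x)
    then show ?case using sub w by (auto simp: indicator_def)
  qed
  have "(\<lambda>x. indicator F x * k) \<in> borel_measurable (side_measure F)"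
    using side_facts(1)[OF F] by (intro borel_measurable_times borel_measurable_indicator) auto
  then have "(LINT x:F \<inter> \<gamma>|side_measure F. w x) = (LINT x|side_measure F. indicator F x * k)"
    unfolding set_lebesgue_integral_def using ae unfolding side_measure_def
    by (rule integral_completion_cong_AE)
  also have "\<dots> = area F * k"
    using side_facts(3)[OF F] by simp
  finally show ?thesis .
qed

lemma integral_side_null:
  fixes w :: "real^'n \<Rightarrow> real"
  assumes F: "F \<in> sides \<T>" and disj: "rel_interior F \<inter> \<gamma> = {}"
  shows "(LINT x:F \<inter> \<gamma>|side_measure F. w x) = 0"
proof -
  have ae: "AE x in side_measure F. indicator (F \<inter> \<gamma>) x *\<^sub>R w x = 0"
    using side_facts(4)[OF F]
  proof eventually_elim
    case (elim x)
    then show ?case using disj by (auto simp: indicator_def)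
  qed
  have "(\<lambda>x. 0::real) \<in> borel_measurable (side_measure F)" by simp
  then have "(LINT x:F \<inter> \<gamma>|side_measure F. w x) = (LINT x|side_measure F. (0::real))"
    unfolding set_lebesgue_integral_def using ae unfolding side_measure_def
    by (rule integral_completion_cong_AE)
  then show ?thesis by simp
qed

text \<open>The part \<open>\<gamma>\<close> of the boundary is resolved by the mesh up to null sets.\<close>

definition splits_boundary :: "(real^'n) set \<Rightarrow> bool" where
  "splits_boundary \<gamma> \<longleftrightarrow>
     (\<forall>F\<in>bsides. F \<in> sides_in \<Omega> \<T> \<gamma> \<or> rel_interior F \<inter> \<gamma> = {})"

lemma sides_inD:
  assumes "F \<in> sides_in \<Omega> \<T> \<gamma>"
  shows "F \<in> bsides" "F \<in> sides \<T>" "rel_interior F \<subseteq> \<gamma>"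
  using assms by (simp_all add: sides_in_def boundary_sides_def)

lemma boundary_inner_eq:
  assumes \<gamma>: "splits_boundary \<gamma>"
    and v: "\<And>F x. F \<in> sides_in \<Omega> \<T> \<gamma> \<Longrightarrow> x \<in> rel_interior F \<Longrightarrow> v x = a F"
    and w: "\<And>F x. F \<in> sides_in \<Omega> \<T> \<gamma> \<Longrightarrow> x \<in> rel_interior F \<Longrightarrow> w x = b F"
  shows "boundary_inner \<Omega> \<T> \<gamma> v w = (\<Sum>F\<in>sides_in \<Omega> \<T> \<gamma>. area F * (a F * b F))"
proof -
  have "boundary_inner \<Omega> \<T> \<gamma> v w = (\<Sum>F\<in>bsides.
      if F \<in> sides_in \<Omega> \<T> \<gamma> then area F * (a F * b F) else 0)"
    unfolding boundary_inner_def
  proof (rule sum.cong)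
    fix F assume F: "F \<in> bsides"
    show "(LINT x:F \<inter> \<gamma>|side_measure F. v x * w x)
        = (if F \<in> sides_in \<Omega> \<T> \<gamma> then area F * (a F * b F) else 0)"
    proof (cases "F \<in> sides_in \<Omega> \<T> \<gamma>")
      case True
      then show ?thesis
        using integral_side_const[OF boundary_sidesD[OF F] sides_inD(3)[OF True], of "\<lambda>x. v x * w x" "a F * b F"]
          v[OF True] w[OF True] by simp
    next
      case False
      then have "rel_interior F \<inter> \<gamma> = {}" using \<gamma> F by (auto simp: splits_boundary_def)
      then show ?thesis using False integral_side_null[OF boundary_sidesD[OF F]] by simp
    qed
  qed simp
  also have "\<dots> = (\<Sum>F\<in>bsides \<inter> sides_in \<Omega> \<T> \<gamma>. area F * (a F * b F))"
    by (rule sum.inter_restrict[OF finite_boundary_sides, symmetric])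
  also have "bsides \<inter> sides_in \<Omega> \<T> \<gamma> = sides_in \<Omega> \<T> \<gamma>"
    by (auto simp: sides_in_def)
  finally show ?thesis .
qed

lemma AE_boundary_eq:
  assumes \<gamma>: "splits_boundary \<gamma>"
    and P: "\<And>F x. F \<in> sides_in \<Omega> \<T> \<gamma> \<Longrightarrow> x \<in> rel_interior F \<Longrightarrow> P x \<longleftrightarrow> Q F"
  shows "AE_boundary \<Omega> \<T> \<gamma> P \<longleftrightarrow> (\<forall>F\<in>sides_in \<Omega> \<T> \<gamma>. Q F)"
proof
  assume ae: "AE_boundary \<Omega> \<T> \<gamma> P"
  show "\<forall>F\<in>sides_in \<Omega> \<T> \<gamma>. Q F"
  proof (rule ballI, rule ccontr)
    fix F assume F: "F \<in> sides_in \<Omega> \<T> \<gamma>" "\<not> Q F"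
    note s = side_facts[OF sides_inD(2)[OF F(1)]]
    have "AE x in side_measure F. x \<in> F \<inter> \<gamma> \<longrightarrow> P x"
      using ae sides_inD(1)[OF F(1)] by (simp add: AE_boundary_def)
    then have "AE x in side_measure F. x \<notin> F"
      using s(4)
    proof eventually_elim
      case (elim x)
      then show ?case using P[OF F(1)] F(2) sides_inD(3)[OF F(1)] by blast
    qed
    then have "F \<in> null_sets (side_measure F)"
      using s(1) by (simp add: AE_iff_null_sets)
    then have "area F = 0" by (simp add: measure_def null_sets_def)
    then show False using s(2) by simp
  qed
next
  assume Q: "\<forall>F\<in>sides_in \<Omega> \<T> \<gamma>. Q F"
  show "AE_boundary \<Omega> \<T> \<gamma> P"
    unfolding AE_boundary_def
  proof
    fix F assume F: "F \<in> bsides"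
    show "AE x in side_measure F. x \<in> F \<inter> \<gamma> \<longrightarrow> P x"
      using side_facts(4)[OF boundary_sidesD[OF F]]
    proof eventually_elim
      case (elim x)
      show ?case
      proof
        assume x: "x \<in> F \<inter> \<gamma>"
        then have "x \<in> rel_interior F" using elim by simp
        moreover have "F \<in> sides_in \<Omega> \<T> \<gamma>"
          using \<gamma> F x \<open>x \<in> rel_interior F\<close> unfolding splits_boundary_def by blast
        ultimately show "P x" using P Q by simp
      qed
    qed
  qed
qed

section \<open>Piecewise affine functions and their traces\<close>

text \<open>The barycenter of the side, characterized by what it is used for: the side average of an affine function is its value
  there.\<close>

definition side_center :: "(real^'n) set \<Rightarrow> real^'n" where
  "side_center F = (SOME m. \<forall>c b. side_mean F (\<lambda>x. c + b \<bullet> x) = c + b \<bullet> m)"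

lemma side_mean_center:
  assumes "F \<in> sides \<T>" shows "side_mean F (\<lambda>x. c + b \<bullet> x) = c + b \<bullet> side_center F"
proof -
  obtain T where T: "T \<in> \<T>" "F facet_of T" using assms by (rule sidesE)
  have "\<forall>c b. side_mean F (\<lambda>x. c + b \<bullet> x) = c + b \<bullet> side_center F"
    unfolding side_center_def by (rule someI_ex[OF side_mean_affine[OF simplex_T[OF T(1)] T(2)]])
  then show ?thesis by blast
qed

lemma side_mean_cong:
  assumes "\<And>x. x \<in> F \<Longrightarrow> v x = w x" shows "side_mean F v = side_mean F w"
proof -
  have "(LINT x:F|side_measure F. v x) = (LINT x:F|side_measure F. w x)"
    unfolding set_lebesgue_integral_def using assms
    by (intro Bochner_Integration.integral_cong) (auto simp: indicator_def)
  then show ?thesis by (simp add: side_mean_def)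
qed

lemma elem_trace_eq:
  fixes v :: "real^'n \<Rightarrow> 'b::t2_space"
  assumes T: "T \<in> \<T>" and v: "\<And>x. x \<in> interior T \<Longrightarrow> v x = h x" and h: "continuous_on UNIV h" and x: "x \<in> T"
  shows "elem_trace T v x = h x"
proof -
  have "T \<subseteq> closure (interior T)"
    using convex_closure_interior[OF element_convex[OF simplex_T[OF T]] element_interior_nonempty[OF simplex_T[OF T]]]
      closure_subset by blast
  then have cl: "x \<in> closure (interior T)" using x by blast
  have "x islimpt interior T"
  proof (cases "x \<in> interior T")
    case True
    then show ?thesis by (simp add: interior_limit_point open_imp_islimpt)
  next
    case False
    then show ?thesis using cl by (simp add: closure_def)
  qed
  then have nt: "at x within interior T \<noteq> bot" by (simp add: trivial_limit_within)
  have "(h \<longlongrightarrow> h x) (at x within interior T)"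
    using h by (meson UNIV_I continuous_on_def subset_UNIV tendsto_within_subset)
  then have "(v \<longlongrightarrow> h x) (at x within interior T)"
    by (rule Lim_transform_eventually) (simp add: eventually_at_filter v)
  then show ?thesis unfolding elem_trace_def by (rule tendsto_Lim[OF nt])
qed

definition affine_rep where
  "affine_rep v c b \<longleftrightarrow> (\<forall>T\<in>\<T>. \<forall>x\<in>interior T. (v :: real^'n \<Rightarrow> real) x = c T + b T \<bullet> x)"

definition affine_rep_vec where
  "affine_rep_vec y A B \<longleftrightarrow> (\<forall>T\<in>\<T>. \<forall>x\<in>interior T. (y :: real^'n \<Rightarrow> real^'n) x = A T + B T *v x)"

lemma affine_rep_exists:
  assumes "v \<in> L1 \<T>" obtains c b where "affine_rep v c b"
proof -
  have "\<forall>T\<in>\<T>. \<exists>p. \<forall>x\<in>interior T. v x = fst p + snd p \<bullet> x" using assms by (auto simp: L1_def)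
  then obtain p where "\<forall>T\<in>\<T>. \<forall>x\<in>interior T. v x = fst (p T) + snd (p T) \<bullet> x"
    using bchoice[of \<T> "\<lambda>T p. \<forall>x\<in>interior T. v x = fst p + snd p \<bullet> x"] by blast
  then have "affine_rep v (\<lambda>T. fst (p T)) (\<lambda>T. snd (p T))" by (simp add: affine_rep_def)
  then show thesis by (rule that)
qed

lemma affine_rep_L1: "affine_rep v c b \<Longrightarrow> v \<in> L1 \<T>"
  by (auto simp: affine_rep_def L1_def)

lemma affine_rep_vec_exists:
  assumes "\<forall>i. (\<lambda>x. y x $ i) \<in> L1 \<T>" obtains A B where "affine_rep_vec y A B"
proof -
  have "\<exists>p. affine_rep (\<lambda>x. y x $ i) (\<lambda>T. fst (p T)) (\<lambda>T. snd (p T))" for i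
  proof -
    obtain c b where "affine_rep (\<lambda>x. y x $ i) c b" using assms affine_rep_exists by blast
    then show ?thesis by (intro exI[of _ "\<lambda>T. (c T, b T)"]) simp
  qed
  then obtain p where p: "\<And>i. affine_rep (\<lambda>x. y x $ i) (\<lambda>T. fst (p i T)) (\<lambda>T. snd (p i T))" by metis
  have "affine_rep_vec y (\<lambda>T. \<chi> i. fst (p i T)) (\<lambda>T. \<chi> i. snd (p i T))"
    unfolding affine_rep_vec_def
  proof (intro ballI)
    fix T x assume "T \<in> \<T>" "x \<in> interior T"
    then have "y x $ i = fst (p i T) + snd (p i T) \<bullet> x" for i using p[of i] by (simp add: affine_rep_def)
    then show "y x = (\<chi> i. fst (p i T)) + (\<chi> i. snd (p i T)) *v x"
      by (simp add: vec_eq_iff matrix_vector_mult_def inner_vec_def)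
  qed
  then show thesis by (rule that)
qed

lemma affine_rep_vec_L1: "affine_rep_vec y A B \<Longrightarrow> (\<lambda>x. y x $ i) \<in> L1 \<T>"
proof -
  assume y: "affine_rep_vec y A B"
  have "\<forall>x\<in>interior T. y x $ i = A T $ i + B T $ i \<bullet> x" if "T \<in> \<T>" for T
    using y that by (simp add: affine_rep_vec_def matrix_vector_mult_def inner_vec_def)
  then show ?thesis unfolding L1_def by blast
qed

lemma trace_affine:
  assumes "affine_rep v c b" "T \<in> \<T>" "x \<in> T" shows "elem_trace T v x = c T + b T \<bullet> x"
  by (rule elem_trace_eq[OF assms(2) _ _ assms(3)])
     (use assms(1,2) in \<open>auto simp: affine_rep_def intro!: continuous_intros\<close>)

lemma continuous_affine_vec: "continuous_on UNIV (\<lambda>x. (a::real^'n) + (M::real^'n^'n) *v x)"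
  by (intro continuous_intros linear_continuous_on) (simp add: linear_linear matrix_vector_mul_linear)

lemma trace_affine_vec:
  assumes "affine_rep_vec y A B" "T \<in> \<T>" "x \<in> T" shows "elem_trace T y x = A T + B T *v x"
  by (rule elem_trace_eq[OF assms(2) _ continuous_affine_vec assms(3)])
     (use assms(1,2) in \<open>simp add: affine_rep_vec_def\<close>)

lemma grad_affine:
  assumes v: "affine_rep v c b" and T: "T \<in> \<T>" and x: "x \<in> interior T"
  shows "grad_h \<T> v x = b T"
proof -
  have "GDERIV (\<lambda>x. c T + b T \<bullet> x) x :> b T"
    unfolding gderiv_def by (auto intro!: derivative_eq_intros simp: inner_commute)
  then have "GDERIV v x :> b T"
    unfolding gderiv_def
    by (rule has_derivative_transform_within_open[OF _ open_interior x])
       (use v T in \<open>simp add: affine_rep_def\<close>)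
  moreover have "D = b T" if "GDERIV v x :> D" for D
  proof -
    have "(\<lambda>h. h \<bullet> D) = (\<lambda>h. h \<bullet> b T)"
      using that \<open>GDERIV v x :> b T\<close> unfolding gderiv_def by (rule has_derivative_unique)
    then have "\<forall>h. h \<bullet> D = h \<bullet> b T" by (simp add: fun_eq_iff)
    then show ?thesis by (simp only: vector_eq_ldot)
  qed
  ultimately have "(THE D. GDERIV v x :> D) = b T" by (rule the_equality)
  then show ?thesis using T x by (auto simp: grad_h_def)
qed

lemma div_affine:
  assumes y: "affine_rep_vec y A B" and T: "T \<in> \<T>" and x: "x \<in> interior T"
  shows "div_h \<T> y x = (\<Sum>i\<in>UNIV. B T $ i $ i)"
proof -
  have "((\<lambda>x. A T + B T *v x) has_derivative (\<lambda>h. B T *v h)) (at x)"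
    by (auto intro!: derivative_eq_intros bounded_linear_imp_has_derivative simp: linear_linear[symmetric] matrix_vector_mul_linear)
  then have "(y has_derivative (\<lambda>h. B T *v h)) (at x)"
    by (rule has_derivative_transform_within_open[OF _ open_interior x])
       (use y T in \<open>simp add: affine_rep_vec_def\<close>)
  then have "frechet_derivative y (at x) = (\<lambda>h. B T *v h)" by (rule frechet_derivative_at[symmetric])
  then show ?thesis
    using T x by (auto simp: div_h_def matrix_vector_mult_basis column_def)
qed

end

context mesh
begin

section \<open>Integration by parts on the mesh\<close>

abbreviation "grd v T \<equiv> grad_h \<T> v (inner_pt T)"
abbreviation "dvg y T \<equiv> div_h \<T> y (inner_pt T)"
abbreviation "avg w T \<equiv> Pi_h \<T> w (inner_pt T)"
abbreviation "smean v F \<equiv> pi_h \<T> v (inner_pt F)"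
abbreviation "ntr y F \<equiv> normal_trace \<Omega> \<T> y (inner_pt F)"

lemma integral_T_cong:
  fixes h :: "real^'n \<Rightarrow> 'b::euclidean_space"
  assumes T: "T \<in> \<T>" and w: "\<And>x. x \<in> interior T \<Longrightarrow> w x = h x" and h: "continuous_on UNIV h"
  shows "set_integrable lebesgue T w" "set_integrable lebesgue T h"
    "(LINT x:T|lebesgue. w x) = (LINT x:T|lebesgue. h x)"
proof -
  have cT: "compact T" by (rule element_compact[OF simplex_T[OF T]])
  have "integrable lborel (\<lambda>x. indicator T x *\<^sub>R h x)"
    by (rule borel_integrable_compact[OF cT continuous_on_subset[OF h]]) simp
  then have i: "integrable lebesgue (\<lambda>x. indicator T x *\<^sub>R h x)" 
    by (simp only: integrable_completion[OF borel_measurable_integrable])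
  then show "set_integrable lebesgue T h" by (simp add: set_integrable_def)
  have "negligible (frontier T)" by (rule negligible_convex_frontier[OF element_convex[OF simplex_T[OF T]]])
  then have "AE x in lebesgue. x \<notin> frontier T" by (intro AE_not_in) (simp only: negligible_iff_null_sets)
  then have ae: "AE x in lebesgue. indicator T x *\<^sub>R w x = indicator T x *\<^sub>R h x"
  proof eventually_elim
    case (elim x)
    show ?case
    proof (cases "x \<in> T")
      case True
      then have "x \<in> interior T" using elim closure_subset by (auto simp: frontier_def)
      then show ?thesis by (simp add: w)
    qed simp
  qed
  note m = borel_measurable_integrable[OF i]
  show "(LINT x:T|lebesgue. w x) = (LINT x:T|lebesgue. h x)"
    unfolding set_lebesgue_integral_def by (rule integral_completion_cong_AE[OF m ae])
  show "set_integrable lebesgue T w"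
    unfolding set_integrable_def
    by (rule integrable_cong_AE_imp[OF i measurable_completion_cong_AE[OF m ae]])
       (use ae in \<open>auto elim: eventually_mono\<close>)
qed

lemma Pi_h_interior:
  fixes w :: "real^'n \<Rightarrow> 'b::euclidean_space"
  assumes "T \<in> \<T>" "x \<in> interior T"
  shows "Pi_h \<T> w x = (1 / vol T) *\<^sub>R (LINT z:T|lebesgue. w z)"
  unfolding Pi_h_def by (rule sum_interior_indicator[OF assms])

lemma elem_const_Pi_h: "elem_const (Pi_h \<T> (w :: real^'n \<Rightarrow> 'b::euclidean_space))"
  by (rule elem_constI) (rule Pi_h_interior)

lemma measure_T_pos: "T \<in> \<T> \<Longrightarrow> vol T > 0"
  by (rule element_measure_pos[OF simplex_T])

lemma Pi_h_affine:
  assumes v: "affine_rep v c b" and T: "T \<in> \<T>"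
  shows "vol T * avg v T = (LINT x:T|lebesgue. c T + b T \<bullet> x)"
proof -
  have "(LINT x:T|lebesgue. v x) = (LINT x:T|lebesgue. c T + b T \<bullet> x)"
    by (rule integral_T_cong(3)[OF T]) (use v T in \<open>auto simp: affine_rep_def intro!: continuous_intros\<close>)
  then show ?thesis using measure_T_pos[OF T] by (simp only: Pi_h_interior[OF T inner_pt_T[OF T]]) simp
qed

lemma affine_vec_integrable:
  assumes y: "affine_rep_vec y A B" and T: "T \<in> \<T>"
  shows "set_integrable lebesgue T y"
  by (rule integral_T_cong(1)[OF T _ continuous_affine_vec]) (use y T in \<open>simp add: affine_rep_vec_def\<close>)

lemma Pi_h_affine_vec:
  assumes y: "affine_rep_vec y A B" and T: "T \<in> \<T>"
  shows "vol T * (avg y T \<bullet> d) = (LINT x:T|lebesgue. (A T + B T *v x) \<bullet> d)"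
proof -
  let ?h = "\<lambda>x. A T + B T *v x"
  have e: "(LINT x:T|lebesgue. y x) = (LINT x:T|lebesgue. ?h x)"
    by (rule integral_T_cong(3)[OF T _ continuous_affine_vec]) (use y T in \<open>simp add: affine_rep_vec_def\<close>)
  have "set_integrable lebesgue T ?h"
    by (rule integral_T_cong(2)[OF T _ continuous_affine_vec]) (use y T in \<open>simp add: affine_rep_vec_def\<close>)
  then have i: "integrable lebesgue (\<lambda>x. indicator T x *\<^sub>R ?h x)" by (simp add: set_integrable_def)
  have "(LINT x:T|lebesgue. ?h x) \<bullet> d = (LINT x|lebesgue. (indicator T x *\<^sub>R ?h x) \<bullet> d)"
    unfolding set_lebesgue_integral_def by (rule integral_inner_left[symmetric]) (rule i)
  also have "\<dots> = (LINT x:T|lebesgue. ?h x \<bullet> d)"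
    by (simp add: set_lebesgue_integral_def)
  finally have "(LINT x:T|lebesgue. y x) \<bullet> d = (LINT x:T|lebesgue. ?h x \<bullet> d)" unfolding e .
  then show ?thesis
    using measure_T_pos[OF T] by (simp only: Pi_h_interior[OF T inner_pt_T[OF T]] inner_scaleR_left) simp
qed

text \<open>The element identities added up and sorted by sides. It is applied to functions of
  the discrete spaces, where the terms of interior sides cancel, and to local basis functions, where only
  the terms of one side remain.\<close>

lemma sum_element_ibp:
  assumes v: "affine_rep v c b" and y: "affine_rep_vec y A B"
    and \<kappa>: "\<And>T F x. T \<in> \<T> \<Longrightarrow> F facet_of T \<Longrightarrow> x \<in> F \<Longrightarrow> (A T + B T *v x) \<bullet> outer_normal T F = \<kappa> T F"
  shows "(\<Sum>T\<in>\<T>. vol T * (avg y T \<bullet> b T + avg v T * (\<Sum>i\<in>UNIV. B T $ i $ i)))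
    = (\<Sum>F\<in>sides \<T>. area F * (\<Sum>T | T \<in> \<T> \<and> F facet_of T. \<kappa> T F * (c T + b T \<bullet> side_center F)))"
proof -
  have el: "vol T * (avg y T \<bullet> b T + avg v T * (\<Sum>i\<in>UNIV. B T $ i $ i))
      = (\<Sum>F | F \<in> sides \<T> \<and> F facet_of T. area F * (\<kappa> T F * (c T + b T \<bullet> side_center F)))"
    if T: "T \<in> \<T>" for T
  proof -
    have sub: "{F. F facet_of T} = {F. F \<in> sides \<T> \<and> F facet_of T}" using T by (auto simp: sides_def)
    have "vol T * (avg y T \<bullet> b T + avg v T * (\<Sum>i\<in>UNIV. B T $ i $ i))
        = (LINT x:T|lebesgue. (A T + B T *v x) \<bullet> b T) + (LINT x:T|lebesgue. c T + b T \<bullet> x) * (\<Sum>i\<in>UNIV. B T $ i $ i)"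
      unfolding distrib_left mult.assoc[symmetric] Pi_h_affine[OF v T] Pi_h_affine_vec[OF y T] ..
    also have "\<dots> = (\<Sum>F | F facet_of T. area F * \<kappa> T F * side_mean F (\<lambda>x. c T + b T \<bullet> x))"
      by (rule element_ibp[OF simplex_T[OF T] \<kappa>[OF T]])
    also have "\<dots> = (\<Sum>F | F \<in> sides \<T> \<and> F facet_of T. area F * (\<kappa> T F * (c T + b T \<bullet> side_center F)))"
      unfolding sub by (rule sum.cong) (auto simp: side_mean_center mult.assoc)
    finally show ?thesis .
  qed
  have "(\<Sum>T\<in>\<T>. vol T * (avg y T \<bullet> b T + avg v T * (\<Sum>i\<in>UNIV. B T $ i $ i)))
      = (\<Sum>T\<in>\<T>. \<Sum>F | F \<in> sides \<T> \<and> F facet_of T. area F * (\<kappa> T F * (c T + b T \<bullet> side_center F)))"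
    by (rule sum.cong) (simp_all add: el)
  also have "\<dots> = (\<Sum>F\<in>sides \<T>. \<Sum>T | T \<in> \<T> \<and> F facet_of T. area F * (\<kappa> T F * (c T + b T \<bullet> side_center F)))"
    by (rule sum.swap_restrict[OF finite_T finite_sides])
  finally show ?thesis by (simp only: sum_distrib_left)
qed

subsection \<open>Discrete spaces in terms of their coefficients\<close>

lemma facet_in_sides: "T \<in> \<T> \<Longrightarrow> F facet_of T \<Longrightarrow> F \<in> sides \<T>"
  by (auto simp: sides_def)

lemma side_mean_jump:
  assumes v: "affine_rep v c b" and T: "T \<in> \<T>" "F facet_of T" "T' \<in> \<T>" "F facet_of T'"
  shows "side_mean F (\<lambda>x. elem_trace T v x - elem_trace T' v x) = (c T + b T \<bullet> side_center F) - (c T' + b T' \<bullet> side_center F)"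
proof -
  have "side_mean F (\<lambda>x. elem_trace T v x - elem_trace T' v x) = side_mean F (\<lambda>x. (c T - c T') + (b T - b T') \<bullet> x)"
  proof (rule side_mean_cong)
    fix x assume "x \<in> F"
    then have "x \<in> T" "x \<in> T'" using T facet_of_imp_subset by blast+
    then show "elem_trace T v x - elem_trace T' v x = (c T - c T') + (b T - b T') \<bullet> x"
      using T by (simp add: trace_affine[OF v] inner_diff_left)
  qed
  also have "\<dots> = (c T - c T') + (b T - b T') \<bullet> side_center F"
    by (rule side_mean_center[OF facet_in_sides[OF T(1,2)]])
  finally show ?thesis by (simp add: inner_diff_left)
qed

lemma side_mean_trace:
  assumes v: "affine_rep v c b" and T: "T \<in> \<T>" "F facet_of T"
  shows "side_mean F (elem_trace T v) = c T + b T \<bullet> side_center F"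
proof -
  have "side_mean F (elem_trace T v) = side_mean F (\<lambda>x. c T + b T \<bullet> x)"
    using facet_of_imp_subset[OF T(2)] by (intro side_mean_cong trace_affine[OF v T(1)]) blast
  then show ?thesis by (simp add: side_mean_center[OF facet_in_sides[OF T]])
qed

lemma CR_iff:
  assumes v: "affine_rep v c b"
  shows "v \<in> CR \<longleftrightarrow> (\<forall>F\<in>isides. \<forall>T\<in>\<T>. \<forall>T'\<in>\<T>.
     T \<noteq> T' \<and> F facet_of T \<and> F facet_of T' \<longrightarrow> c T + b T \<bullet> side_center F = c T' + b T' \<bullet> side_center F)"
proof -
  have "(\<forall>F\<in>isides. \<forall>T\<in>\<T>. \<forall>T'\<in>\<T>. T \<noteq> T' \<and> F facet_of T \<and> F facet_of T' \<longrightarrow>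
        side_mean F (\<lambda>x. elem_trace T v x - elem_trace T' v x) = 0)
     \<longleftrightarrow> (\<forall>F\<in>isides. \<forall>T\<in>\<T>. \<forall>T'\<in>\<T>.
        T \<noteq> T' \<and> F facet_of T \<and> F facet_of T' \<longrightarrow> c T + b T \<bullet> side_center F = c T' + b T' \<bullet> side_center F)"
    by (intro ball_cong refl imp_cong) (simp add: side_mean_jump[OF v])
  then show ?thesis using affine_rep_L1[OF v] by (simp only: crouzeix_raviart_def mem_Collect_eq simp_thms)
qed

lemma RT_iff:
  assumes y: "affine_rep_vec y A B"
  shows "y \<in> RT \<longleftrightarrow>
     (\<forall>T\<in>\<T>. \<forall>F. F facet_of T \<longrightarrow> (\<exists>k. \<forall>x\<in>F. (A T + B T *v x) \<bullet> outer_normal T F = k)) \<and>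
     (\<forall>F\<in>isides. \<forall>T\<in>\<T>. \<forall>T'\<in>\<T>. T \<noteq> T' \<and> F facet_of T \<and> F facet_of T' \<longrightarrow>
        (\<forall>x\<in>F. (A T + B T *v x) \<bullet> outer_normal T F + (A T' + B T' *v x) \<bullet> outer_normal T' F = 0))"
proof -
  have tr: "elem_trace T y x = A T + B T *v x" if "T \<in> \<T>" "F facet_of T" "x \<in> F" for T F x
    using facet_of_imp_subset[OF that(2)] that(3) by (intro trace_affine_vec[OF y that(1)]) blast
  have 1: "(\<forall>T\<in>\<T>. \<forall>F. F facet_of T \<longrightarrow> (\<exists>k. \<forall>x\<in>F. elem_trace T y x \<bullet> outer_normal T F = k))
    \<longleftrightarrow> (\<forall>T\<in>\<T>. \<forall>F. F facet_of T \<longrightarrow> (\<exists>k. \<forall>x\<in>F. (A T + B T *v x) \<bullet> outer_normal T F = k))"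
    by (intro ball_cong refl all_cong imp_cong) (simp add: tr)
  have 2: "(\<forall>F\<in>isides. \<forall>T\<in>\<T>. \<forall>T'\<in>\<T>. T \<noteq> T' \<and> F facet_of T \<and> F facet_of T' \<longrightarrow>
        (\<forall>x\<in>F. elem_trace T y x \<bullet> outer_normal T F + elem_trace T' y x \<bullet> outer_normal T' F = 0))
    \<longleftrightarrow> (\<forall>F\<in>isides. \<forall>T\<in>\<T>. \<forall>T'\<in>\<T>. T \<noteq> T' \<and> F facet_of T \<and> F facet_of T' \<longrightarrow>
        (\<forall>x\<in>F. (A T + B T *v x) \<bullet> outer_normal T F + (A T' + B T' *v x) \<bullet> outer_normal T' F = 0))"
    by (intro ball_cong refl imp_cong) (elim conjE, simp add: tr)
  have "\<forall>i. (\<lambda>x. y x $ i) \<in> L1 \<T>" using affine_rep_vec_L1[OF y] by blast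
  then show ?thesis unfolding raviart_thomas_def mem_Collect_eq 1 2 by blast
qed

lemma sum_side_indicator:
  assumes F: "F \<in> S" and S: "S \<subseteq> sides \<T>" and x: "x \<in> rel_interior F"
  shows "(\<Sum>G\<in>S. indicator (rel_interior G) x * (h G :: real)) = h F"
proof -
  have "(\<Sum>G\<in>S. indicator (rel_interior G) x * h G) = (\<Sum>G\<in>S. if G = F then h G else 0)"
  proof (rule sum.cong)
    fix G assume "G \<in> S"
    then show "indicator (rel_interior G) x * h G = (if G = F then h G else 0)"
      using sides_rel_interior_disjoint[of G F x] F S x by (cases "G = F") (auto simp: indicator_def)
  qed simp
  then show ?thesis using F finite_subset[OF S finite_sides] by simp
qed

lemma boundary_sideE:
  assumes "F \<in> bsides" obtains T where "T \<in> \<T>" "F facet_of T"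
  using boundary_sidesD[OF assms] by (rule sidesE)

lemma pi_h_boundary:
  assumes v: "affine_rep v c b" and F: "F \<in> bsides" and T: "T \<in> \<T>" "F facet_of T"
    and x: "x \<in> rel_interior F"
  shows "pi_h \<T> v x = c T + b T \<bullet> side_center F"
proof -
  have "pi_h \<T> v x = (THE k. \<forall>T\<in>\<T>. F facet_of T \<longrightarrow> side_mean F (elem_trace T v) = k)"
    unfolding pi_h_def by (rule sum_side_indicator[OF boundary_sidesD[OF F] order_refl x])
  also have "\<dots> = c T + b T \<bullet> side_center F"
  proof (rule the_equality)
    show "\<forall>S\<in>\<T>. F facet_of S \<longrightarrow> side_mean F (elem_trace S v) = c T + b T \<bullet> side_center F"
    proof (intro ballI impI)
      fix S assume S: "S \<in> \<T>" "F facet_of S"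
      have "S = T" by (rule boundary_side_unique_element[OF F S T])
      show "side_mean F (elem_trace S v) = c T + b T \<bullet> side_center F"
        unfolding \<open>S = T\<close> by (rule side_mean_trace[OF v T])
    qed
  next
    fix k assume "\<forall>S\<in>\<T>. F facet_of S \<longrightarrow> side_mean F (elem_trace S v) = k"
    then have "side_mean F (elem_trace T v) = k" using T by blast
    then show "k = c T + b T \<bullet> side_center F" unfolding side_mean_trace[OF v T] by (rule sym)
  qed
  finally show ?thesis .
qed

lemma normal_trace_boundary:
  assumes y: "affine_rep_vec y A B" and F: "F \<in> bsides" and T: "T \<in> \<T>" "F facet_of T"
    and x: "x \<in> rel_interior F"
  shows "normal_trace \<Omega> \<T> y x = (A T + B T *v x) \<bullet> outer_normal T F"
proof -
  have xT: "x \<in> T" using facet_of_imp_subset[OF T(2)] x rel_interior_subset[of F] by blast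
  have "bsides \<subseteq> sides \<T>" by (auto simp: boundary_sides_def)
  then have "normal_trace \<Omega> \<T> y x
      = (THE k. \<forall>T\<in>\<T>. F facet_of T \<longrightarrow> elem_trace T y x \<bullet> outer_normal T F = k)"
    unfolding normal_trace_def by (rule sum_side_indicator[OF F _ x])
  also have "\<dots> = (A T + B T *v x) \<bullet> outer_normal T F"
  proof (rule the_equality)
    show "\<forall>S\<in>\<T>. F facet_of S \<longrightarrow> elem_trace S y x \<bullet> outer_normal S F = (A T + B T *v x) \<bullet> outer_normal T F"
    proof (intro ballI impI)
      fix S assume S: "S \<in> \<T>" "F facet_of S"
      have "S = T" by (rule boundary_side_unique_element[OF F S T])
      then show "elem_trace S y x \<bullet> outer_normal S F = (A T + B T *v x) \<bullet> outer_normal T F"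
        using trace_affine_vec[OF y T(1) xT] by simp
    qed
  next
    fix k assume "\<forall>S\<in>\<T>. F facet_of S \<longrightarrow> elem_trace S y x \<bullet> outer_normal S F = k"
    then have "elem_trace T y x \<bullet> outer_normal T F = k" using T by blast
    then show "k = (A T + B T *v x) \<bullet> outer_normal T F" unfolding trace_affine_vec[OF y T(1) xT] by (rule sym)
  qed
  finally show ?thesis .
qed

lemma CR_rep:
  assumes "v \<in> CR" obtains c b where "affine_rep v c b"
proof -
  have "v \<in> L1 \<T>" using assms by (simp add: crouzeix_raviart_def)
  then show thesis using that by (rule affine_rep_exists)
qed

lemma RT_rep:
  assumes "y \<in> RT" obtains A B where "affine_rep_vec y A B"
proof -
  have "\<forall>i. (\<lambda>x. y x $ i) \<in> L1 \<T>" using assms by (simp add: raviart_thomas_def)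
  then show thesis using that by (rule affine_rep_vec_exists)
qed

lemma RT_flux:
  assumes "y \<in> RT" "affine_rep_vec y A B" "T \<in> \<T>" "F facet_of T" "x \<in> F"
  shows "(A T + B T *v x) \<bullet> outer_normal T F = (A T + B T *v inner_pt F) \<bullet> outer_normal T F"
proof -
  obtain k where k: "\<forall>x\<in>F. (A T + B T *v x) \<bullet> outer_normal T F = k"
    using conjunct1[OF assms(1)[unfolded RT_iff[OF assms(2)]]] assms(3,4) by blast
  have "inner_pt F \<in> F" using inner_pt_F[OF facet_in_sides[OF assms(3,4)]] rel_interior_subset by blast
  then show ?thesis using k assms(5) by simp
qed

lemma pi_h_boundary_const:
  assumes "v \<in> CR" "F \<in> bsides" "x \<in> rel_interior F"
  shows "pi_h \<T> v x = smean v F"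
proof -
  obtain c b where v: "affine_rep v c b" using assms(1) by (rule CR_rep)
  obtain T where T: "T \<in> \<T>" "F facet_of T" using assms(2) by (rule boundary_sideE)
  show ?thesis
    unfolding pi_h_boundary[OF v assms(2) T assms(3)]
      pi_h_boundary[OF v assms(2) T inner_pt_F[OF boundary_sidesD[OF assms(2)]]] ..
qed

lemma normal_trace_const:
  assumes y: "y \<in> RT" and F: "F \<in> bsides" and x: "x \<in> rel_interior F"
  shows "normal_trace \<Omega> \<T> y x = ntr y F"
proof -
  obtain A B where r: "affine_rep_vec y A B" using y by (rule RT_rep)
  obtain T where T: "T \<in> \<T>" "F facet_of T" using F by (rule boundary_sideE)
  have xF: "x \<in> F" using x rel_interior_subset by blast
  show ?thesis
    unfolding normal_trace_boundary[OF r F T x]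
      normal_trace_boundary[OF r F T inner_pt_F[OF boundary_sidesD[OF F]]]
    by (rule RT_flux[OF y r T xF])
qed

text \<open>On an interior side the side averages from the two elements agree while the normal fluxes
  cancel; only the boundary sides remain.\<close>

lemma discrete_ibp:
  assumes v: "v \<in> CR" and y: "y \<in> RT"
  shows "(\<Sum>T\<in>\<T>. vol T *
        (avg y T \<bullet> grd v T + avg v T * dvg y T))
    = (\<Sum>F\<in>bsides. area F * (smean v F * ntr y F))"
proof -
  obtain c b where rv: "affine_rep v c b" using v by (rule CR_rep)
  obtain A B where ry: "affine_rep_vec y A B" using y by (rule RT_rep)
  define \<kappa> where "\<kappa> T F = (A T + B T *v inner_pt F) \<bullet> outer_normal T F" for T F
  define s where "s T F = c T + b T \<bullet> side_center F" for T F
  have "(\<Sum>T\<in>\<T>. vol T *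
        (avg y T \<bullet> grd v T + avg v T * dvg y T))
      = (\<Sum>T\<in>\<T>. vol T * (avg y T \<bullet> b T + avg v T * (\<Sum>i\<in>UNIV. B T $ i $ i)))"
    by (rule sum.cong) (simp_all add: grad_affine[OF rv _ inner_pt_T] div_affine[OF ry _ inner_pt_T])
  also have "\<dots> = (\<Sum>F\<in>sides \<T>. area F * (\<Sum>T | T \<in> \<T> \<and> F facet_of T. \<kappa> T F * s T F))"
    unfolding s_def by (rule sum_element_ibp[OF rv ry]) (simp add: \<kappa>_def RT_flux[OF y ry])
  also have "\<dots> = (\<Sum>F\<in>bsides. area F * (\<Sum>T | T \<in> \<T> \<and> F facet_of T. \<kappa> T F * s T F))"
  proof (rule sum.mono_neutral_right[OF finite_sides])
    show "bsides \<subseteq> sides \<T>" by (auto simp: boundary_sides_def)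
    show "\<forall>F\<in>sides \<T> - bsides. area F * (\<Sum>T | T \<in> \<T> \<and> F facet_of T. \<kappa> T F * s T F) = 0"
    proof
      fix F assume "F \<in> sides \<T> - bsides"
      then have F: "F \<in> isides" "F \<in> sides \<T>" by (auto simp: interior_sides_def)
      obtain T where T: "T \<in> \<T>" "F facet_of T" using F(2) by (rule sidesE)
      obtain T' where T': "T' \<in> \<T>" "F facet_of T'" "T' \<noteq> T" using F(1) T by (rule interior_side_second_element)
      have two: "{S. S \<in> \<T> \<and> F facet_of S} = {T, T'}"
        using at_most_two_elements[OF T T'(1,2) _ _ T'(3)[symmetric]] T T'(1,2) by blast
      have "inner_pt F \<in> F" using inner_pt_F[OF F(2)] rel_interior_subset by blast
      then have "\<kappa> T F + \<kappa> T' F = 0"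
        using y[unfolded RT_iff[OF ry]] F(1) T T' unfolding \<kappa>_def by blast
      moreover have "s T F = s T' F"
        using v[unfolded CR_iff[OF rv]] F(1) T T' unfolding s_def by blast
      ultimately have "\<kappa> T F * s T F + \<kappa> T' F * s T' F = 0" by (simp add: distrib_right[symmetric])
      then show "area F * (\<Sum>T | T \<in> \<T> \<and> F facet_of T. \<kappa> T F * s T F) = 0"
        unfolding two using T'(3) by simp
    qed
  qed
  also have "\<dots> = (\<Sum>F\<in>bsides. area F * (smean v F * ntr y F))"
  proof (rule sum.cong)
    fix F assume F: "F \<in> bsides"
    obtain T where T: "T \<in> \<T>" "F facet_of T" using F by (rule boundary_sideE)
    have one: "{S. S \<in> \<T> \<and> F facet_of S} = {T}"
      using boundary_side_unique_element[OF F _ _ T] T by blast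
    note m = inner_pt_F[OF boundary_sidesD[OF F]]
    show "area F * (\<Sum>T | T \<in> \<T> \<and> F facet_of T. \<kappa> T F * s T F)
        = area F * (smean v F * ntr y F)"
      unfolding one pi_h_boundary[OF rv F T m] normal_trace_boundary[OF ry F T m] \<kappa>_def s_def by simp
  qed simp
  finally show ?thesis .
qed

subsection \<open>Linear combinations\<close>

lemma CR_add:
  assumes v: "v \<in> CR" and w: "w \<in> CR"
  shows "(\<lambda>x. v x + w x) \<in> CR"
    "\<And>T. T \<in> \<T> \<Longrightarrow> grd (\<lambda>x. v x + w x) T = grd v T + grd w T"
    "\<And>F. F \<in> bsides \<Longrightarrow> smean (\<lambda>x. v x + w x) F = smean v F + smean w F"
    "\<And>T. T \<in> \<T> \<Longrightarrow> avg (\<lambda>x. v x + w x) T = avg v T + avg w T"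
proof -
  obtain c b where rv: "affine_rep v c b" using v by (rule CR_rep)
  obtain c' b' where rw: "affine_rep w c' b'" using w by (rule CR_rep)
  have r: "affine_rep (\<lambda>x. v x + w x) (\<lambda>T. c T + c' T) (\<lambda>T. b T + b' T)"
    using rv rw by (simp add: affine_rep_def inner_add_left)
  show "(\<lambda>x. v x + w x) \<in> CR"
    unfolding CR_iff[OF r]
  proof (intro ballI impI)
    fix F T T' assume a: "F \<in> isides" "T \<in> \<T>" "T' \<in> \<T>" "T \<noteq> T' \<and> F facet_of T \<and> F facet_of T'"
    have "c T + b T \<bullet> side_center F = c T' + b T' \<bullet> side_center F" using v[unfolded CR_iff[OF rv]] a by blast
    moreover have "c' T + b' T \<bullet> side_center F = c' T' + b' T' \<bullet> side_center F" using w[unfolded CR_iff[OF rw]] a by blast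
    ultimately show "c T + c' T + (b T + b' T) \<bullet> side_center F = c T' + c' T' + (b T' + b' T') \<bullet> side_center F"
      by (simp add: inner_add_left)
  qed
  show "grd (\<lambda>x. v x + w x) T = grd v T + grd w T" if "T \<in> \<T>" for T
    using that by (simp add: grad_affine[OF _ that inner_pt_T] r grad_affine[OF rv that inner_pt_T] grad_affine[OF rw that inner_pt_T] grad_affine[OF r that inner_pt_T])
  show "smean (\<lambda>x. v x + w x) F = smean v F + smean w F" if F: "F \<in> bsides" for F
  proof -
    obtain T where T: "T \<in> \<T>" "F facet_of T" using F by (rule boundary_sideE)
    note m = inner_pt_F[OF boundary_sidesD[OF F]]
    show ?thesis
      unfolding pi_h_boundary[OF rv F T m] pi_h_boundary[OF rw F T m] pi_h_boundary[OF r F T m]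
      by (simp add: inner_add_left)
  qed
  show "avg (\<lambda>x. v x + w x) T = avg v T + avg w T" if T: "T \<in> \<T>" for T
  proof -
    have "set_integrable lebesgue T v"
      by (rule integral_T_cong(1)[OF T, of v "\<lambda>x. c T + b T \<bullet> x"]) (use rv T in \<open>auto simp: affine_rep_def intro!: continuous_intros\<close>)
    moreover have "set_integrable lebesgue T w"
      by (rule integral_T_cong(1)[OF T, of w "\<lambda>x. c' T + b' T \<bullet> x"]) (use rw T in \<open>auto simp: affine_rep_def intro!: continuous_intros\<close>)
    ultimately have "(LINT z:T|lebesgue. v z + w z) = (LINT z:T|lebesgue. v z) + (LINT z:T|lebesgue. w z)"
      by (rule set_integral_add(2))
    then show ?thesis by (simp only: Pi_h_interior[OF T inner_pt_T[OF T]] scaleR_add_right)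
  qed
qed

lemma RT_comb:
  fixes s :: real
  assumes y: "y \<in> RT" and z: "z \<in> RT"
  defines "u \<equiv> \<lambda>x. y x + s *\<^sub>R z x"
  shows "u \<in> RT"
    "\<And>T. T \<in> \<T> \<Longrightarrow> avg u T = avg y T + s *\<^sub>R avg z T"
    "\<And>T. T \<in> \<T> \<Longrightarrow> dvg u T = dvg y T + s * dvg z T"
    "\<And>F. F \<in> bsides \<Longrightarrow>
       ntr u F = ntr y F + s * ntr z F"
proof -
  obtain A B where ry: "affine_rep_vec y A B" using y by (rule RT_rep)
  obtain A' B' where rz: "affine_rep_vec z A' B'" using z by (rule RT_rep)
  have lin: "(A T + s *\<^sub>R A' T) + (B T + s *\<^sub>R B' T) *v x = (A T + B T *v x) + s *\<^sub>R (A' T + B' T *v x)" for T x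
    by (simp add: matrix_vector_mult_add_rdistrib scaleR_matrix_vector_assoc[symmetric] scaleR_add_right)
  have linn: "((A T + s *\<^sub>R A' T) + (B T + s *\<^sub>R B' T) *v x) \<bullet> m
      = (A T + B T *v x) \<bullet> m + s * ((A' T + B' T *v x) \<bullet> m)" for T x m
    unfolding lin inner_add_left[of _ "s *\<^sub>R _"] inner_scaleR_left ..
  have r: "affine_rep_vec u (\<lambda>T. A T + s *\<^sub>R A' T) (\<lambda>T. B T + s *\<^sub>R B' T)"
    using ry rz by (simp add: affine_rep_vec_def u_def lin)
  show "u \<in> RT"
    unfolding RT_iff[OF r] linn
  proof (intro conjI ballI allI impI)
    fix T F assume a: "T \<in> \<T>" "F facet_of T"
    show "\<exists>k. \<forall>x\<in>F. (A T + B T *v x) \<bullet> outer_normal T F + s * ((A' T + B' T *v x) \<bullet> outer_normal T F) = k"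
      by (intro exI ballI) (simp only: RT_flux[OF y ry a] RT_flux[OF z rz a])
  next
    fix F T T' x
    assume a: "F \<in> isides" "T \<in> \<T>" "T' \<in> \<T>" "T \<noteq> T' \<and> F facet_of T \<and> F facet_of T'" "x \<in> F"
    have "(A T + B T *v x) \<bullet> outer_normal T F + (A T' + B T' *v x) \<bullet> outer_normal T' F = 0" (is "?a + ?b = 0")
      using y[unfolded RT_iff[OF ry]] a by blast
    moreover have "(A' T + B' T *v x) \<bullet> outer_normal T F + (A' T' + B' T' *v x) \<bullet> outer_normal T' F = 0" (is "?c + ?d = 0")
      using z[unfolded RT_iff[OF rz]] a by blast
    moreover have "?a + s * ?c + (?b + s * ?d) = (?a + ?b) + s * (?c + ?d)" by (simp only: distrib_left add_ac)
    ultimately show "?a + s * ?c + (?b + s * ?d) = 0" by simp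
  qed
  show "avg u T = avg y T + s *\<^sub>R avg z T" if T: "T \<in> \<T>" for T
  proof -
    have iy: "set_integrable lebesgue T y" by (rule affine_vec_integrable[OF ry T])
    have iz: "set_integrable lebesgue T z" by (rule affine_vec_integrable[OF rz T])
    have "(LINT x:T|lebesgue. u x)
        = (LINT x|lebesgue. indicator T x *\<^sub>R y x + s *\<^sub>R (indicator T x *\<^sub>R z x))"
      unfolding set_lebesgue_integral_def u_def
      by (rule Bochner_Integration.integral_cong) (simp_all add: scaleR_add_right mult.commute)
    also have "\<dots> = (LINT x|lebesgue. indicator T x *\<^sub>R y x) + (LINT x|lebesgue. s *\<^sub>R (indicator T x *\<^sub>R z x))"
      by (rule Bochner_Integration.integral_add[OF iy[unfolded set_integrable_def] integrable_scaleR_right])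
        (rule iz[unfolded set_integrable_def])
    also have "(LINT x|lebesgue. s *\<^sub>R (indicator T x *\<^sub>R z x)) = s *\<^sub>R (LINT x:T|lebesgue. z x)"
      unfolding set_lebesgue_integral_def
      by (rule integral_scaleR_right)
    also have "(LINT x|lebesgue. indicator T x *\<^sub>R y x) = (LINT x:T|lebesgue. y x)"
      unfolding set_lebesgue_integral_def ..
    finally show ?thesis
      by (simp only: Pi_h_interior[OF T inner_pt_T[OF T]] scaleR_add_right scaleR_left_commute)
  qed
  show "dvg u T = dvg y T + s * dvg z T" if T: "T \<in> \<T>" for T
    unfolding div_affine[OF r T inner_pt_T[OF T]] div_affine[OF ry T inner_pt_T[OF T]] div_affine[OF rz T inner_pt_T[OF T]]
    by (simp add: sum.distrib sum_distrib_left)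
  show "ntr u F = ntr y F + s * ntr z F"
    if F: "F \<in> bsides" for F
  proof -
    obtain T where T: "T \<in> \<T>" "F facet_of T" using F by (rule boundary_sideE)
    note m = inner_pt_F[OF boundary_sidesD[OF F]]
    show ?thesis
      unfolding normal_trace_boundary[OF r F T m] normal_trace_boundary[OF ry F T m] normal_trace_boundary[OF rz F T m] lin
      by (simp add: inner_add_left)
  qed
qed

end

section \<open>Orthogonal projection onto a finite family\<close>

text \<open>Orthogonal projection onto the span of finitely many vectors of the weighted product space, by Gram-Schmidt
  induction: the new vector is first made orthogonal to the old ones.\<close>

lemma normal_equations:
  fixes r :: "'a \<Rightarrow> 'b::real_inner" and g :: "'c \<Rightarrow> 'a \<Rightarrow> 'b" and t :: "'a \<Rightarrow> real"
  assumes fin: "finite S" and t: "\<And>T. T \<in> S \<Longrightarrow> t T > 0" and A: "finite A"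
  shows "\<exists>c. \<forall>F\<in>A. (\<Sum>T\<in>S. t T * ((r T - (\<Sum>G\<in>A. c G *\<^sub>R g G T)) \<bullet> g F T)) = 0"
  using A
proof (induction A arbitrary: r)
  case empty
  then show ?case by simp
next
  case (insert a A)
  define ip where "ip x y = (\<Sum>T\<in>S. t T * (x T \<bullet> y T))" for x y :: "'a \<Rightarrow> 'b"
  have ip_diff: "ip (\<lambda>T. x T - k *\<^sub>R y T) w = ip x w - k * ip y w" for x y w k
    by (simp add: ip_def inner_diff_left sum_subtractf sum_distrib_left right_diff_distrib mult.left_commute)
  have ip_sum: "ip x (\<lambda>T. \<Sum>G\<in>A. c G *\<^sub>R g G T) = (\<Sum>G\<in>A. c G * ip x (g G))" for x c
    by (simp add: ip_def inner_sum_right sum_distrib_left sum.swap[of _ A S] mult.left_commute)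
  obtain c1 where "\<forall>F\<in>A. (\<Sum>T\<in>S. t T * ((r T - (\<Sum>G\<in>A. c1 G *\<^sub>R g G T)) \<bullet> g F T)) = 0"
    using insert.IH by blast
  define r1 where "r1 T = r T - (\<Sum>G\<in>A. c1 G *\<^sub>R g G T)" for T
  have r1: "ip r1 (g F) = 0" if "F \<in> A" for F
    using \<open>\<forall>F\<in>A. _\<close> that by (simp add: ip_def r1_def)
  obtain c2 where "\<forall>F\<in>A. (\<Sum>T\<in>S. t T * ((g a T - (\<Sum>G\<in>A. c2 G *\<^sub>R g G T)) \<bullet> g F T)) = 0"
    using insert.IH by blast
  define g1 where "g1 T = g a T - (\<Sum>G\<in>A. c2 G *\<^sub>R g G T)" for T
  have g1: "ip g1 (g F) = 0" if "F \<in> A" for F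
    using \<open>\<forall>F\<in>A. (\<Sum>T\<in>S. t T * ((g a T - _) \<bullet> _)) = 0\<close> that by (simp add: ip_def g1_def)
  have ga: "ip x (g a) = ip x g1" if "\<And>F. F \<in> A \<Longrightarrow> ip x (g F) = 0" for x
  proof -
    have "ip x g1 = ip x (g a) - ip x (\<lambda>T. \<Sum>G\<in>A. c2 G *\<^sub>R g G T)"
      by (simp add: ip_def g1_def inner_diff_right right_diff_distrib sum_subtractf)
    also have "ip x (\<lambda>T. \<Sum>G\<in>A. c2 G *\<^sub>R g G T) = 0"
      unfolding ip_sum using that by (intro sum.neutral) simp
    finally show ?thesis by simp
  qed
  \<comment> \<open>if the new direction is a combination of the old ones, division by zero makes its coefficient vanish\<close>
  define k where "k = ip r1 g1 / ip g1 g1"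
  define r2 where "r2 T = r1 T - k *\<^sub>R g1 T" for T
  have r2A: "ip r2 (g F) = 0" if "F \<in> A" for F
    unfolding r2_def ip_diff using r1[OF that] g1[OF that] by simp
  have "ip r1 g1 = 0" if "ip g1 g1 = 0"
  proof -
    have "\<forall>T\<in>S. t T * (g1 T \<bullet> g1 T) = 0"
      using that t unfolding ip_def by (subst (asm) sum_nonneg_eq_0_iff[OF fin]) (auto simp: less_imp_le)
    then have "g1 T = 0" if "T \<in> S" for T using t[OF that] that by force
    then show ?thesis unfolding ip_def by (intro sum.neutral) simp
  qed
  then have "ip r2 g1 = 0" unfolding r2_def ip_diff k_def by auto
  then have r2a: "ip r2 (g a) = 0" using ga[OF r2A] by simp
  define c where "c G = (if G = a then k else c1 G - k * c2 G)" for G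
  have "r T - (\<Sum>G\<in>insert a A. c G *\<^sub>R g G T) = r2 T" for T
  proof -
    have "(\<Sum>G\<in>A. c G *\<^sub>R g G T) = (\<Sum>G\<in>A. c1 G *\<^sub>R g G T - k *\<^sub>R (c2 G *\<^sub>R g G T))"
      using insert.hyps(2) by (intro sum.cong refl) (auto simp: c_def scaleR_diff_left)
    then have "(\<Sum>G\<in>insert a A. c G *\<^sub>R g G T)
        = k *\<^sub>R g a T + ((\<Sum>G\<in>A. c1 G *\<^sub>R g G T) - k *\<^sub>R (\<Sum>G\<in>A. c2 G *\<^sub>R g G T))"
      using insert.hyps by (simp add: c_def sum_subtractf scaleR_sum_right)
    then show ?thesis by (simp add: r2_def r1_def g1_def scaleR_diff_right)
  qed
  then show ?case using r2A r2a unfolding ip_def by (intro exI[of _ c]) auto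
qed

section \<open>The Huber function\<close>

text \<open>The projection onto the ball of radius \<open>z\<close>, which is the derivative of \<open>phi_star\<close>. Writing it with
  the maximum makes its continuity evident.\<close>

definition ball_proj :: "real \<Rightarrow> real^'n \<Rightarrow> real^'n" where
  "ball_proj z s = (z / max (norm s) z) *\<^sub>R s"

lemma ball_proj_eq:
  assumes "z > 0"
  shows "ball_proj z s = (if norm s \<le> z then s else (z / norm s) *\<^sub>R s)"
  using assms by (simp add: ball_proj_def max_def)

lemma norm_ball_proj:
  assumes "z > 0" shows "norm (ball_proj z s) \<le> z"
proof -
  have "s \<noteq> 0" if "\<not> norm s \<le> z" using that assms by auto
  then show ?thesis using assms by (auto simp: ball_proj_eq)
qed

lemma ball_proj_obtuse:
  assumes z: "z > 0" and w: "norm w \<le> z"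
  shows "(s - ball_proj z s) \<bullet> (w - ball_proj z s) \<le> 0"
proof (cases "norm s \<le> z")
  case True
  then show ?thesis using z by (simp add: ball_proj_eq)
next
  case False
  then have n: "norm s > z" "norm s > 0" using z by auto
  have p: "ball_proj z s = (z / norm s) *\<^sub>R s" using False z by (simp add: ball_proj_eq)
  have d: "s - ball_proj z s = (1 - z / norm s) *\<^sub>R s" by (simp add: p scaleR_diff_left)
  have "(s - ball_proj z s) \<bullet> (w - ball_proj z s) = (1 - z / norm s) * (s \<bullet> w - s \<bullet> ball_proj z s)"
    by (subst d) (simp only: inner_scaleR_left inner_diff_right right_diff_distrib)
  moreover have "s \<bullet> ball_proj z s = z * norm s"
    using n by (simp add: p power2_norm_eq_inner[symmetric] power2_eq_square)
  moreover have "s \<bullet> w \<le> norm s * z"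
    using norm_cauchy_schwarz[of s w] mult_left_mono[OF w, of "norm s"] by simp
  moreover have "1 - z / norm s \<ge> 0" using n by (simp add: field_simps)
  ultimately show ?thesis
    by (simp add: mult_nonneg_nonpos mult.commute[of z])
qed

text \<open>The contribution of one element to the primal error: inside the ball nothing is lost, outside of it \<open>s\<close> is the
  multiple \<open>norm s / z\<close> of its projection \<open>u\<close>.\<close>

lemma ball_proj_defect:
  assumes z: "z > 0" and u: "u = ball_proj z s"
  shows "(u - s) \<bullet> (v - u) = (if norm u = z then (norm s / z - 1) * (z\<^sup>2 - u \<bullet> v) else 0)"
proof (cases "norm s \<le> z")
  case True
  then have "u = s" using u z by (simp add: ball_proj_eq)
  then show ?thesis using z by simp
next
  case False
  then have n: "norm s > z" "norm s > 0" using z by auto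
  have p: "u = (z / norm s) *\<^sub>R s" using False z u by (simp add: ball_proj_eq)
  then have nu: "norm u = z" using z n by simp
  have s: "s = (norm s / z) *\<^sub>R u" using p z n by simp
  have d: "u - s = (1 - norm s / z) *\<^sub>R u" by (subst s) (simp add: scaleR_diff_left)
  have "(u - s) \<bullet> (v - u) = (1 - norm s / z) * (u \<bullet> v - u \<bullet> u)"
    by (subst d) (simp only: inner_scaleR_left inner_diff_right right_diff_distrib)
  moreover have "u \<bullet> u = z\<^sup>2" using nu by (simp add: power2_norm_eq_inner[symmetric])
  ultimately show ?thesis using nu by (simp add: algebra_simps)
qed

lemma max_zero_square_derivative:
  "((\<lambda>r::real. (max r 0)\<^sup>2) has_real_derivative 2 * max r 0) (at r)"
proof -
  consider "r > 0" | "r < 0" | "r = 0" by linarith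
  then show ?thesis
  proof cases
    case 1
    have "((\<lambda>r::real. r\<^sup>2) has_real_derivative 2 * r) (at r)"
      by (auto intro!: derivative_eq_intros)
    then have "((\<lambda>r::real. (max r 0)\<^sup>2) has_real_derivative 2 * r) (at r)"
      by (rule has_field_derivative_transform_within_open[of _ _ _ "{0<..}"]) (use 1 in auto)
    then show ?thesis using 1 by simp
  next
    case 2
    have "((\<lambda>r::real. 0) has_real_derivative 0) (at r)" by simp
    then have "((\<lambda>r::real. (max r 0)\<^sup>2) has_real_derivative 0) (at r)"
      by (rule has_field_derivative_transform_within_open[of _ _ _ "{..<0}"]) (use 2 in auto)
    then show ?thesis using 2 by simp
  next
    case 3
    have "((\<lambda>y::real. (max y 0)\<^sup>2 / y) \<longlongrightarrow> 0) (at 0)"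
    proof (rule Lim_null_comparison)
      show "\<forall>\<^sub>F y in at 0. norm ((max y 0)\<^sup>2 / y) \<le> \<bar>y::real\<bar>"
        by (rule always_eventually) (auto simp: max_def power2_eq_square)
      show "((\<lambda>y::real. \<bar>y\<bar>) \<longlongrightarrow> 0) (at 0)"
        by (rule tendsto_rabs_zero) (rule tendsto_ident_at)
    qed
    then show ?thesis using 3 by (simp add: has_field_derivative_iff)
  qed
qed

context
  fixes \<zeta> :: "real^'n \<Rightarrow> real" and x :: "real^'n" and z :: real
  assumes z_def: "z = \<zeta> x" and z: "z > 0"
begin

text \<open>The correction term is the square of a positive part, hence differentiable also on the sphere of radius \<open>z\<close>.\<close>

lemma phi_star_eq: "phi_star \<zeta> x s = (norm s)\<^sup>2 / 2 - (max (norm s - z) 0)\<^sup>2 / 2"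
  by (simp add: phi_star_def z_def[symmetric] max_def power2_eq_square algebra_simps add_divide_distrib diff_divide_distrib)

lemma norm_line_square: "(norm (s + l *\<^sub>R e))\<^sup>2 = s \<bullet> s + 2 * l * (s \<bullet> e) + l\<^sup>2 * (e \<bullet> e)" for s e :: "real^'n"
  unfolding power2_norm_eq_inner
  by (simp add: inner_add_left inner_add_right inner_commute[of e s] power2_eq_square algebra_simps)

lemma norm_line_square_derivative:
  "((\<lambda>l. (norm (s + l *\<^sub>R e))\<^sup>2) has_real_derivative 2 * ((s + l *\<^sub>R e) \<bullet> e)) (at l)" for s e :: "real^'n"
  unfolding norm_line_square
  by (auto intro!: derivative_eq_intros simp: inner_add_left algebra_simps)

lemma norm_line_derivative:
  fixes s e :: "real^'n"
  assumes "s + l *\<^sub>R e \<noteq> 0"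
  shows "((\<lambda>l. norm (s + l *\<^sub>R e)) has_real_derivative ((s + l *\<^sub>R e) \<bullet> e) / norm (s + l *\<^sub>R e)) (at l)"
proof -
  have "((\<lambda>l. sqrt ((norm (s + l *\<^sub>R e))\<^sup>2)) has_real_derivative
      inverse (sqrt ((norm (s + l *\<^sub>R e))\<^sup>2)) / 2 * (2 * ((s + l *\<^sub>R e) \<bullet> e))) (at l)"
    by (rule DERIV_chain2[OF DERIV_real_sqrt norm_line_square_derivative]) (use assms in simp)
  then show ?thesis by (simp add: field_simps)
qed

lemma open_line_less: "open {l. norm (s + l *\<^sub>R e) < z}" and open_line_greater: "open {l. z < norm (s + l *\<^sub>R e)}"
  for s e :: "real^'n"
  by (intro open_Collect_less continuous_intros)+

lemma phi_star_line_derivative: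
  fixes s e :: "real^'n"
  shows "((\<lambda>l. phi_star \<zeta> x (s + l *\<^sub>R e)) has_real_derivative ball_proj z (s + l *\<^sub>R e) \<bullet> e) (at l)"
proof (cases "norm (s + l *\<^sub>R e) < z")
  case True
  have "((\<lambda>l. (norm (s + l *\<^sub>R e))\<^sup>2 / 2) has_real_derivative (2 * ((s + l *\<^sub>R e) \<bullet> e)) / 2) (at l)"
    by (rule DERIV_cdivide[OF norm_line_square_derivative])
  then have "((\<lambda>l. phi_star \<zeta> x (s + l *\<^sub>R e)) has_real_derivative (2 * ((s + l *\<^sub>R e) \<bullet> e)) / 2) (at l)"
    by (rule has_field_derivative_transform_within_open[OF _ open_line_less])
       (use True in \<open>auto simp: phi_star_def z_def\<close>)
  then show ?thesis using True z by (simp add: ball_proj_eq)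
next
  case False
  define r where "r = s + l *\<^sub>R e"
  have r: "norm r \<ge> z" "r \<noteq> 0" "norm r > 0" using False z by (auto simp: r_def)
  have 1: "((\<lambda>l. norm (s + l *\<^sub>R e) - z) has_real_derivative (r \<bullet> e) / norm r) (at l)"
    using DERIV_diff[OF norm_line_derivative[of s l e] DERIV_const[of z]] r by (simp add: r_def)
  have "((\<lambda>l. (max (norm (s + l *\<^sub>R e) - z) 0)\<^sup>2) has_real_derivative 2 * max (norm r - z) 0 * ((r \<bullet> e) / norm r)) (at l)"
    using DERIV_chain2[OF max_zero_square_derivative 1] by (simp add: r_def)
  then have "((\<lambda>l. (norm (s + l *\<^sub>R e))\<^sup>2 / 2 - (max (norm (s + l *\<^sub>R e) - z) 0)\<^sup>2 / 2) has_real_derivative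
      2 * (r \<bullet> e) / 2 - 2 * max (norm r - z) 0 * ((r \<bullet> e) / norm r) / 2) (at l)"
    unfolding r_def by (intro DERIV_diff DERIV_cdivide norm_line_square_derivative)
  moreover have "2 * (r \<bullet> e) / 2 - 2 * max (norm r - z) 0 * ((r \<bullet> e) / norm r) / 2 = ball_proj z r \<bullet> e"
    using r by (simp add: ball_proj_def max_def field_simps)
  ultimately show ?thesis unfolding phi_star_eq r_def by simp
qed

lemma outer_product_mult: "outer_product s t *v e = (t \<bullet> e) *\<^sub>R s" for s t e :: "real^'n"
  by (simp add: vec_eq_iff outer_product_def matrix_vector_mult_def inner_vec_def sum_distrib_left sum_distrib_right mult_ac)

lemma ball_proj_line_derivative:
  fixes s e :: "real^'n"
  assumes ne: "norm (s + l *\<^sub>R e) \<noteq> z"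
  shows "((\<lambda>l. ball_proj z (s + l *\<^sub>R e) \<bullet> e) has_real_derivative
     (hess_phi_star \<zeta> x (s + l *\<^sub>R e) *v e) \<bullet> e) (at l)"
proof (cases "norm (s + l *\<^sub>R e) < z")
  case True
  have "((\<lambda>l. (s + l *\<^sub>R e) \<bullet> e) has_real_derivative e \<bullet> e) (at l)"
    unfolding inner_add_left inner_scaleR_left by (auto intro!: derivative_eq_intros)
  then have "((\<lambda>l. ball_proj z (s + l *\<^sub>R e) \<bullet> e) has_real_derivative e \<bullet> e) (at l)"
    by (rule has_field_derivative_transform_within_open[OF _ open_line_less])
       (use True z in \<open>auto simp: ball_proj_eq\<close>)
  then show ?thesis using True by (simp add: hess_phi_star_def z_def[symmetric])
next
  case False
  define r where "r = s + l *\<^sub>R e"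
  have r: "norm r > z" "r \<noteq> 0" "norm r > 0" using False z ne by (auto simp: r_def)
  have 1: "((\<lambda>l. (s + l *\<^sub>R e) \<bullet> e) has_real_derivative e \<bullet> e) (at l)"
    unfolding inner_add_left inner_scaleR_left by (auto intro!: derivative_eq_intros)
  have "((\<lambda>l. z * (((s + l *\<^sub>R e) \<bullet> e) / norm (s + l *\<^sub>R e))) has_real_derivative
      z * (((e \<bullet> e) * norm r - (r \<bullet> e) * ((r \<bullet> e) / norm r)) / (norm r * norm r))) (at l)"
    using DERIV_cmult[OF DERIV_divide[OF 1 norm_line_derivative[of s l e]], of z] r by (simp add: r_def)
  then have "((\<lambda>l. ball_proj z (s + l *\<^sub>R e) \<bullet> e) has_real_derivative
      z * (((e \<bullet> e) * norm r - (r \<bullet> e) * ((r \<bullet> e) / norm r)) / (norm r * norm r))) (at l)"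
    by (rule has_field_derivative_transform_within_open[OF _ open_line_greater])
       (use r z in \<open>auto simp: ball_proj_eq r_def\<close>)
  moreover have "z * (((e \<bullet> e) * norm r - (r \<bullet> e) * ((r \<bullet> e) / norm r)) / (norm r * norm r))
      = (hess_phi_star \<zeta> x r *v e) \<bullet> e"
  proof -
    have "(hess_phi_star \<zeta> x r *v e) \<bullet> e = (z / norm r) * (e \<bullet> e - (1 / (norm r)\<^sup>2) * ((r \<bullet> e) * (r \<bullet> e)))"
      using r by (simp add: hess_phi_star_def z_def[symmetric] scaleR_matrix_vector_assoc[symmetric]
          matrix_vector_mult_diff_rdistrib outer_product_mult inner_diff_left)
    then show ?thesis using r by (simp add: field_simps power2_eq_square)
  qed
  ultimately show ?thesis unfolding r_def by simp
qed

lemma finite_crossings: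
  fixes s e :: "real^'n"
  assumes "e \<noteq> 0" shows "finite {l. norm (s + l *\<^sub>R e) = z}"
proof -
  define p where "p = [:s \<bullet> s - z\<^sup>2, 2 * (s \<bullet> e), e \<bullet> e:]"
  have "p \<noteq> 0" using assms by (simp add: p_def)
  then have "finite {l. poly p l = 0}" by (rule poly_roots_finite)
  moreover have "poly p l = 0" if "norm (s + l *\<^sub>R e) = z" for l
  proof -
    have "poly p l = (norm (s + l *\<^sub>R e))\<^sup>2 - z\<^sup>2"
      unfolding norm_line_square by (simp add: p_def power2_eq_square algebra_simps)
    then show ?thesis using that by simp
  qed
  then have "{l. norm (s + l *\<^sub>R e) = z} \<subseteq> {l. poly p l = 0}" by blast
  ultimately show ?thesis by (rule rev_finite_subset)
qed

lemma continuous_ball_proj: "continuous_on UNIV (\<lambda>l. ball_proj z (s + l *\<^sub>R e) \<bullet> e)" for s e :: "real^'n"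
  unfolding ball_proj_def using z by (intro continuous_intros) (auto simp: max_def)

lemma phi_star_taylor_integral:
  fixes s e :: "real^'n"
  assumes "e \<noteq> 0"
  shows "((\<lambda>l. (1 - l) * ((hess_phi_star \<zeta> x (s + l *\<^sub>R e) *v e) \<bullet> e)) has_integral
    phi_star \<zeta> x (s + e) - phi_star \<zeta> x s - ball_proj z s \<bullet> e) {0..1}"
proof -
  \<comment> \<open>partial integration: \<open>G\<close> is the antiderivative of the weighted second derivative\<close>
  define G where "G l = (1 - l) * (ball_proj z (s + l *\<^sub>R e) \<bullet> e) + phi_star \<zeta> x (s + l *\<^sub>R e)" for l
  have "((\<lambda>l. (1 - l) * ((hess_phi_star \<zeta> x (s + l *\<^sub>R e) *v e) \<bullet> e)) has_integral G 1 - G 0) {0..1}"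
  proof (rule fundamental_theorem_of_calculus_interior_strong[OF finite_crossings[OF assms, of s]])
    fix l assume "l \<in> {0<..<1} - {l. norm (s + l *\<^sub>R e) = z}"
    then have ne: "norm (s + l *\<^sub>R e) \<noteq> z" by simp
    have "(G has_real_derivative (0 - 1) * (ball_proj z (s + l *\<^sub>R e) \<bullet> e)
        + (hess_phi_star \<zeta> x (s + l *\<^sub>R e) *v e) \<bullet> e * (1 - l) + ball_proj z (s + l *\<^sub>R e) \<bullet> e) (at l)"
      unfolding G_def
      by (intro DERIV_add DERIV_mult DERIV_diff DERIV_const DERIV_ident ball_proj_line_derivative[OF ne] phi_star_line_derivative)
    then show "(G has_vector_derivative (1 - l) * ((hess_phi_star \<zeta> x (s + l *\<^sub>R e) *v e) \<bullet> e)) (at l)"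
      by (simp add: has_real_derivative_iff_has_vector_derivative mult.commute)
  next
    have "isCont (\<lambda>l. phi_star \<zeta> x (s + l *\<^sub>R e)) l" for l
      by (rule DERIV_isCont[OF phi_star_line_derivative])
    then have "continuous_on {0..1} (\<lambda>l. phi_star \<zeta> x (s + l *\<^sub>R e))"
      by (intro continuous_at_imp_continuous_on) simp
    moreover have "continuous_on {0..1} (\<lambda>l. ball_proj z (s + l *\<^sub>R e) \<bullet> e)"
      by (rule continuous_on_subset[OF continuous_ball_proj]) simp
    ultimately show "continuous_on {0..1} G"
      unfolding G_def by (intro continuous_on_add continuous_on_mult continuous_on_diff continuous_on_const continuous_on_id)
  qed simp
  then show ?thesis by (simp add: G_def algebra_simps)
qed

lemma outer_product_norm: "norm (outer_product s t) \<le> CARD('n) * (norm s * norm t)" for s t :: "real^'n"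
proof -
  have row: "outer_product s t $ i = s $ i *\<^sub>R t" for i by (simp add: outer_product_def vec_eq_iff)
  have "norm (outer_product s t) \<le> (\<Sum>i\<in>UNIV. norm (outer_product s t $ i))"
    unfolding norm_vec_def by (rule L2_set_le_sum) simp
  also have "\<dots> \<le> (\<Sum>i\<in>(UNIV::'n set). norm s * norm t)"
    unfolding row by (rule sum_mono) (simp add: mult_right_mono component_le_norm_cart)
  finally show ?thesis by simp
qed

lemma hess_bounded: "norm (hess_phi_star \<zeta> x t) \<le> norm (mat 1 :: real^'n^'n) + CARD('n)" for t :: "real^'n"
proof (cases "norm t \<le> z")
  case True
  then show ?thesis by (simp add: hess_phi_star_def z_def[symmetric])
next
  case False
  then have n: "norm t > z" "norm t > 0" using z by auto
  have "norm ((1 / (norm t)\<^sup>2) *\<^sub>R outer_product t t) = (1 / (norm t)\<^sup>2) * norm (outer_product t t)" by simp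
  also have "\<dots> \<le> (1 / (norm t)\<^sup>2) * (CARD('n) * (norm t * norm t))"
    by (rule mult_left_mono[OF outer_product_norm]) simp
  also have "\<dots> = CARD('n)" using n by (simp add: power2_eq_square)
  finally have o: "norm ((1 / (norm t)\<^sup>2) *\<^sub>R outer_product t t) \<le> CARD('n)" .
  have "norm (hess_phi_star \<zeta> x t) = (z / norm t) * norm (mat 1 - (1 / (norm t)\<^sup>2) *\<^sub>R outer_product t t)"
    using False n z by (simp add: hess_phi_star_def z_def[symmetric])
  also have "\<dots> \<le> 1 * norm (mat 1 - (1 / (norm t)\<^sup>2) *\<^sub>R outer_product t t)"
    using n z by (intro mult_right_mono) (auto simp: field_simps)
  also have "\<dots> \<le> norm (mat 1 :: real^'n^'n) + norm ((1 / (norm t)\<^sup>2) *\<^sub>R outer_product t t)"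
    by (simp only: mult_1_left norm_triangle_ineq4)
  finally show ?thesis using o by linarith
qed

lemma hess_measurable: "hess_phi_star \<zeta> x \<in> borel_measurable borel"
proof -
  have "continuous_on UNIV (\<lambda>t::real^'n. outer_product t t)"
    unfolding outer_product_def by (intro continuous_intros)
  then have [measurable]: "(\<lambda>t::real^'n. outer_product t t) \<in> borel_measurable borel"
    by (rule borel_measurable_continuous_onI)
  show ?thesis unfolding hess_phi_star_def[abs_def] by measurable
qed

text \<open>Taylor's formula with integral remainder. Along a nondegenerate segment the second derivative exists except at
  the finitely many points where the segment meets the sphere of radius \<open>\<zeta> x\<close>, which is enough for the
  fundamental theorem of calculus since the first derivative is continuous.\<close>

lemma phi_star_taylor:
  "(hess_phi_star_mean \<zeta> t s x *v (t - s)) \<bullet> (t - s)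
     = phi_star \<zeta> x t - phi_star \<zeta> x s - ball_proj z s \<bullet> (t - s)"
proof (cases "t = s")
  case False
  define e where "e = t - s"
  then have e: "e \<noteq> 0" using False by simp
  define H where "H l = (1 - l) *\<^sub>R hess_phi_star \<zeta> x (l *\<^sub>R t + (1 - l) *\<^sub>R s)" for l
  have line: "l *\<^sub>R t + (1 - l) *\<^sub>R s = s + l *\<^sub>R e" for l by (simp add: e_def algebra_simps)
  have "(\<lambda>l. hess_phi_star \<zeta> x (l *\<^sub>R t + (1 - l) *\<^sub>R s)) \<in> borel_measurable borel"
    by (rule measurable_compose[OF _ hess_measurable]) measurable
  then have "H \<in> borel_measurable borel" unfolding H_def by measurable
  then have Hm: "H \<in> borel_measurable lebesgue" by (intro measurable_completion) simp
  have int: "integrable lebesgue (\<lambda>l. indicator {0..1} l *\<^sub>R H l)"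
  proof (rule integrableI_bounded_set_indicator[OF _ Hm])
    show "AE l in lebesgue. l \<in> {0..1} \<longrightarrow> norm (H l) \<le> norm (mat 1 :: real^'n^'n) + CARD('n)"
    proof (rule AE_I2, rule impI)
      fix l :: real assume "l \<in> {0..1}"
      then have "norm (H l) \<le> 1 * norm (hess_phi_star \<zeta> x (l *\<^sub>R t + (1 - l) *\<^sub>R s))"
        unfolding H_def norm_scaleR by (intro mult_right_mono) auto
      also have "\<dots> \<le> norm (mat 1 :: real^'n^'n) + CARD('n)" using hess_bounded by simp
      finally show "norm (H l) \<le> norm (mat 1 :: real^'n^'n) + CARD('n)" .
    qed
  qed auto
  have "linear (\<lambda>M::real^'n^'n. (M *v e) \<bullet> e)"
    by (rule linearI) (simp_all add: matrix_vector_mult_add_rdistrib inner_add_left scaleR_matrix_vector_assoc[symmetric])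
  then have bl: "bounded_linear (\<lambda>M::real^'n^'n. (M *v e) \<bullet> e)" by (simp add: linear_linear)
  define h where "h l = (1 - l) * ((hess_phi_star \<zeta> x (s + l *\<^sub>R e) *v e) \<bullet> e)" for l
  have Hh: "((indicator {0..1} l *\<^sub>R H l) *v e) \<bullet> e = indicator {0..1} l *\<^sub>R h l" for l
    by (simp add: H_def h_def line scaleR_matrix_vector_assoc[symmetric])
  have "(hess_phi_star_mean \<zeta> t s x *v e) \<bullet> e = (LINT l|lebesgue. ((indicator {0..1} l *\<^sub>R H l) *v e) \<bullet> e)"
    unfolding hess_phi_star_mean_def set_lebesgue_integral_def H_def[symmetric]
    by (rule integral_bounded_linear[OF bl int, symmetric])
  also have "\<dots> = (LINT l:{0..1}|lebesgue. h l)"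
    unfolding Hh set_lebesgue_integral_def ..
  also have "\<dots> = integral {0..1} h"
  proof (rule set_lebesgue_integral_eq_integral(2))
    have "integrable lebesgue (\<lambda>l. ((indicator {0..1} l *\<^sub>R H l) *v e) \<bullet> e)"
      by (rule integrable_bounded_linear[OF bl int])
    then show "set_integrable lebesgue {0..1} h" unfolding Hh set_integrable_def .
  qed
  also have "\<dots> = phi_star \<zeta> x (s + e) - phi_star \<zeta> x s - ball_proj z s \<bullet> e"
    unfolding h_def by (rule integral_unique[OF phi_star_taylor_integral[OF e]])
  finally show ?thesis by (simp add: e_def)
qed simp

end

context mesh
begin

lemma piecewise_affine_rep:
  "affine_rep (\<lambda>x. \<Sum>T\<in>\<T>. indicator (interior T) x *\<^sub>R (c T + b T \<bullet> x)) c b"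
  unfolding affine_rep_def by (intro ballI) (rule sum_interior_indicator)

lemma piecewise_constant_rep:
  "affine_rep_vec (\<lambda>x. \<Sum>T\<in>\<T>. indicator (interior T) x *\<^sub>R q T) q (\<lambda>T. 0)"
  unfolding affine_rep_vec_def by (intro ballI) (simp add: sum_interior_indicator)

text \<open>The residual of the orthogonal projection of \<open>r\<close> onto the gradients of the Crouzeix-Raviart functions with
  vanishing averages on \<open>D\<close> is orthogonal to the gradients of the basis functions of all sides
  outside \<open>D\<close>. Element-wise integration by parts turns this into the cancellation of its
  normal components on these sides, so the residual is a Raviart-Thomas field with vanishing divergence.\<close>

lemma discrete_helmholtz:
  fixes r :: "(real^'n) set \<Rightarrow> real^'n"
  assumes D: "D \<subseteq> bsides"
  obtains w y where
    "w \<in> CR" "\<And>F. F \<in> D \<Longrightarrow> smean w F = 0"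
    "y \<in> RT" "\<And>T. T \<in> \<T> \<Longrightarrow> dvg y T = 0"
    "\<And>F. F \<in> bsides - D \<Longrightarrow> ntr y F = 0"
    "\<And>T. T \<in> \<T> \<Longrightarrow> r T = grd w T + avg y T"
proof -
  have "\<forall>T\<in>\<T>. \<exists>p. \<forall>F G. F facet_of T \<longrightarrow> G facet_of T \<longrightarrow>
     side_mean G (\<lambda>x. fst p F + snd p F \<bullet> x) = (if G = F then 1 else 0)"
  proof
    fix T assume "T \<in> \<T>"
    from element_dual_basis[OF simplex_T[OF this]]
    obtain \<kappa> \<gamma> where "\<forall>F G. F facet_of T \<longrightarrow> G facet_of T \<longrightarrow>
       side_mean G (\<lambda>x. \<kappa> F + (\<gamma> F :: real^'n) \<bullet> x) = (if G = F then 1 else 0)"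
      by (elim exE) (rule that)
    then show "\<exists>p. \<forall>F G. F facet_of T \<longrightarrow> G facet_of T \<longrightarrow>
       side_mean G (\<lambda>x. fst p F + snd p F \<bullet> x) = (if G = F then 1 else 0)"
      by (intro exI[of _ "(\<kappa>, \<gamma>)"]) simp
  qed
  then obtain p where p: "\<forall>T\<in>\<T>. \<forall>F G. F facet_of T \<longrightarrow> G facet_of T \<longrightarrow>
     side_mean G (\<lambda>x. fst (p T) F + snd (p T) F \<bullet> x) = (if G = F then 1 else 0)"
    by (rule bchoice[THEN exE])
  define k where "k F T = (if F facet_of T then fst (p T) F else 0)" for F T
  define g where "g F T = (if F facet_of T then snd (p T) F else 0)" for F T
  have dual: "k F T + g F T \<bullet> side_center G = (if G = F then 1 else 0)" if "T \<in> \<T>" "G facet_of T" for F G T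
  proof (cases "F facet_of T")
    case True
    then show ?thesis
      using p that side_mean_center[OF facet_in_sides[OF that], of "fst (p T) F" "snd (p T) F"]
      by (simp add: k_def g_def)
  next
    case False
    then have "G \<noteq> F" using that by blast
    then show ?thesis using False by (simp add: k_def g_def)
  qed
  define A where "A = sides \<T> - D"
  have finA: "finite A" using finite_sides by (simp add: A_def)
  obtain c where c: "\<forall>F\<in>A. (\<Sum>T\<in>\<T>. vol T * ((r T - (\<Sum>G\<in>A. c G *\<^sub>R g G T)) \<bullet> g F T)) = 0"
    using normal_equations[OF finite_T measure_T_pos finA, where r = r and g = g] by (rule exE)
  define cc where "cc T = (\<Sum>G\<in>A. c G * k G T)" for T
  define bb where "bb T = (\<Sum>G\<in>A. c G *\<^sub>R g G T)" for T
  define w where "w = (\<lambda>x. \<Sum>T\<in>\<T>. indicator (interior T) x *\<^sub>R (cc T + bb T \<bullet> x))"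
  have rw: "affine_rep w cc bb" unfolding w_def by (rule piecewise_affine_rep)
  have w_val: "cc T + bb T \<bullet> side_center F = (if F \<in> A then c F else 0)" if "T \<in> \<T>" "F facet_of T" for T F
  proof -
    have "cc T + bb T \<bullet> side_center F = (\<Sum>G\<in>A. c G * (k G T + g G T \<bullet> side_center F))"
      by (simp add: cc_def bb_def inner_sum_left sum.distrib distrib_left)
    also have "\<dots> = (\<Sum>G\<in>A. if G = F then c G else 0)"
      by (rule sum.cong) (auto simp: dual[OF that])
    finally show ?thesis using finA by simp
  qed
  have w: "w \<in> CR"
    unfolding CR_iff[OF rw] using w_val by simp
  define q where "q T = r T - bb T" for T
  define y where "y = (\<lambda>x. \<Sum>T\<in>\<T>. indicator (interior T) x *\<^sub>R q T)"
  have ry: "affine_rep_vec y q (\<lambda>T. 0)" unfolding y_def by (rule piecewise_constant_rep)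
  have Pi_y: "avg y T = q T" if T: "T \<in> \<T>" for T
  proof -
    have "d \<bullet> avg y T = d \<bullet> q T" for d
    proof -
      have "vol T * (avg y T \<bullet> d) = (LINT x:T|lebesgue. q T \<bullet> d)"
        using Pi_h_affine_vec[OF ry T, of d] by simp
      also have "\<dots> = vol T * (q T \<bullet> d)"
        using borel_compact[OF element_compact[OF simplex_T[OF T]]] by (simp add: set_lebesgue_integral_def)
      finally show ?thesis using measure_T_pos[OF T] by (simp add: inner_commute)
    qed
    then have "\<forall>d. d \<bullet> avg y T = d \<bullet> q T" by blast
    then show ?thesis by (rule vector_eq_ldot[THEN iffD1])
  qed
  \<comment> \<open>testing with the basis function of a free side: the fluxes through that side cancel\<close>
  have flux: "(\<Sum>T | T \<in> \<T> \<and> F facet_of T. q T \<bullet> outer_normal T F) = 0" if F: "F \<in> A" for F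
  proof -
    define v where "v = (\<lambda>x. \<Sum>T\<in>\<T>. indicator (interior T) x *\<^sub>R (k F T + g F T \<bullet> x))"
    have rv: "affine_rep v (k F) (g F)" unfolding v_def by (rule piecewise_affine_rep)
    have "0 = (\<Sum>T\<in>\<T>. vol T * (q T \<bullet> g F T))"
      using c F by (simp add: q_def bb_def)
    also have "\<dots> = (\<Sum>T\<in>\<T>. vol T * (avg y T \<bullet> g F T
        + avg v T * (\<Sum>i\<in>UNIV. (0 :: real^'n^'n) $ i $ i)))"
      by (rule sum.cong) (simp_all add: Pi_y)
    also have "\<dots> = (\<Sum>G\<in>sides \<T>. area G *
        (\<Sum>T | T \<in> \<T> \<and> G facet_of T. (q T \<bullet> outer_normal T G) * (k F T + g F T \<bullet> side_center G)))"
      by (rule sum_element_ibp[OF rv ry]) simp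
    also have "\<dots> = (\<Sum>G\<in>sides \<T>. if G = F then area G *
        (\<Sum>T | T \<in> \<T> \<and> G facet_of T. q T \<bullet> outer_normal T G) else 0)"
      by (rule sum.cong) (auto simp: dual)
    also have "\<dots> = area F * (\<Sum>T | T \<in> \<T> \<and> F facet_of T. q T \<bullet> outer_normal T F)"
      using F finite_sides by (simp add: A_def)
    finally show ?thesis using side_facts(2)[of F] F by (simp add: A_def)
  qed
  have y: "y \<in> RT"
    unfolding RT_iff[OF ry]
  proof (intro conjI ballI allI impI)
    fix T F show "\<exists>k. \<forall>x\<in>F. (q T + 0 *v x) \<bullet> outer_normal T F = k" by simp
  next
    fix F T T' x
    assume a: "F \<in> isides" "T \<in> \<T>" "T' \<in> \<T>" "T \<noteq> T' \<and> F facet_of T \<and> F facet_of T'" "x \<in> F"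
    then have FA: "F \<in> A" using D by (auto simp: A_def interior_sides_def)
    have two: "{S. S \<in> \<T> \<and> F facet_of S} = {T, T'}"
      using at_most_two_elements[of T F T'] a by blast
    show "(q T + 0 *v x) \<bullet> outer_normal T F + (q T' + 0 *v x) \<bullet> outer_normal T' F = 0"
      using flux[OF FA] a(4) unfolding two by simp
  qed
  show thesis
  proof (rule that[OF w _ y])
    show "smean w F = 0" if F: "F \<in> D" for F
    proof -
      have Fb: "F \<in> bsides" using D F by blast
      obtain T where T: "T \<in> \<T>" "F facet_of T" using Fb by (rule boundary_sideE)
      show ?thesis
        unfolding pi_h_boundary[OF rw Fb T inner_pt_F[OF boundary_sidesD[OF Fb]]] w_val[OF T] using F by (simp add: A_def)
    qed
    show "dvg y T = 0" if T: "T \<in> \<T>" for T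
      unfolding div_affine[OF ry T inner_pt_T[OF T]] by simp
    show "ntr y F = 0" if F: "F \<in> bsides - D" for F
    proof -
      have Fb: "F \<in> bsides" using F by blast
      obtain T where T: "T \<in> \<T>" "F facet_of T" using Fb by (rule boundary_sideE)
      have one: "{S. S \<in> \<T> \<and> F facet_of S} = {T}"
        using boundary_side_unique_element[OF Fb _ _ T] T by blast
      have "F \<in> A" using F boundary_sidesD by (auto simp: A_def)
      from flux[OF this] show ?thesis
        unfolding normal_trace_boundary[OF ry Fb T inner_pt_F[OF boundary_sidesD[OF Fb]]] one by simp
    qed
    show "r T = grd w T + avg y T" if T: "T \<in> \<T>" for T
      unfolding grad_affine[OF rw T inner_pt_T[OF T]] Pi_y[OF T] by (simp add: q_def)
  qed
qed

lemma elem_const_grad_h: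
  assumes "v \<in> CR" shows "elem_const (grad_h \<T> v)"
proof -
  obtain c b where "affine_rep v c b" using assms by (rule CR_rep)
  then show ?thesis by (intro elem_constI grad_affine)
qed

lemma elem_const_div_h:
  assumes "y \<in> RT" shows "elem_const (div_h \<T> y)"
proof -
  obtain A B where "affine_rep_vec y A B" using assms by (rule RT_rep)
  then show ?thesis by (intro elem_constI[where k = "\<lambda>T. \<Sum>i\<in>UNIV. B T $ i $ i"] div_affine)
qed

lemma elem_const_L0:
  assumes "v \<in> L0 \<T>" shows "elem_const v"
proof -
  have "\<forall>T\<in>\<T>. \<exists>c. \<forall>x\<in>interior T. v x = c" using assms by (simp add: L0_def)
  then obtain c where "\<forall>T\<in>\<T>. \<forall>x\<in>interior T. v x = c T" by (rule bchoice[THEN exE])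
  then show ?thesis by (intro elem_constI[of _ c]) blast
qed

lemma L0_sides_inner_pt:
  assumes "g \<in> L0_sides S" "F \<in> S" "F \<in> sides \<T>" "x \<in> rel_interior F"
  shows "g x = g (inner_pt F)"
proof -
  obtain c where "\<forall>x\<in>rel_interior F. g x = c" using assms(1,2) by (auto simp: L0_sides_def)
  then show ?thesis using assms(4) inner_pt_F[OF assms(3)] by simp
qed

end

locale discrete_problem = mesh \<Omega> \<T> for \<Omega> :: "(real^'n) set" and \<T> :: "(real^'n) set set" +
  fixes \<Gamma>D \<Gamma>N :: "(real^'n) set" and f g \<zeta> uD :: "real^'n \<Rightarrow> real"
  assumes parts_disjoint: "\<Gamma>D \<inter> \<Gamma>N = {}"
    and parts_cover: "bsides = sides_in \<Omega> \<T> \<Gamma>D \<union> sides_in \<Omega> \<T> \<Gamma>N"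
    and f: "f \<in> L0 \<T>" and g: "g \<in> L0_sides (sides_in \<Omega> \<T> \<Gamma>N)"
    and \<zeta>: "\<zeta> \<in> L0 \<T>" and \<zeta>_ess_inf: "ess_inf_on \<Omega> \<zeta> > 0"
    and uD: "uD \<in> L0_sides (sides_in \<Omega> \<T> \<Gamma>D)"
begin

abbreviation "SD \<equiv> sides_in \<Omega> \<T> \<Gamma>D"
abbreviation "SN \<equiv> sides_in \<Omega> \<T> \<Gamma>N"
abbreviation "I_val \<equiv> I_cr \<Omega> \<Gamma>D \<Gamma>N \<T> f g \<zeta> uD"
abbreviation "D_val \<equiv> D_rt \<Omega> \<Gamma>D \<Gamma>N \<T> f g \<zeta> uD"
abbreviation "K_primal \<equiv> K_cr \<Omega> \<Gamma>D \<T> \<zeta> uD"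
abbreviation "K_dual \<equiv> K_rt \<Omega> \<Gamma>N \<T> f g"

lemma splits_D: "splits_boundary \<Gamma>D" and splits_N: "splits_boundary \<Gamma>N"
proof -
  have "rel_interior F \<inter> \<Gamma>N = {}" if "F \<in> sides_in \<Omega> \<T> \<Gamma>D" for F
    using sides_inD(3)[OF that] parts_disjoint by blast
  moreover have "rel_interior F \<inter> \<Gamma>D = {}" if "F \<in> sides_in \<Omega> \<T> \<Gamma>N" for F
    using sides_inD(3)[OF that] parts_disjoint by blast
  ultimately show "splits_boundary \<Gamma>D" "splits_boundary \<Gamma>N"
    unfolding splits_boundary_def parts_cover by blast+
qed

lemma SD_SN_disjoint: "SD \<inter> SN = {}"
proof (rule ccontr)
  assume "SD \<inter> SN \<noteq> {}"
  then obtain F where F: "F \<in> SD" "F \<in> SN" by blast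
  have "inner_pt F \<in> rel_interior F" by (rule inner_pt_F[OF sides_inD(2)[OF F(1)]])
  then show False using sides_inD(3)[OF F(1)] sides_inD(3)[OF F(2)] parts_disjoint by blast
qed

lemma finite_SD: "finite SD" and finite_SN: "finite SN"
  using finite_boundary_sides unfolding parts_cover by simp_all

lemma sum_boundary: "(\<Sum>F\<in>bsides. h F) = (\<Sum>F\<in>SD. h F) + (\<Sum>F\<in>SN. (h F :: real))"
  unfolding parts_cover by (rule sum.union_disjoint[OF finite_SD finite_SN SD_SN_disjoint])

lemma \<zeta>_pos: assumes "T \<in> \<T>" shows "\<zeta> (inner_pt T) > 0"
proof -
  have lt: "esssup (restrict_space lebesgue \<Omega>) (\<lambda>x. - ereal (\<zeta> x)) < 0"
    using \<zeta>_ess_inf unfolding ess_inf_on_def by (simp add: ereal_less_uminus_reorder)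
  have "AE x in restrict_space lebesgue \<Omega>. - ereal (\<zeta> x) \<le> esssup (restrict_space lebesgue \<Omega>) (\<lambda>x. - ereal (\<zeta> x))"
    by (rule esssup_AE)
  then have "AE x in restrict_space lebesgue \<Omega>. 0 < \<zeta> x"
  proof eventually_elim
    case (elim x)
    then have "- ereal (\<zeta> x) < 0" using lt by (rule le_less_trans)
    then show ?case by simp
  qed
  then have ae: "AE x in lebesgue. x \<in> \<Omega> \<longrightarrow> 0 < \<zeta> x"
    using open_Omega by (subst (asm) AE_restrict_space_iff) auto
  have "elem_const (\<lambda>x. 0 < \<zeta> x)" by (rule elem_const_comp[OF elem_const_L0[OF \<zeta>]])
  from ae[unfolded AE_elem_const[OF this]] show ?thesis using assms by blast
qed

lemma K_cr_iff: "v \<in> K_primal \<longleftrightarrow> v \<in> CR \<and> (\<forall>T\<in>\<T>. norm (grd v T) \<le> \<zeta> (inner_pt T)) \<and>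
    (\<forall>F\<in>SD. smean v F = uD (inner_pt F))"
proof (cases "v \<in> CR")
  case True
  have "elem_const (\<lambda>x. norm (grad_h \<T> v x) \<le> \<zeta> x)"
    by (rule elem_const_comp2[OF elem_const_grad_h[OF True] elem_const_L0[OF \<zeta>]])
  note 1 = AE_elem_const[OF this]
  have 2: "AE_boundary \<Omega> \<T> \<Gamma>D (\<lambda>x. pi_h \<T> v x = uD x) \<longleftrightarrow> (\<forall>F\<in>SD. smean v F = uD (inner_pt F))"
  proof (rule AE_boundary_eq[OF splits_D])
    fix F x assume F: "F \<in> SD" "x \<in> rel_interior F"
    show "pi_h \<T> v x = uD x \<longleftrightarrow> smean v F = uD (inner_pt F)"
      unfolding pi_h_boundary_const[OF True sides_inD(1)[OF F(1)] F(2)] L0_sides_inner_pt[OF uD F(1) sides_inD(2)[OF F(1)] F(2)] ..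
  qed
  show ?thesis unfolding K_cr_def mem_Collect_eq 1 2 by simp
qed (simp add: K_cr_def)

lemma K_rt_iff: "y \<in> K_dual \<longleftrightarrow> y \<in> RT \<and> (\<forall>T\<in>\<T>. dvg y T = - f (inner_pt T)) \<and>
    (\<forall>F\<in>SN. ntr y F = g (inner_pt F))"
proof (cases "y \<in> RT")
  case True
  have "elem_const (\<lambda>x. div_h \<T> y x = - f x)"
    by (rule elem_const_comp2[OF elem_const_div_h[OF True] elem_const_L0[OF f]])
  note 1 = AE_elem_const[OF this]
  have 2: "AE_boundary \<Omega> \<T> \<Gamma>N (\<lambda>x. normal_trace \<Omega> \<T> y x = g x) \<longleftrightarrow> (\<forall>F\<in>SN. ntr y F = g (inner_pt F))"
  proof (rule AE_boundary_eq[OF splits_N])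
    fix F x assume F: "F \<in> SN" "x \<in> rel_interior F"
    show "normal_trace \<Omega> \<T> y x = g x \<longleftrightarrow> ntr y F = g (inner_pt F)"
      unfolding normal_trace_const[OF True sides_inD(1)[OF F(1)] F(2)] L0_sides_inner_pt[OF g F(1) sides_inD(2)[OF F(1)] F(2)] ..
  qed
  show ?thesis unfolding K_rt_def mem_Collect_eq 1 2 by simp
qed (simp add: K_rt_def)

text \<open>The primal and the dual functional as finite sums.\<close>

definition I_sum :: "(real^'n \<Rightarrow> real) \<Rightarrow> real" where
  "I_sum v = (\<Sum>T\<in>\<T>. vol T * (1/2 * (grd v T \<bullet> grd v T) - f (inner_pt T) * avg v T))
     - (\<Sum>F\<in>SN. area F * (g (inner_pt F) * smean v F))"

definition D_sum :: "(real^'n \<Rightarrow> real^'n) \<Rightarrow> real" where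
  "D_sum y = - (\<Sum>T\<in>\<T>. vol T * phi_star \<zeta> (inner_pt T) (avg y T)) + (\<Sum>F\<in>SD. area F * (ntr y F * uD (inner_pt F)))"

lemma l2_inner_elem_const:
  fixes v w :: "real^'n \<Rightarrow> 'b::euclidean_space"
  assumes "elem_const v" "elem_const w"
  shows "l2_inner \<Omega> v w = (\<Sum>T\<in>\<T>. vol T * (v (inner_pt T) \<bullet> w (inner_pt T)))"
  unfolding l2_inner_def by (rule integral_elem_const[OF elem_const_comp2[OF assms]])

lemma I_cr_eq:
  assumes v: "v \<in> K_primal"
  shows "I_val v = ereal (I_sum v)"
proof -
  have cr: "v \<in> CR" using v by (simp add: K_cr_iff)
  have 1: "l2_inner \<Omega> (grad_h \<T> v) (grad_h \<T> v) = (\<Sum>T\<in>\<T>. vol T * (grd v T \<bullet> grd v T))"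
    by (rule l2_inner_elem_const[OF elem_const_grad_h[OF cr] elem_const_grad_h[OF cr]])
  have 2: "l2_inner \<Omega> f (Pi_h \<T> v) = (\<Sum>T\<in>\<T>. vol T * (f (inner_pt T) \<bullet> avg v T))"
    by (rule l2_inner_elem_const[OF elem_const_L0[OF f] elem_const_Pi_h])
  have 3: "boundary_inner \<Omega> \<T> \<Gamma>N g (pi_h \<T> v) = (\<Sum>F\<in>SN. area F * (g (inner_pt F) * smean v F))"
    by (rule boundary_inner_eq[OF splits_N])
      (rule L0_sides_inner_pt[OF g _ sides_inD(2)], assumption+, rule pi_h_boundary_const[OF cr sides_inD(1)])
  show ?thesis
    using v unfolding I_cr_def I_sum_def 1 2 3
    by (simp add: sum_distrib_left sum_subtractf right_diff_distrib mult.left_commute)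
qed

lemma D_rt_eq:
  assumes y: "y \<in> K_dual"
  shows "D_val y = ereal (D_sum y)"
proof -
  have rt: "y \<in> RT" using y by (simp add: K_rt_iff)
  have "elem_const (\<lambda>x. phi_star \<zeta> x (Pi_h \<T> y x))"
    unfolding phi_star_def by (rule elem_const_comp2[OF elem_const_L0[OF \<zeta>] elem_const_Pi_h])
  note 1 = integral_elem_const[OF this]
  have 2: "boundary_inner \<Omega> \<T> \<Gamma>D (normal_trace \<Omega> \<T> y) uD = (\<Sum>F\<in>SD. area F * (ntr y F * uD (inner_pt F)))"
    by (rule boundary_inner_eq[OF splits_D])
      (rule normal_trace_const[OF rt sides_inD(1)], assumption+, rule L0_sides_inner_pt[OF uD _ sides_inD(2)])
  show ?thesis using y unfolding D_rt_def D_sum_def 1 2 by simp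
qed

lemma ibp_parts:
  assumes "v \<in> CR" "y \<in> RT"
  shows "(\<Sum>T\<in>\<T>. vol T * (avg y T \<bullet> grd v T + avg v T * dvg y T))
    = (\<Sum>F\<in>SD. area F * (smean v F * ntr y F)) + (\<Sum>F\<in>SN. area F * (smean v F * ntr y F))"
  unfolding discrete_ibp[OF assms] sum_boundary ..

lemma ibp_dual:
  assumes v: "v \<in> CR" and y: "y \<in> K_dual"
  shows "(\<Sum>T\<in>\<T>. vol T * (avg y T \<bullet> grd v T - f (inner_pt T) * avg v T))
    = (\<Sum>F\<in>SD. area F * (smean v F * ntr y F)) + (\<Sum>F\<in>SN. area F * (g (inner_pt F) * smean v F))"
proof -
  have rt: "y \<in> RT" and dv: "\<And>T. T \<in> \<T> \<Longrightarrow> dvg y T = - f (inner_pt T)"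
    and nt: "\<And>F. F \<in> SN \<Longrightarrow> ntr y F = g (inner_pt F)"
    using y by (simp_all add: K_rt_iff)
  have "(\<Sum>T\<in>\<T>. vol T * (avg y T \<bullet> grd v T - f (inner_pt T) * avg v T))
      = (\<Sum>T\<in>\<T>. vol T * (avg y T \<bullet> grd v T + avg v T * dvg y T))"
    by (rule sum.cong) (simp_all add: dv)
  also have "\<dots> = (\<Sum>F\<in>SD. area F * (smean v F * ntr y F)) + (\<Sum>F\<in>SN. area F * (smean v F * ntr y F))"
    by (rule ibp_parts[OF v rt])
  also have "(\<Sum>F\<in>SN. area F * (smean v F * ntr y F)) = (\<Sum>F\<in>SN. area F * (g (inner_pt F) * smean v F))"
    by (rule sum.cong) (simp_all add: nt)
  finally show ?thesis .
qed

text \<open>The derivative of \<open>phi_star\<close> at the averages of \<open>z\<close>; for a dual solution it is the gradient of the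
  primal solution.\<close>

definition dual_grad :: "(real^'n \<Rightarrow> real^'n) \<Rightarrow> (real^'n) set \<Rightarrow> real^'n" where
  "dual_grad z T = ball_proj (\<zeta> (inner_pt T)) (avg z T)"

text \<open>The admissible set is invariant under translations along \<open>w\<close>, and the derivative of the dual functional in this
  direction vanishes at the maximizer.\<close>

lemma dual_stationary:
  assumes z: "z \<in> K_dual"
    and max: "\<And>y. y \<in> RT \<Longrightarrow> D_val y \<le> D_val z"
    and w: "w \<in> RT" and div0: "\<And>T. T \<in> \<T> \<Longrightarrow> dvg w T = 0"
    and tr0: "\<And>F. F \<in> SN \<Longrightarrow> ntr w F = 0"
  shows "(\<Sum>T\<in>\<T>. vol T * (dual_grad z T \<bullet> avg w T)) = (\<Sum>F\<in>SD. area F * (ntr w F * uD (inner_pt F)))"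
proof -
  have zr: "z \<in> RT" using z by (simp add: K_rt_iff)
  define y where "y s = (\<lambda>x. z x + s *\<^sub>R w x)" for s
  note comb = RT_comb[OF zr w, folded y_def]
  have yK: "y s \<in> K_dual" for s
    unfolding K_rt_iff
  proof (intro conjI ballI)
    show "y s \<in> RT" by (rule comb(1))
    show "dvg (y s) T = - f (inner_pt T)" if "T \<in> \<T>" for T
      unfolding comb(3)[OF that] div0[OF that] using z that by (simp add: K_rt_iff)
    show "ntr (y s) F = g (inner_pt F)" if "F \<in> SN" for F
      unfolding comb(4)[OF sides_inD(1)[OF that]] tr0[OF that] using z that by (simp add: K_rt_iff)
  qed
  define h where "h s = - (\<Sum>T\<in>\<T>. vol T * phi_star \<zeta> (inner_pt T) (avg z T + s *\<^sub>R avg w T))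
      + (\<Sum>F\<in>SD. area F * ((ntr z F + s * ntr w F) * uD (inner_pt F)))" for s
  have h: "D_sum (y s) = h s" for s
  proof -
    have "(\<Sum>T\<in>\<T>. vol T * phi_star \<zeta> (inner_pt T) (avg (y s) T)) = (\<Sum>T\<in>\<T>. vol T * phi_star \<zeta> (inner_pt T) (avg z T + s *\<^sub>R avg w T))"
      by (rule sum.cong) (simp_all add: comb(2))
    moreover have "(\<Sum>F\<in>SD. area F * (ntr (y s) F * uD (inner_pt F))) = (\<Sum>F\<in>SD. area F * ((ntr z F + s * ntr w F) * uD (inner_pt F)))"
      by (rule sum.cong) (simp_all add: comb(4) sides_inD(1))
    ultimately show ?thesis by (simp only: D_sum_def h_def)
  qed
  have le: "h s \<le> h 0" for s
  proof -
    have "ereal (D_sum (y s)) \<le> ereal (D_sum z)"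
      using max[OF comb(1)[of s]] unfolding D_rt_eq[OF yK] D_rt_eq[OF z] .
    moreover have "D_sum z = h 0" by (simp add: D_sum_def h_def)
    ultimately show ?thesis by (simp add: h)
  qed
  have "(h has_real_derivative - (\<Sum>T\<in>\<T>. vol T * (dual_grad z T \<bullet> avg w T))
      + (\<Sum>F\<in>SD. area F * (ntr w F * uD (inner_pt F)))) (at 0)"
    unfolding h_def
  proof (intro DERIV_add DERIV_minus DERIV_sum DERIV_cmult DERIV_cmult_right)
    fix T assume T: "T \<in> \<T>"
    show "((\<lambda>s. phi_star \<zeta> (inner_pt T) (avg z T + s *\<^sub>R avg w T)) has_real_derivative dual_grad z T \<bullet> avg w T) (at 0)"
      using phi_star_line_derivative[where \<zeta> = \<zeta> and x = "inner_pt T" and z = "\<zeta> (inner_pt T)" and s = "avg z T" and e = "avg w T" and l = 0,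
          OF refl \<zeta>_pos[OF T]] by (simp add: dual_grad_def)
  next
    fix F assume "F \<in> SD"
    show "((\<lambda>s. ntr z F + s * ntr w F) has_real_derivative ntr w F) (at 0)"
      by (auto intro!: derivative_eq_intros)
  qed
  then have "- (\<Sum>T\<in>\<T>. vol T * (dual_grad z T \<bullet> avg w T)) + (\<Sum>F\<in>SD. area F * (ntr w F * uD (inner_pt F))) = 0"
    by (rule DERIV_local_max[where d = 1]) (use le in auto)
  then show ?thesis by simp
qed

text \<open>By stationarity the boundary terms equal the linear term of Taylor's formula.\<close>

lemma dual_error:
  assumes z: "z \<in> K_dual" and y: "y \<in> K_dual"
    and max: "\<And>y. y \<in> RT \<Longrightarrow> D_val y \<le> D_val z"
  shows "rho2_D \<Omega> \<Gamma>D \<Gamma>N \<T> f g \<zeta> uD z y = ereal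
          (l2_inner \<Omega>
             (\<lambda>x. hess_phi_star_mean \<zeta> (Pi_h \<T> y x) (Pi_h \<T> z x) x *v (Pi_h \<T> y x - Pi_h \<T> z x))
             (\<lambda>x. Pi_h \<T> y x - Pi_h \<T> z x))"
proof -
  have yr: "y \<in> RT" and zr: "z \<in> RT" using y z by (simp_all add: K_rt_iff)
  define w where "w = (\<lambda>x. y x + (-1) *\<^sub>R z x)"
  note comb = RT_comb[OF yr zr, where s = "-1", folded w_def]
  have aw: "avg w T = avg y T - avg z T" if "T \<in> \<T>" for T using comb(2)[OF that] by simp
  have nw: "ntr w F = ntr y F - ntr z F" if "F \<in> bsides" for F using comb(4)[OF that] by simp
  have st: "(\<Sum>T\<in>\<T>. vol T * (dual_grad z T \<bullet> avg w T)) = (\<Sum>F\<in>SD. area F * (ntr w F * uD (inner_pt F)))"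
  proof (rule dual_stationary[OF z max comb(1)])
    show "dvg w T = 0" if "T \<in> \<T>" for T using comb(3)[OF that] y z that by (simp add: K_rt_iff)
    show "ntr w F = 0" if "F \<in> SN" for F using nw[OF sides_inD(1)[OF that]] y z that by (simp add: K_rt_iff)
  qed
  have hc: "hess_phi_star_mean \<zeta> a b x = hess_phi_star_mean \<zeta> a b x'" if "\<zeta> x = \<zeta> x'" for a b x x'
  proof -
    have "hess_phi_star \<zeta> x = hess_phi_star \<zeta> x'" by (rule ext) (simp only: hess_phi_star_def that)
    then show ?thesis by (simp only: hess_phi_star_mean_def)
  qed
  have "elem_const (\<lambda>x. hess_phi_star_mean \<zeta> (Pi_h \<T> y x) (Pi_h \<T> z x) x *v (Pi_h \<T> y x - Pi_h \<T> z x))"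
  proof (rule elem_constI)
    fix T x assume T: "T \<in> \<T>" "x \<in> interior T"
    have e: "Pi_h \<T> y x = avg y T" "Pi_h \<T> z x = avg z T" "\<zeta> x = \<zeta> (inner_pt T)"
      using elem_constD[OF elem_const_Pi_h T] elem_constD[OF elem_const_L0[OF \<zeta>] T] by simp_all
    show "hess_phi_star_mean \<zeta> (Pi_h \<T> y x) (Pi_h \<T> z x) x *v (Pi_h \<T> y x - Pi_h \<T> z x)
        = hess_phi_star_mean \<zeta> (avg y T) (avg z T) (inner_pt T) *v (avg y T - avg z T)"
      unfolding e(1,2) hc[OF e(3)] ..
  qed
  then have "l2_inner \<Omega> (\<lambda>x. hess_phi_star_mean \<zeta> (Pi_h \<T> y x) (Pi_h \<T> z x) x *v (Pi_h \<T> y x - Pi_h \<T> z x))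
      (\<lambda>x. Pi_h \<T> y x - Pi_h \<T> z x)
     = (\<Sum>T\<in>\<T>. vol T * ((hess_phi_star_mean \<zeta> (avg y T) (avg z T) (inner_pt T) *v (avg y T - avg z T)) \<bullet> (avg y T - avg z T)))"
    by (rule l2_inner_elem_const[OF _ elem_const_comp2[OF elem_const_Pi_h elem_const_Pi_h]])
  also have "\<dots> = (\<Sum>T\<in>\<T>. vol T * (phi_star \<zeta> (inner_pt T) (avg y T) - phi_star \<zeta> (inner_pt T) (avg z T) - dual_grad z T \<bullet> avg w T))"
  proof (rule sum.cong)
    fix T assume T: "T \<in> \<T>"
    show "vol T * ((hess_phi_star_mean \<zeta> (avg y T) (avg z T) (inner_pt T) *v (avg y T - avg z T)) \<bullet> (avg y T - avg z T))
        = vol T * (phi_star \<zeta> (inner_pt T) (avg y T) - phi_star \<zeta> (inner_pt T) (avg z T) - dual_grad z T \<bullet> avg w T)"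
      unfolding phi_star_taylor[where \<zeta> = \<zeta> and x = "inner_pt T" and z = "\<zeta> (inner_pt T)", OF refl \<zeta>_pos[OF T]] dual_grad_def aw[OF T] ..
  qed simp
  also have "\<dots> = (\<Sum>T\<in>\<T>. vol T * phi_star \<zeta> (inner_pt T) (avg y T)) - (\<Sum>T\<in>\<T>. vol T * phi_star \<zeta> (inner_pt T) (avg z T))
      - (\<Sum>F\<in>SD. area F * (ntr w F * uD (inner_pt F)))"
    unfolding st[symmetric] by (simp only: right_diff_distrib sum_subtractf)
  also have "(\<Sum>F\<in>SD. area F * (ntr w F * uD (inner_pt F)))
      = (\<Sum>F\<in>SD. area F * (ntr y F * uD (inner_pt F))) - (\<Sum>F\<in>SD. area F * (ntr z F * uD (inner_pt F)))"
    unfolding sum_subtractf[symmetric]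
    by (rule sum.cong) (simp_all add: nw sides_inD(1) left_diff_distrib right_diff_distrib)
  finally have "l2_inner \<Omega> (\<lambda>x. hess_phi_star_mean \<zeta> (Pi_h \<T> y x) (Pi_h \<T> z x) x *v (Pi_h \<T> y x - Pi_h \<T> z x))
      (\<lambda>x. Pi_h \<T> y x - Pi_h \<T> z x) = - D_sum y + D_sum z"
    by (simp add: D_sum_def)
  then show ?thesis by (simp add: rho2_D_def D_rt_eq[OF y] D_rt_eq[OF z])
qed

text \<open>Stationarity of \<open>z\<close> makes \<open>dual_grad z - grd u\<close> orthogonal to the divergence-free fields without flux through the
  Neumann sides, so by the Helmholtz decomposition it is the gradient of some \<open>w\<close> with vanishing averages on the
  Dirichlet sides. Then \<open>u + w\<close> is admissible. Its energy is not smaller than that of \<open>u\<close>, while the obtuse angle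
  property of the projection bounds the energy difference by \<open>- 1/2 * (grd w T \<bullet> grd w T)\<close> on each element \<open>T\<close>.\<close>

lemma primal_gradient:
  assumes z: "z \<in> K_dual"
    and max: "\<And>y. y \<in> RT \<Longrightarrow> D_val y \<le> D_val z"
    and u: "u \<in> K_primal"
    and min: "\<And>v. v \<in> CR \<Longrightarrow> I_val u \<le> I_val v"
    and T: "T \<in> \<T>"
  shows "grd u T = dual_grad z T"
proof -
  have ucr: "u \<in> CR" and un: "\<And>T. T \<in> \<T> \<Longrightarrow> norm (grd u T) \<le> \<zeta> (inner_pt T)"
    and uuD: "\<And>F. F \<in> SD \<Longrightarrow> smean u F = uD (inner_pt F)" using u by (simp_all add: K_cr_iff)
  have sub: "SD \<subseteq> bsides" using parts_cover by blast
  obtain w y where w: "w \<in> CR" "\<And>F. F \<in> SD \<Longrightarrow> smean w F = 0"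
    and y: "y \<in> RT" "\<And>T. T \<in> \<T> \<Longrightarrow> dvg y T = 0"
      "\<And>F. F \<in> bsides - SD \<Longrightarrow> ntr y F = 0"
    and r: "\<And>T. T \<in> \<T> \<Longrightarrow> dual_grad z T - grd u T = grd w T + avg y T"
    by (rule discrete_helmholtz[OF sub, of "\<lambda>T. dual_grad z T - grd u T"]) (rule that)
  have yN: "ntr y F = 0" if "F \<in> SN" for F using y(3) that SD_SN_disjoint parts_cover by blast
  have pair: "(\<Sum>T\<in>\<T>. vol T * (avg y T \<bullet> grd v T)) = (\<Sum>F\<in>SD. area F * (smean v F * ntr y F))"
    if v: "v \<in> CR" for v
  proof -
    have "(\<Sum>T\<in>\<T>. vol T * (avg y T \<bullet> grd v T))
        = (\<Sum>T\<in>\<T>. vol T * (avg y T \<bullet> grd v T + avg v T * dvg y T))"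
      by (rule sum.cong) (simp_all add: y(2))
    also have "\<dots> = (\<Sum>F\<in>SD. area F * (smean v F * ntr y F)) + (\<Sum>F\<in>SN. area F * (smean v F * ntr y F))"
      by (rule ibp_parts[OF v y(1)])
    also have "(\<Sum>F\<in>SN. area F * (smean v F * ntr y F)) = 0"
      by (rule sum.neutral) (simp add: yN)
    finally show ?thesis by simp
  qed
  \<comment> \<open>\<open>avg y\<close> is orthogonal to \<open>dual_grad z - grd u\<close> by stationarity and to \<open>grd w\<close> by integration by parts,
    hence to itself\<close>
  have 1: "(\<Sum>T\<in>\<T>. vol T * (avg y T \<bullet> dual_grad z T)) = (\<Sum>T\<in>\<T>. vol T * (avg y T \<bullet> grd u T))"
  proof -
    have "(\<Sum>T\<in>\<T>. vol T * (dual_grad z T \<bullet> avg y T)) = (\<Sum>F\<in>SD. area F * (ntr y F * uD (inner_pt F)))"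
      by (rule dual_stationary[OF z max y(1,2) yN])
    also have "\<dots> = (\<Sum>F\<in>SD. area F * (smean u F * ntr y F))"
      by (rule sum.cong) (simp_all add: uuD)
    finally show ?thesis unfolding pair[OF ucr] by (simp only: inner_commute)
  qed
  have 2: "(\<Sum>T\<in>\<T>. vol T * (avg y T \<bullet> grd w T)) = 0"
    unfolding pair[OF w(1)] by (rule sum.neutral) (simp add: w(2))
  have "(\<Sum>T\<in>\<T>. vol T * (avg y T \<bullet> avg y T))
      = (\<Sum>T\<in>\<T>. vol T * (avg y T \<bullet> dual_grad z T) - vol T * (avg y T \<bullet> grd u T) - vol T * (avg y T \<bullet> grd w T))"
  proof (rule sum.cong)
    fix T assume "T \<in> \<T>"
    then have "avg y T = dual_grad z T - grd u T - grd w T" using r by simp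
    then have "avg y T \<bullet> avg y T = avg y T \<bullet> (dual_grad z T - grd u T - grd w T)" by (rule arg_cong)
    then show "vol T * (avg y T \<bullet> avg y T)
        = vol T * (avg y T \<bullet> dual_grad z T) - vol T * (avg y T \<bullet> grd u T) - vol T * (avg y T \<bullet> grd w T)"
      by (simp only: inner_diff_right right_diff_distrib)
  qed simp
  also have "\<dots> = 0" unfolding sum_subtractf 1 2 by simp
  finally have y0: "(\<Sum>T\<in>\<T>. vol T * (avg y T \<bullet> avg y T)) = 0" .
  have zero: "a T = 0" if "(\<Sum>T\<in>\<T>. vol T * (a T \<bullet> a T)) \<le> 0" "T \<in> \<T>" for a :: "_ \<Rightarrow> real^'n" and T
  proof -
    have nn: "\<forall>T\<in>\<T>. 0 \<le> vol T * (a T \<bullet> a T)" by simp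
    then have "(\<Sum>T\<in>\<T>. vol T * (a T \<bullet> a T)) = 0" using that(1) by (intro antisym sum_nonneg) auto
    then have "\<forall>T\<in>\<T>. vol T * (a T \<bullet> a T) = 0"
      using sum_nonneg_eq_0_iff[OF finite_T, of "\<lambda>T. vol T * (a T \<bullet> a T)"] nn by simp
    then have "vol T * (a T \<bullet> a T) = 0" using that(2) by (rule bspec)
    then show ?thesis using measure_T_pos[OF that(2)] by simp
  qed
  have W: "grd w T = dual_grad z T - grd u T" if "T \<in> \<T>" for T
    using r[OF that] zero[of "avg y" T] y0 that by simp
  \<comment> \<open>\<open>u + w\<close> has the projections as gradients, so it satisfies the gradient constraint\<close>
  note add = CR_add[OF ucr w(1)]
  have K: "(\<lambda>x. u x + w x) \<in> K_primal"
    unfolding K_cr_iff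
  proof (intro conjI ballI)
    show "(\<lambda>x. u x + w x) \<in> CR" by (rule add(1))
    show "norm (grd (\<lambda>x. u x + w x) T) \<le> \<zeta> (inner_pt T)" if "T \<in> \<T>" for T
      unfolding add(2)[OF that] W[OF that] using norm_ball_proj[OF \<zeta>_pos[OF that]] by (simp add: dual_grad_def)
    show "smean (\<lambda>x. u x + w x) F = uD (inner_pt F)" if "F \<in> SD" for F
      unfolding add(3)[OF sides_inD(1)[OF that]] using uuD[OF that] w(2)[OF that] by simp
  qed
  have "I_sum u \<le> I_sum (\<lambda>x. u x + w x)"
    using min[OF add(1)] unfolding I_cr_eq[OF u] I_cr_eq[OF K] by simp
  also have "I_sum (\<lambda>x. u x + w x) = I_sum u
      + (\<Sum>T\<in>\<T>. vol T * (grd u T \<bullet> grd w T + 1/2 * (grd w T \<bullet> grd w T) - f (inner_pt T) * avg w T))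
      - (\<Sum>F\<in>SN. area F * (g (inner_pt F) * smean w F))"
  proof -
    have "(\<Sum>T\<in>\<T>. vol T * (1/2 * (grd (\<lambda>x. u x + w x) T \<bullet> grd (\<lambda>x. u x + w x) T) - f (inner_pt T) * Pi_h \<T> (\<lambda>x. u x + w x) (inner_pt T)))
        = (\<Sum>T\<in>\<T>. vol T * (1/2 * (grd u T \<bullet> grd u T) - f (inner_pt T) * avg u T)
           + vol T * (grd u T \<bullet> grd w T + 1/2 * (grd w T \<bullet> grd w T) - f (inner_pt T) * avg w T))"
      by (rule sum.cong) (simp_all add: add(2,4) inner_add_left inner_add_right inner_commute algebra_simps)
    moreover have "(\<Sum>F\<in>SN. area F * (g (inner_pt F) * smean (\<lambda>x. u x + w x) F))
        = (\<Sum>F\<in>SN. area F * (g (inner_pt F) * smean u F) + area F * (g (inner_pt F) * smean w F))"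
      by (rule sum.cong) (simp_all add: add(3) sides_inD(1) distrib_left)
    ultimately show ?thesis by (simp add: I_sum_def sum.distrib)
  qed
  finally have "0 \<le> (\<Sum>T\<in>\<T>. vol T * (grd u T \<bullet> grd w T + 1/2 * (grd w T \<bullet> grd w T) - f (inner_pt T) * avg w T))
      - (\<Sum>F\<in>SN. area F * (g (inner_pt F) * smean w F))" by simp
  also have "(\<Sum>F\<in>SN. area F * (g (inner_pt F) * smean w F)) = (\<Sum>T\<in>\<T>. vol T * (avg z T \<bullet> grd w T - f (inner_pt T) * avg w T))"
    unfolding ibp_dual[OF w(1) z] by (simp add: w(2))
  also have "(\<Sum>T\<in>\<T>. vol T * (grd u T \<bullet> grd w T + 1/2 * (grd w T \<bullet> grd w T) - f (inner_pt T) * avg w T))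
      - (\<Sum>T\<in>\<T>. vol T * (avg z T \<bullet> grd w T - f (inner_pt T) * avg w T))
      = (\<Sum>T\<in>\<T>. vol T * (grd u T \<bullet> grd w T - avg z T \<bullet> grd w T + 1/2 * (grd w T \<bullet> grd w T)))"
    unfolding sum_subtractf[symmetric] by (rule sum.cong) (simp_all add: algebra_simps)
  also have "\<dots> \<le> (\<Sum>T\<in>\<T>. vol T * (- (1/2) * (grd w T \<bullet> grd w T)))"
  proof (rule sum_mono)
    fix T assume T: "T \<in> \<T>"
    \<comment> \<open>obtuse angle at the projection: \<open>grd u T\<close> lies in the ball onto which \<open>avg z T\<close> is projected\<close>
    have "(avg z T - dual_grad z T) \<bullet> (grd u T - dual_grad z T) \<le> 0"
      unfolding dual_grad_def by (rule ball_proj_obtuse[OF \<zeta>_pos[OF T] un[OF T]])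
    moreover have "grd u T - dual_grad z T = - grd w T" using W[OF T] by simp
    ultimately have "(avg z T - dual_grad z T) \<bullet> grd w T \<ge> 0" by simp
    moreover have "dual_grad z T = grd u T + grd w T" using W[OF T] by simp
    ultimately have "grd u T \<bullet> grd w T - avg z T \<bullet> grd w T + grd w T \<bullet> grd w T \<le> 0"
      by (simp add: inner_diff_left inner_add_left)
    then have "grd u T \<bullet> grd w T - avg z T \<bullet> grd w T + 1/2 * (grd w T \<bullet> grd w T) \<le> - (1/2) * (grd w T \<bullet> grd w T)"
      by linarith
    then show "vol T * (grd u T \<bullet> grd w T - avg z T \<bullet> grd w T + 1/2 * (grd w T \<bullet> grd w T)) \<le> vol T * (- (1/2) * (grd w T \<bullet> grd w T))"
      by (rule mult_left_mono) simp
  qed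
  also have "\<dots> = - (1/2) * (\<Sum>T\<in>\<T>. vol T * (grd w T \<bullet> grd w T))"
    by (simp add: sum_distrib_left sum_negf)
  finally have "(\<Sum>T\<in>\<T>. vol T * (grd w T \<bullet> grd w T)) \<le> 0" by simp
  from zero[OF this T] show ?thesis using W[OF T] by simp
qed

text \<open>Integration by parts with \<open>z\<close> replaces the load terms; what remains on each element is
  the quadratic term and the defect of the projection.\<close>

lemma primal_error:
  assumes z: "z \<in> K_dual"
    and max: "\<And>y. y \<in> RT \<Longrightarrow> D_val y \<le> D_val z"
    and u: "u \<in> K_primal"
    and min: "\<And>v. v \<in> CR \<Longrightarrow> I_val u \<le> I_val v"
    and v: "v \<in> K_primal"
  shows "rho2_I \<Omega> \<Gamma>D \<Gamma>N \<T> f g \<zeta> uD u v = ereal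
          (1/2 * l2_inner \<Omega> (\<lambda>x. grad_h \<T> v x - grad_h \<T> u x) (\<lambda>x. grad_h \<T> v x - grad_h \<T> u x)
           + l2_inner {x \<in> \<Omega>. norm (grad_h \<T> u x) = \<zeta> x}
               (\<lambda>x. norm (Pi_h \<T> z x) / \<zeta> x - 1)
               (\<lambda>x. (\<zeta> x)\<^sup>2 - grad_h \<T> u x \<bullet> grad_h \<T> v x))"
proof -
  have cr: "u \<in> CR" "v \<in> CR"
    and tr: "\<And>F. F \<in> SD \<Longrightarrow> smean v F = smean u F"
    using u v by (simp_all add: K_cr_iff)
  have eu: "elem_const (grad_h \<T> u)" and ev: "elem_const (grad_h \<T> v)"
    using cr by (simp_all add: elem_const_grad_h)
  have e\<zeta>: "elem_const \<zeta>" by (rule elem_const_L0[OF \<zeta>])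
  define defect where "defect T = (if norm (grd u T) = \<zeta> (inner_pt T)
    then (norm (avg z T) / \<zeta> (inner_pt T) - 1) * ((\<zeta> (inner_pt T))\<^sup>2 - grd u T \<bullet> grd v T) else 0)" for T
  have 1: "l2_inner \<Omega> (\<lambda>x. grad_h \<T> v x - grad_h \<T> u x) (\<lambda>x. grad_h \<T> v x - grad_h \<T> u x)
      = (\<Sum>T\<in>\<T>. vol T * ((grd v T - grd u T) \<bullet> (grd v T - grd u T)))"
    by (rule l2_inner_elem_const[OF elem_const_comp2[OF ev eu] elem_const_comp2[OF ev eu]])
  have 2: "l2_inner {x \<in> \<Omega>. norm (grad_h \<T> u x) = \<zeta> x}
       (\<lambda>x. norm (Pi_h \<T> z x) / \<zeta> x - 1) (\<lambda>x. (\<zeta> x)\<^sup>2 - grad_h \<T> u x \<bullet> grad_h \<T> v x)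
      = (\<Sum>T\<in>\<T>. vol T * defect T)"
  proof -
    define k where "k x = (if norm (grad_h \<T> u x) = \<zeta> x
       then (norm (Pi_h \<T> z x) / \<zeta> x - 1) * ((\<zeta> x)\<^sup>2 - grad_h \<T> u x \<bullet> grad_h \<T> v x) else 0)" for x
    have "l2_inner {x \<in> \<Omega>. norm (grad_h \<T> u x) = \<zeta> x}
       (\<lambda>x. norm (Pi_h \<T> z x) / \<zeta> x - 1) (\<lambda>x. (\<zeta> x)\<^sup>2 - grad_h \<T> u x \<bullet> grad_h \<T> v x)
      = (LINT x:\<Omega>|lebesgue. k x)"
      unfolding l2_inner_def set_lebesgue_integral_def
      by (rule Bochner_Integration.integral_cong) (auto simp: k_def indicator_def)
    also have "\<dots> = (\<Sum>T\<in>\<T>. vol T * k (inner_pt T))"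
    proof (rule integral_elem_const, rule elem_constI)
      fix T x assume T: "T \<in> \<T>" "x \<in> interior T"
      show "k x = k (inner_pt T)"
        unfolding k_def elem_constD[OF eu T] elem_constD[OF ev T] elem_constD[OF e\<zeta> T]
          elem_constD[OF elem_const_Pi_h T] ..
    qed
    finally show ?thesis by (simp add: k_def defect_def)
  qed
  have d: "(grd u T - avg z T) \<bullet> (grd v T - grd u T) = defect T" if T: "T \<in> \<T>" for T
    unfolding defect_def
    by (rule ball_proj_defect[OF \<zeta>_pos[OF T]]) (use primal_gradient[OF z max u min T] in \<open>simp add: dual_grad_def\<close>)
  have sD: "(\<Sum>F\<in>SD. area F * (smean v F * ntr z F)) = (\<Sum>F\<in>SD. area F * (smean u F * ntr z F))"
    by (rule sum.cong) (simp_all add: tr)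
  have i: "(\<Sum>F\<in>SN. area F * (g (inner_pt F) * smean w F)) = (\<Sum>T\<in>\<T>. vol T * (avg z T \<bullet> grd w T - f (inner_pt T) * avg w T))
      - (\<Sum>F\<in>SD. area F * (smean w F * ntr z F))" if "w \<in> CR" for w
    using ibp_dual[OF that z] by simp
  have "I_sum v - I_sum u = (\<Sum>T\<in>\<T>. vol T * (1/2 * (grd v T \<bullet> grd v T) - f (inner_pt T) * avg v T))
      - (\<Sum>T\<in>\<T>. vol T * (avg z T \<bullet> grd v T - f (inner_pt T) * avg v T))
      - ((\<Sum>T\<in>\<T>. vol T * (1/2 * (grd u T \<bullet> grd u T) - f (inner_pt T) * avg u T))
      - (\<Sum>T\<in>\<T>. vol T * (avg z T \<bullet> grd u T - f (inner_pt T) * avg u T)))"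
    unfolding I_sum_def i[OF cr(1)] i[OF cr(2)] sD by simp
  also have "\<dots> = (\<Sum>T\<in>\<T>. 1/2 * (vol T * ((grd v T - grd u T) \<bullet> (grd v T - grd u T)))
      + vol T * ((grd u T - avg z T) \<bullet> (grd v T - grd u T)))"
    unfolding sum_subtractf[symmetric]
    by (rule sum.cong) (simp_all add: inner_diff_left inner_diff_right inner_commute algebra_simps)
  also have "\<dots> = (\<Sum>T\<in>\<T>. 1/2 * (vol T * ((grd v T - grd u T) \<bullet> (grd v T - grd u T))) + vol T * defect T)"
    by (rule sum.cong) (simp_all add: d)
  finally have "I_sum v - I_sum u = 1/2 * (\<Sum>T\<in>\<T>. vol T * ((grd v T - grd u T) \<bullet> (grd v T - grd u T)))
      + (\<Sum>T\<in>\<T>. vol T * defect T)"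
    by (simp only: sum.distrib sum_distrib_left)
  then show ?thesis
    unfolding 1 2 rho2_I_def I_cr_eq[OF u] I_cr_eq[OF v] by simp
qed

end

theorem lemma6p3:
  fixes \<Omega> \<Gamma>D \<Gamma>N :: "(real^'n) set" and \<T> :: "(real^'n) set set"
    and f g \<zeta> uD u :: "real^'n \<Rightarrow> real" and z :: "real^'n \<Rightarrow> real^'n"
  assumes domain: "bounded \<Omega>" "lipschitz_domain \<Omega>"
    and mesh: "simplicial_mesh \<Omega> \<T>"
    and bdry: "frontier \<Omega> = closure \<Gamma>D \<union> closure \<Gamma>N" "\<Gamma>D \<inter> \<Gamma>N = {}"
      "openin (top_of_set (frontier \<Omega>)) \<Gamma>D" "openin (top_of_set (frontier \<Omega>)) \<Gamma>N"
      "boundary_measure \<Omega> \<T> \<Gamma>D > 0"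
    and bdry_sides: "boundary_sides \<Omega> \<T> = sides_in \<Omega> \<T> \<Gamma>D \<union> sides_in \<Omega> \<T> \<Gamma>N"
    and data: "f \<in> L0 \<T>" "g \<in> L0_sides (sides_in \<Omega> \<T> \<Gamma>N)"
      "\<zeta> \<in> L0 \<T>" "ess_inf_on \<Omega> \<zeta> > 0" "uD \<in> L0_sides (sides_in \<Omega> \<T> \<Gamma>D)"
      "\<exists>uD_hat \<in> crouzeix_raviart \<Omega> \<T>.
         AE_boundary \<Omega> \<T> \<Gamma>D (\<lambda>x. pi_h \<T> uD_hat x = uD x) \<and>
         linf_norm \<Omega> (\<lambda>x. grad_h \<T> uD_hat x /\<^sub>R \<zeta> x) < 1"
    and primal: "u \<in> K_cr \<Omega> \<Gamma>D \<T> \<zeta> uD"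
      "\<forall>v \<in> crouzeix_raviart \<Omega> \<T>. I_cr \<Omega> \<Gamma>D \<Gamma>N \<T> f g \<zeta> uD u \<le> I_cr \<Omega> \<Gamma>D \<Gamma>N \<T> f g \<zeta> uD v"
    and dual: "z \<in> K_rt \<Omega> \<Gamma>N \<T> f g"
      "\<forall>y \<in> raviart_thomas \<Omega> \<T>. D_rt \<Omega> \<Gamma>D \<Gamma>N \<T> f g \<zeta> uD y \<le> D_rt \<Omega> \<Gamma>D \<Gamma>N \<T> f g \<zeta> uD z"
  shows
    "(\<forall>v \<in> K_cr \<Omega> \<Gamma>D \<T> \<zeta> uD.
        rho2_I \<Omega> \<Gamma>D \<Gamma>N \<T> f g \<zeta> uD u v = ereal
          (1/2 * l2_inner \<Omega> (\<lambda>x. grad_h \<T> v x - grad_h \<T> u x) (\<lambda>x. grad_h \<T> v x - grad_h \<T> u x)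
           + l2_inner {x \<in> \<Omega>. norm (grad_h \<T> u x) = \<zeta> x}
               (\<lambda>x. norm (Pi_h \<T> z x) / \<zeta> x - 1)
               (\<lambda>x. (\<zeta> x)\<^sup>2 - grad_h \<T> u x \<bullet> grad_h \<T> v x)))
     \<and> (\<forall>y \<in> K_rt \<Omega> \<Gamma>N \<T> f g.
        rho2_D \<Omega> \<Gamma>D \<Gamma>N \<T> f g \<zeta> uD z y = ereal
          (l2_inner \<Omega>
             (\<lambda>x. hess_phi_star_mean \<zeta> (Pi_h \<T> y x) (Pi_h \<T> z x) x *v (Pi_h \<T> y x - Pi_h \<T> z x))
             (\<lambda>x. Pi_h \<T> y x - Pi_h \<T> z x)))"
proof -
  interpret mesh \<Omega> \<T> by unfold_locales (rule domain(2), rule mesh)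
  interpret discrete_problem \<Omega> \<T> \<Gamma>D \<Gamma>N f g \<zeta> uD
    by unfold_locales (rule bdry(2), rule bdry_sides, rule data(1), rule data(2), rule data(3), rule data(4), rule data(5))
  note max = dual(2)[rule_format] and min = primal(2)[rule_format]
  show ?thesis
    by (intro conjI ballI primal_error[OF dual(1) max primal(1) min] dual_error[OF dual(1) _ max])
qed

end
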